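(* Let $p>q$ be primes and let $A$ be a skew left brace of size $pq$. All representations are over $\mathbb{C}$ and are counted up to equivalence. If $p\not\equiv 1 \pmod q$, then $A$ has exactly $p^2q^2$ one-dimensional representations. If $p\equiv 1\pmod q$, fix an element $g\in\mathbb{Z}_p$ of multiplicative order $q$, and let $B,C,D,E,F_\gamma$ ($1<\gamma\le q$), $G_\mu$ ($1<\mu\le q$) be the skew left braces of order $pq$ defined in the context. Then: (1) if $A\cong B$, then $A$ has exactly $p^2q^2$ one-dimensional representations; (2) if $A\cong C$, then $A$ has exactly $q^2$ one-dimensional representations and $p^2-1$ irreducible representations of dimension $q$; (3) if $A\cong D$, or $A\cong F_\gamma$ for some $1<\gamma<q$, or $A\cong G_\mu$ for some $1<\mu\le q$, then $A$ has exactly $q^2$ one-dimensional representations, $2(p-1)$ irreducible representations of dimension $q$, and $(p-1)^2/q^2$ irreducible representations of dimension $q^2$; (4) if $A\cong E$ or $A\cong F_q$, then $A$ has exactly $pq^2$ one-dimensional representations and $p^2-p$ irreducible representations of dimension $q$.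
   Context: A skew left brace is a set $A$ with two group structures $(A,\cdot)$ (additive group) and $(A,\circ)$ (multiplicative group) such that $a\circ(b\cdot c)=(a\circ b)\cdot a^{-1}\cdot(a\circ c)$ for all $a,b,c\in A$, where $a^{-1}$ is the inverse in $(A,\cdot)$. It is trivial if $\cdot$ and $\circ$ coincide. Put $\lambda^{\mathrm{op}}_a(b)=(a\circ b)\cdot a^{-1}$; this defines a homomorphism $\lambda^{\mathrm{op}}:(A,\circ)\to\operatorname{Aut}(A,\cdot)$. A representation of $A$ is a triple $(V,\beta,\rho)$ where $V$ is a (here finite-dimensional complex) vector space and $\beta:(A,\cdot)\to \mathrm{GL}(V)$, $\rho:(A,\circ)\to \mathrm{GL}(V)$ are group representations with $\beta(\lambda^{\mathrm{op}}_a(b))=\rho(a)\beta(b)\rho(a)^{-1}$ for all $a,b\in A$. Its dimension is $\dim V$. It is irreducible if $V\neq 0$ and no proper nonzero subspace of $V$ is invariant under both $\beta$ and $\rho$. Two representations are equivalent if there is a linear isomorphism intertwining both the $\beta$'s and the $\rho$'s. Suppose $p\equiv1\pmod q$ and $g\in\mathbb{Z}_p$ has multiplicative order $q$. The following skew left braces have underlying set $\mathbb{Z}_p\times\mathbb{Z}_q$; the additive group operation is written $+$ (it plays the role of $\cdot$ above). With $(n,m)+(s,t)=(n+s,m+t)$: - $B$: the trivial skew brace ($\circ=+$); - $C$: $(n,m)\circ(s,t)=(n+g^m s,\,m+t)$. With $(n,m)+(s,t)=(n+g^m s,\,m+t)$: - $D$: the trivial skew brace ($\circ=+$); - $E$: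 $(n,m)\circ(s,t)=(g^t n+g^m s,\,m+t)$; - $F_\gamma$, for integers $1<\gamma\le q$: $(n,m)\circ(s,t)=(n+(g^\gamma)^m s,\,m+t)$; - $G_\mu$, for integers $1<\mu\le q$: $(n,m)\circ(s,t)=(g^t n+(g^\mu)^m s,\,m+t)$. Known classification (Acri–Bonatto), which may be used: if $p\not\equiv1\pmod q$, the only skew left brace of order $pq$ up to isomorphism is the trivial one on the cyclic group $\mathbb{Z}_{pq}$; if $p\equiv1\pmod q$, the $2q+2$ skew left braces listed above form a complete list up to isomorphism. *)

theory Defs
  imports
    Complex_Main
    "HOL-Library.Function_Algebras"
    "HOL-Algebra.Bij"
    "HOL-Number_Theory.Number_Theory"
begin

section \<open>Skew left braces\<close>

text \<open>The inherited monoid part of the record is the (possibly non-commutative) additive group,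
  written \<open>(A, \<cdot>)\<close> in the literature.\<close>

record 'a skew_brace = "'a monoid" +
  circ :: "'a \<Rightarrow> 'a \<Rightarrow> 'a"  (infixl \<open>\<star>\<index>\<close> 70)
  circ_one :: 'a

definition circ_group :: "('a, 'm) skew_brace_scheme \<Rightarrow> 'a monoid" where
  "circ_group A = \<lparr>carrier = carrier A, monoid.mult = circ A, one = circ_one A\<rparr>"

definition skew_left_brace :: "('a, 'm) skew_brace_scheme \<Rightarrow> bool" where
  "skew_left_brace A \<longleftrightarrow>
     group A \<and> group (circ_group A) \<and>
     (\<forall>a\<in>carrier A. \<forall>b\<in>carrier A. \<forall>c\<in>carrier A.
        a \<star>\<^bsub>A\<^esub> (b \<otimes>\<^bsub>A\<^esub> c) = (a \<star>\<^bsub>A\<^esub> b) \<otimes>\<^bsub>A\<^esub> inv\<^bsub>A\<^esub> a \<otimes>\<^bsub>A\<^esub> (a \<star>\<^bsub>A\<^esub> c))"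

definition lambda_op :: "('a, 'm) skew_brace_scheme \<Rightarrow> 'a \<Rightarrow> 'a \<Rightarrow> 'a" where
  "lambda_op A a b = (a \<star>\<^bsub>A\<^esub> b) \<otimes>\<^bsub>A\<^esub> inv\<^bsub>A\<^esub> a"

definition brace_iso ::
    "('a, 'm) skew_brace_scheme \<Rightarrow> ('b, 'n) skew_brace_scheme \<Rightarrow> bool" where
  "brace_iso A B \<longleftrightarrow> iso A B \<inter> iso (circ_group A) (circ_group B) \<noteq> {}"


section \<open>Representations of skew left braces\<close>

type_synonym ('a, 'v) brace_rep = "'v set \<times> ('a \<Rightarrow> 'v \<Rightarrow> 'v) \<times> ('a \<Rightarrow> 'v \<Rightarrow> 'v)"

text \<open>The space carrying a representation is a finite-dimensional subspace \<open>V\<close> of a fixed ambient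
  complex vector space. As with \<^const>\<open>Bij\<close>, elements of \<open>GL V\<close> are functions that are extensional on \<open>V\<close>.\<close>

locale complex_ambient_space = vector_space scale
  for scale :: "complex \<Rightarrow> 'v::ab_group_add \<Rightarrow> 'v"  (infixr \<open>*s\<close> 75)
begin

definition linear_between :: "'v set \<Rightarrow> 'v set \<Rightarrow> ('v \<Rightarrow> 'v) \<Rightarrow> bool" where
  "linear_between V W f \<longleftrightarrow> f \<in> V \<rightarrow> W \<and>
     (\<forall>x\<in>V. \<forall>y\<in>V. f (x + y) = f x + f y) \<and> (\<forall>c. \<forall>x\<in>V. f (c *s x) = c *s f x)"

definition GL :: "'v set \<Rightarrow> ('v \<Rightarrow> 'v) monoid" where
  "GL V = BijGroup V \<lparr>carrier := {f \<in> Bij V. linear_between V V f}\<rparr>"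

definition findim_subspace :: "'v set \<Rightarrow> bool" where
  "findim_subspace V \<longleftrightarrow> (\<exists>S. finite S \<and> span S = V)"

definition brace_reps :: "('a, 'm) skew_brace_scheme \<Rightarrow> ('a, 'v) brace_rep set" where
  "brace_reps A = {(V, \<beta>, \<rho>). findim_subspace V \<and>
     \<beta> \<in> hom A (GL V) \<and> \<rho> \<in> hom (circ_group A) (GL V) \<and>
     (\<forall>a\<in>carrier A. \<forall>b\<in>carrier A.
        \<beta> (lambda_op A a b) = \<rho> a \<otimes>\<^bsub>GL V\<^esub> \<beta> b \<otimes>\<^bsub>GL V\<^esub> inv\<^bsub>GL V\<^esub> (\<rho> a))}"

definition rep_dim :: "('a, 'v) brace_rep \<Rightarrow> nat" where
  "rep_dim R = dim (fst R)"

definition irreducible_rep ::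
    "('a, 'm) skew_brace_scheme \<Rightarrow> ('a, 'v) brace_rep \<Rightarrow> bool" where
  "irreducible_rep A = (\<lambda>(V, \<beta>, \<rho>). V \<noteq> {0} \<and>
     (\<forall>W. subspace W \<and> W \<subseteq> V \<and> (\<forall>a\<in>carrier A. \<beta> a ` W \<subseteq> W \<and> \<rho> a ` W \<subseteq> W)
        \<longrightarrow> W = {0} \<or> W = V))"

definition rep_equiv ::
    "('a, 'm) skew_brace_scheme \<Rightarrow> (('a, 'v) brace_rep \<times> ('a, 'v) brace_rep) set" where
  "rep_equiv A = {((V, \<beta>, \<rho>), (V', \<beta>', \<rho>')).
     (V, \<beta>, \<rho>) \<in> brace_reps A \<and> (V', \<beta>', \<rho>') \<in> brace_reps A \<and>
     (\<exists>\<phi>. linear_between V V' \<phi> \<and> bij_betw \<phi> V V' \<and>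
        (\<forall>a\<in>carrier A. \<forall>v\<in>V. \<phi> (\<beta> a v) = \<beta>' a (\<phi> v) \<and> \<phi> (\<rho> a v) = \<rho>' a (\<phi> v)))}"

text \<open>Both counts are cardinalities of sets of equivalence classes; a positive value therefore
  also says that there are only finitely many classes.\<close>

definition num_reps :: "('a, 'm) skew_brace_scheme \<Rightarrow> nat \<Rightarrow> nat" where
  "num_reps A d = card ({R \<in> brace_reps A. rep_dim R = d} // rep_equiv A)"

definition num_irreps :: "('a, 'm) skew_brace_scheme \<Rightarrow> nat \<Rightarrow> nat" where
  "num_irreps A d =
     card ({R \<in> brace_reps A. irreducible_rep A R \<and> rep_dim R = d} // rep_equiv A)"

end

text \<open>Every finite-dimensional complex vector space is isomorphic to a subspace of the space of
  complex sequences, so up to equivalence nothing is lost by taking that space as ambient space.\<close>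

definition seq_scale :: "complex \<Rightarrow> (nat \<Rightarrow> complex) \<Rightarrow> nat \<Rightarrow> complex" where
  "seq_scale c x = (\<lambda>i. c * x i)"

global_interpretation cseq: complex_ambient_space seq_scale
  by unfold_locales (auto simp: seq_scale_def fun_eq_iff algebra_simps)


section \<open>The skew left braces of order \<open>pq\<close>\<close>

text \<open>Residues modulo \<open>p\<close> and \<open>q\<close> are represented by the least non-negative ones. The exponents
  \<open>m\<close>, \<open>t\<close> below are such representatives modulo \<open>q\<close>; this is immaterial when \<open>g\<close> has
  multiplicative order \<open>q\<close> modulo \<open>p\<close>.\<close>

definition pq_brace :: "nat \<Rightarrow> nat \<Rightarrow> (nat \<times> nat \<Rightarrow> nat \<times> nat \<Rightarrow> nat \<times> nat) \<Rightarrow>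
    (nat \<times> nat \<Rightarrow> nat \<times> nat \<Rightarrow> nat \<times> nat) \<Rightarrow> (nat \<times> nat) skew_brace" where
  "pq_brace p q ad ci =
     \<lparr>carrier = {..<p} \<times> {..<q}, monoid.mult = ad, one = (0, 0), circ = ci, circ_one = (0, 0)\<rparr>"

definition dir_op :: "nat \<Rightarrow> nat \<Rightarrow> nat \<times> nat \<Rightarrow> nat \<times> nat \<Rightarrow> nat \<times> nat" where
  "dir_op p q = (\<lambda>(n, m) (s, t). ((n + s) mod p, (m + t) mod q))"

definition semidir_op :: "nat \<Rightarrow> nat \<Rightarrow> nat \<Rightarrow> nat \<times> nat \<Rightarrow> nat \<times> nat \<Rightarrow> nat \<times> nat" where
  "semidir_op p q h = (\<lambda>(n, m) (s, t). ((n + h ^ m * s) mod p, (m + t) mod q))"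

definition brace_B :: "nat \<Rightarrow> nat \<Rightarrow> (nat \<times> nat) skew_brace" where
  "brace_B p q = pq_brace p q (dir_op p q) (dir_op p q)"

definition brace_C :: "nat \<Rightarrow> nat \<Rightarrow> nat \<Rightarrow> (nat \<times> nat) skew_brace" where
  "brace_C p q g = pq_brace p q (dir_op p q) (semidir_op p q g)"

text \<open>The remaining braces have the non-abelian additive group \<open>(n, m) + (s, t) = (n + g\<^sup>m s, m + t)\<close>.\<close>

definition brace_D :: "nat \<Rightarrow> nat \<Rightarrow> nat \<Rightarrow> (nat \<times> nat) skew_brace" where
  "brace_D p q g = pq_brace p q (semidir_op p q g) (semidir_op p q g)"

definition brace_E :: "nat \<Rightarrow> nat \<Rightarrow> nat \<Rightarrow> (nat \<times> nat) skew_brace" where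
  "brace_E p q g = pq_brace p q (semidir_op p q g)
     (\<lambda>(n, m) (s, t). ((g ^ t * n + g ^ m * s) mod p, (m + t) mod q))"

definition brace_F :: "nat \<Rightarrow> nat \<Rightarrow> nat \<Rightarrow> nat \<Rightarrow> (nat \<times> nat) skew_brace" where
  "brace_F p q g \<gamma> = pq_brace p q (semidir_op p q g) (semidir_op p q (g ^ \<gamma>))"

definition brace_G :: "nat \<Rightarrow> nat \<Rightarrow> nat \<Rightarrow> nat \<Rightarrow> (nat \<times> nat) skew_brace" where
  "brace_G p q g \<mu> = pq_brace p q (semidir_op p q g)
     (\<lambda>(n, m) (s, t). ((g ^ t * n + (g ^ \<mu>) ^ m * s) mod p, (m + t) mod q))"

end

theory Submission
  imports Defs "HOL-Algebra.Sylow"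
begin

text \<open>A representation of a skew left brace \<open>A\<close> is the same thing as a representation of the semidirect
  product \<open>\<Gamma>\<close> of its additive group by its circle group along \<open>\<lambda>\<^sup>o\<^sup>p\<close>. For the braces of order \<open>pq\<close>, this \<open>\<Gamma>\<close>
  is a split extension of \<open>H = \<int>\<^sub>q\<^sup>2\<close> by \<open>N = \<int>\<^sub>p\<^sup>2\<close>, and \<open>H\<close> acts diagonally on \<open>N\<close> for a suitable choice of
  coordinates.

  Let \<open>V\<close> be an irreducible representation of a split extension \<open>\<Gamma>\<close> of finite abelian groups, and let \<open>w\<close> be a common
  eigenvector of \<open>H\<close>, with character \<open>\<Psi>\<close>. The components of \<open>w\<close> in the \<open>N\<close>-eigenspaces span a
  \<open>\<Gamma>\<close>-invariant subspace, so they form a basis of \<open>V\<close>; their characters form one \<open>H\<close>-orbit \<open>O\<close>,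
  \<open>\<Psi>\<close> together with any element of \<open>O\<close> determines \<open>V\<close>, and \<open>dim V = card O\<close>. Both groups act on
  \<open>V\<close> without multiplicities, so exactly \<open>(dim V)\<^sup>2\<close> pairs \<open>(\<omega>, \<Psi>)\<close> occur in \<open>V\<close>, whereas every pair occurs in
  exactly one irreducible representation up to equivalence. Hence \<open>d\<^sup>2\<close> times the number of irreducible
  representations of dimension \<open>d\<close> is \<open>card H\<close> times the number of characters of \<open>N\<close> with orbit of size \<open>d\<close>.\<close>

section \<open>Representations of finite abelian groups\<close>

text \<open>The stabilizers of Clifford-Mackey theory do not appear. An orbit with a character of a
  stabilizer is replaced by the pairs (\<omega>, \<Psi>), with \<Psi> a character of all of
  \<open>H\<close>; in general several pairs name the same representation, and the square of the
  dimension accounts for this. Each brace then contributes only the exponents of two weights: with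
  \<open>H\<close> in coordinates (m, t), an element multiplies the coordinates of \<open>N\<close>
  by \<open>g ^ (a * m + d * t)\<close> and \<open>g ^ (e * t)\<close>. Modulo q, (a, d, e) is (0,
  1, 1) for C, (1, \<gamma>, \<gamma>) for F_\<gamma> and (1, \<mu>, \<mu> - 1) for G_\<mu>. D and E
  are the values \<gamma> = 1 and \<mu> = 1, and B has trivial weights. Cases (3) and (4) of the
  theorem are the braces with a = 1, separated by whether e vanishes modulo q: it does exactly for E
  and F_q. If q does not divide p - 1, a coprimality argument on top of Cauchy's theorem shows
  directly that the brace is B.\<close>

context complex_ambient_space
begin

text \<open>The operators are constrained on \<open>V\<close> only and, unlike elements of
  \<open>GL V\<close>, need not be extensional; they can be composed and restricted to subgroups
  without cutting functions down to \<open>V\<close>.\<close>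

definition is_rep :: "('g, 'm) monoid_scheme \<Rightarrow> 'v set \<Rightarrow> ('g \<Rightarrow> 'v \<Rightarrow> 'v) \<Rightarrow> bool" where
  "is_rep G V U \<longleftrightarrow> subspace V \<and> (\<forall>x\<in>carrier G. linear_between V V (U x)) \<and>
     (\<forall>x\<in>carrier G. \<forall>y\<in>carrier G. \<forall>v\<in>V. U (x \<otimes>\<^bsub>G\<^esub> y) v = U x (U y v)) \<and>
     (\<forall>v\<in>V. U \<one>\<^bsub>G\<^esub> v = v)"

lemma linear_between_cong:
  assumes "\<And>x. x \<in> V \<Longrightarrow> f x = g x" "subspace V"
  shows "linear_between V W f \<longleftrightarrow> linear_between V W g"
  using assms unfolding linear_between_def by (auto simp: subspace_add subspace_scale Pi_iff)

lemma linear_between_sum: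
  assumes "linear_between V W f" "subspace V" "\<And>i. i \<in> I \<Longrightarrow> x i \<in> V"
  shows "f (sum x I) = (\<Sum>i\<in>I. f (x i))"
  using assms(3)
proof (induction I rule: infinite_finite_induct)
  case (insert i I)
  then show ?case
    using assms(1,2) by (simp add: linear_between_def subspace_sum)
next
  case empty
  have "f (0 *s 0) = 0 *s f 0"
    using assms subspace_0 unfolding linear_between_def by blast
  then show ?case by simp
next
  case (infinite I)
  have "f (0 *s 0) = 0 *s f 0"
    using assms subspace_0 unfolding linear_between_def by blast
  then show ?case using infinite by simp
qed

lemma linear_between_0: "linear_between V W f \<Longrightarrow> subspace V \<Longrightarrow> f 0 = 0"
  using linear_between_sum[of V W f "{}"] by simp

lemma linear_between_diff:
  assumes "linear_between V W f" "subspace V" "x \<in> V" "y \<in> V"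
  shows "f (x - y) = f x - f y"
proof -
  have "f (x + (-1) *s y) = f x + (-1) *s f y"
    using assms subspace_scale[of V y "-1"] unfolding linear_between_def by metis
  then show ?thesis by simp
qed

end

text \<open>The orthogonality relations say that \<open>X\<close> indexes all characters of \<open>G\<close>, each of them once.\<close>

locale dual_pair = comm_group G for G (structure) +
  fixes X :: "'c set" and e :: "'c \<Rightarrow> 'a \<Rightarrow> complex"
  assumes finite_carrier: "finite (carrier G)" and finite_X: "finite X"
    and e_mult: "c \<in> X \<Longrightarrow> x \<in> carrier G \<Longrightarrow> y \<in> carrier G \<Longrightarrow> e c (x \<otimes> y) = e c x * e c y"
    and e_cnj: "c \<in> X \<Longrightarrow> x \<in> carrier G \<Longrightarrow> cnj (e c x) * e c x = 1"
    and e_rows: "c \<in> X \<Longrightarrow> c' \<in> X \<Longrightarrow>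
      (\<Sum>x\<in>carrier G. cnj (e c' x) * e c x) = (if c = c' then of_nat (order G) else 0)"
    and e_cols: "x \<in> carrier G \<Longrightarrow>
      (\<Sum>c\<in>X. cnj (e c x)) = (if x = \<one> then of_nat (order G) else 0)"
begin

lemma e_nonzero: "c \<in> X \<Longrightarrow> x \<in> carrier G \<Longrightarrow> e c x \<noteq> 0"
  using e_cnj by fastforce

lemma order_nonzero: "(of_nat (order G) :: complex) \<noteq> 0"
  using finite_carrier order_gt_0_iff_finite by simp

lemma e_one: "c \<in> X \<Longrightarrow> e c \<one> = 1"
  using e_mult[of c \<one> \<one>] e_nonzero[of c \<one>] by simp

end

locale abelian_rep = complex_ambient_space scale + dual_pair G X e
  for scale :: "complex \<Rightarrow> 'v::ab_group_add \<Rightarrow> 'v"  (infixr \<open>*s\<close> 75)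
    and G :: "('g, 'm) monoid_scheme" (structure) and X :: "'c set" and e +
  fixes V :: "'v set" and U :: "'g \<Rightarrow> 'v \<Rightarrow> 'v"
  assumes rep: "is_rep G V U"
begin

lemma subspace_V: "subspace V"
  and U_linear: "x \<in> carrier G \<Longrightarrow> linear_between V V (U x)"
  and U_closed: "x \<in> carrier G \<Longrightarrow> v \<in> V \<Longrightarrow> U x v \<in> V"
  and U_add: "x \<in> carrier G \<Longrightarrow> v \<in> V \<Longrightarrow> w \<in> V \<Longrightarrow> U x (v + w) = U x v + U x w"
  and U_scale: "x \<in> carrier G \<Longrightarrow> v \<in> V \<Longrightarrow> U x (a *s v) = a *s U x v"
  and U_mult: "x \<in> carrier G \<Longrightarrow> y \<in> carrier G \<Longrightarrow> v \<in> V \<Longrightarrow> U (x \<otimes> y) v = U x (U y v)"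
  and U_one: "v \<in> V \<Longrightarrow> U \<one> v = v"
  using rep unfolding is_rep_def linear_between_def by blast+

text \<open>The isotypic projector: the average of the operators against the conjugate
  character.\<close>

definition proj :: "'c \<Rightarrow> 'v \<Rightarrow> 'v" where
  "proj c v = (1 / of_nat (order G)) *s (\<Sum>x\<in>carrier G. cnj (e c x) *s U x v)"

text \<open>Zero qualifies for every \<open>c\<close>, so that every component
  \<open>proj c v\<close> is covered.\<close>

definition eig :: "'c \<Rightarrow> 'v \<Rightarrow> bool" where
  "eig c v \<longleftrightarrow> v \<in> V \<and> (\<forall>x\<in>carrier G. U x v = e c x *s v)"

lemma proj_invariant:
  assumes "subspace W" "v \<in> W" "\<And>x. x \<in> carrier G \<Longrightarrow> U x v \<in> W"
  shows "proj c v \<in> W"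
  unfolding proj_def using assms by (intro subspace_scale subspace_sum) auto

lemma proj_closed: "v \<in> V \<Longrightarrow> proj c v \<in> V"
  by (rule proj_invariant[OF subspace_V]) (auto simp: U_closed)

lemma proj_linear: "linear_between V V (proj c)"
  unfolding linear_between_def
proof (intro conjI ballI allI)
  show "proj c \<in> V \<rightarrow> V" by (auto simp: proj_closed)
  fix x y assume "x \<in> V" "y \<in> V"
  then show "proj c (x + y) = proj c x + proj c y"
    by (simp add: proj_def U_add scale_right_distrib sum.distrib)
next
  fix a x assume "x \<in> V"
  then have "(\<Sum>xa\<in>carrier G. cnj (e c xa) *s U xa (a *s x)) =
    a *s (\<Sum>xa\<in>carrier G. cnj (e c xa) *s U xa x)"
    unfolding scale_sum_right by (intro sum.cong) (auto simp: U_scale mult.commute)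
  then show "proj c (a *s x) = a *s proj c x"
    by (simp add: proj_def mult.commute)
qed

text \<open>Applying \<open>U y\<close> shifts the summation variable by \<open>y\<close>, and
  multiplicativity of the conjugate character pulls out the factor \<open>e c y\<close>.\<close>

lemma eig_proj:
  assumes c: "c \<in> X" and v: "v \<in> V"
  shows "eig c (proj c v)"
  unfolding eig_def
proof (intro conjI ballI)
  show "proj c v \<in> V" using v by (rule proj_closed)
  fix y assume y: "y \<in> carrier G"
  let ?f = "\<lambda>x. cnj (e c x) *s U x v"
  have mem: "?f x \<in> V" if "x \<in> carrier G" for x
    using that v by (simp add: U_closed subspace_scale subspace_V)
  have "U y (\<Sum>x\<in>carrier G. ?f x) = (\<Sum>x\<in>carrier G. U y (?f x))"
    using linear_between_sum[OF U_linear[OF y] subspace_V, of "carrier G" ?f] mem by simp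
  also have "\<dots> = (\<Sum>x\<in>carrier G. e c y *s ?f (y \<otimes> x))"
  proof (rule sum.cong[OF refl])
    fix x assume x: "x \<in> carrier G"
    have "cnj (e c x) = e c y * cnj (e c (y \<otimes> x))"
      using e_mult[OF c y x] e_cnj[OF c y] by (simp add: mult.assoc[symmetric] mult.commute[of "e c y"])
    then show "U y (?f x) = e c y *s ?f (y \<otimes> x)"
      using x y v by (simp add: U_scale U_closed U_mult)
  qed
  also have "\<dots> = e c y *s (\<Sum>x\<in>carrier G. ?f (y \<otimes> x))"
    by (simp add: scale_sum_right)
  also have "(\<Sum>x\<in>carrier G. ?f (y \<otimes> x)) = (\<Sum>x\<in>carrier G. ?f x)"
    by (rule sum.reindex_bij_betw)
       (metis bij_betw_def inj_on_cmult surj_const_mult y)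
  finally show "U y (proj c v) = e c y *s proj c v"
    using y mem by (simp add: proj_def U_scale subspace_sum[OF subspace_V] mult.commute)
qed

text \<open>When the projectors are summed over all characters, column orthogonality leaves only the
  term of the identity element.\<close>

lemma proj_sum:
  assumes v: "v \<in> V"
  shows "(\<Sum>c\<in>X. proj c v) = v"
proof -
  have "(\<Sum>c\<in>X. proj c v)
      = (1 / of_nat (order G)) *s (\<Sum>x\<in>carrier G. \<Sum>c\<in>X. cnj (e c x) *s U x v)"
    by (subst sum.swap) (simp add: proj_def scale_sum_right)
  also have "(\<Sum>x\<in>carrier G. \<Sum>c\<in>X. cnj (e c x) *s U x v)
      = (\<Sum>x\<in>carrier G. (if x = \<one> then of_nat (order G) else 0) *s U x v)"
    by (intro sum.cong refl) (simp add: scale_sum_left[symmetric] e_cols)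
  also have "\<dots> = (\<Sum>x\<in>carrier G. if x = \<one> then of_nat (order G) *s v else 0)"
    using v by (intro sum.cong refl) (auto simp: U_one)
  also have "\<dots> = of_nat (order G) *s v"
    using finite_carrier by (simp add: sum.delta)
  finally show ?thesis using order_nonzero by simp
qed

lemma proj_of_eig:
  assumes "eig c v" "c \<in> X" "c' \<in> X"
  shows "proj c' v = (if c' = c then v else 0)"
proof -
  have "proj c' v = (1 / of_nat (order G)) *s (\<Sum>x\<in>carrier G. (cnj (e c' x) * e c x) *s v)"
    using assms unfolding proj_def eig_def by simp
  also have "\<dots> = (1 / of_nat (order G)) *s ((if c = c' then of_nat (order G) else 0) *s v)"
    using assms by (simp only: scale_sum_left[symmetric] e_rows)
  finally show ?thesis using order_nonzero by auto
qed

lemma exists_eig: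
  assumes "v \<in> V" "v \<noteq> 0"
  obtains c where "c \<in> X" "proj c v \<noteq> 0"
  using assms proj_sum sum.neutral by metis

text \<open>\<open>proj c\<close> isolates the term of \<open>c\<close> in a linear relation, and it
  separates two characters that would share a nonzero eigenvector.\<close>

lemma eig_family_independent:
  assumes J: "J \<subseteq> X" and v: "\<And>c. c \<in> J \<Longrightarrow> eig c (v c)" "\<And>c. c \<in> J \<Longrightarrow> v c \<noteq> 0"
  shows "inj_on v J" "independent (v ` J)"
proof -
  show inj: "inj_on v J"
    using v J proj_of_eig by (metis (no_types, lifting) inj_on_def subsetD)
  have fin: "finite J" using J finite_X finite_subset by blast
  show "independent (v ` J)"
  proof (rule independent_if_scalars_zero)
    show "finite (v ` J)" using fin by simp
    fix f x assume 0: "(\<Sum>x\<in>v ` J. f x *s x) = 0" and x: "x \<in> v ` J"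
    then obtain c where c: "c \<in> J" "x = v c" by auto
    have V: "v i \<in> V" if "i \<in> J" for i using v(1) that by (simp add: eig_def)
    have "0 = proj c (\<Sum>i\<in>J. f (v i) *s v i)"
      using 0 linear_between_0[OF proj_linear subspace_V]
      by (simp add: sum.reindex[OF inj])
    also have "\<dots> = (\<Sum>i\<in>J. proj c (f (v i) *s v i))"
      by (rule linear_between_sum[OF proj_linear subspace_V]) (simp add: V subspace_V subspace_scale)
    also have "\<dots> = (\<Sum>i\<in>J. if i = c then f (v c) *s v c else 0)"
    proof (rule sum.cong[OF refl])
      fix i assume i: "i \<in> J"
      have "proj c (f (v i) *s v i) = f (v i) *s proj c (v i)"
        using proj_linear V[OF i] by (simp add: linear_between_def)
      then show "proj c (f (v i) *s v i) = (if i = c then f (v c) *s v c else 0)"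
        using proj_of_eig[OF v(1)[OF i], of c] i c(1) subsetD[OF J] by auto
    qed
    also have "\<dots> = f (v c) *s v c" using c fin by simp
    finally show "f x = 0" using c v(2) by simp
  qed
qed

text \<open>Under multiplicity one, a chosen eigenvector for each occurring character gives a basis;
  it spans by \<open>proj_sum\<close>.\<close>

lemma dim_eq_card_eig:
  assumes mult1: "\<And>c v w. c \<in> X \<Longrightarrow> eig c v \<Longrightarrow> eig c w \<Longrightarrow> v \<noteq> 0 \<Longrightarrow> w \<in> span {v}"
  shows "dim V = card {c \<in> X. \<exists>v. eig c v \<and> v \<noteq> 0}"
proof -
  let ?J = "{c \<in> X. \<exists>v. eig c v \<and> v \<noteq> 0}"
  define v where "v c = (SOME v. eig c v \<and> v \<noteq> 0)" for c
  have v: "eig c (v c)" "v c \<noteq> 0" if "c \<in> ?J" for c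
    using that someI_ex[of "\<lambda>v. eig c v \<and> v \<noteq> 0"] unfolding v_def by auto
  have ind: "inj_on v ?J" "independent (v ` ?J)"
    using eig_family_independent[of ?J v] v by auto
  have "V \<subseteq> span (v ` ?J)"
  proof
    fix x assume x: "x \<in> V"
    have "proj c x \<in> span (v ` ?J)" if c: "c \<in> X" for c
    proof (cases "proj c x = 0")
      case True
      then show ?thesis by (simp add: span_zero)
    next
      case False
      then have cJ: "c \<in> ?J" using eig_proj[OF c x] c by auto
      then have "proj c x \<in> span {v c}"
        using mult1[OF c v(1)[OF cJ] eig_proj[OF c x] v(2)[OF cJ]] by simp
      then show ?thesis using cJ span_mono[of "{v c}" "v ` ?J"] by blast
    qed
    then have "(\<Sum>c\<in>X. proj c x) \<in> span (v ` ?J)" by (rule span_sum)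
    then show "x \<in> span (v ` ?J)" by (simp add: proj_sum[OF x])
  qed
  moreover have "v ` ?J \<subseteq> V" using v by (auto simp: eig_def)
  ultimately have "dim V = card (v ` ?J)"
    using ind(2) basis_card_eq_dim[of "v ` ?J" V] by simp
  then show ?thesis using card_image[OF ind(1)] by simp
qed

end

section \<open>Irreducible representations of split extensions\<close>

definition semidirect ::
    "('n, 'l) monoid_scheme \<Rightarrow> ('h, 'k) monoid_scheme \<Rightarrow> ('h \<Rightarrow> 'n \<Rightarrow> 'n) \<Rightarrow> ('n \<times> 'h) monoid" where
  "semidirect N H a = \<lparr>carrier = carrier N \<times> carrier H,
     monoid.mult = (\<lambda>(n, h) (n', h'). (n \<otimes>\<^bsub>N\<^esub> a h n', h \<otimes>\<^bsub>H\<^esub> h')), one = (\<one>\<^bsub>N\<^esub>, \<one>\<^bsub>H\<^esub>)\<rparr>"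

lemma semidirect_simps [simp]:
  "carrier (semidirect N H a) = carrier N \<times> carrier H"
  "(n, h) \<otimes>\<^bsub>semidirect N H a\<^esub> (n', h') = (n \<otimes>\<^bsub>N\<^esub> a h n', h \<otimes>\<^bsub>H\<^esub> h')"
  "\<one>\<^bsub>semidirect N H a\<^esub> = (\<one>\<^bsub>N\<^esub>, \<one>\<^bsub>H\<^esub>)"
  by (simp_all add: semidirect_def)

text \<open>By \<open>e_aX\<close>, \<open>aX h\<close> is the pullback of characters along
  \<open>a h\<close>. A pullback reverses products, and it is a left action here because
  \<open>H\<close> is commutative.\<close>

locale dual_action = N: dual_pair N XN eN + H: dual_pair H XH eH
  for N :: "('n, 'l) monoid_scheme" and XN :: "'c set" and eN
    and H :: "('h, 'k) monoid_scheme" and XH :: "'d set" and eH +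
  fixes a :: "'h \<Rightarrow> 'n \<Rightarrow> 'n" and aX :: "'h \<Rightarrow> 'c \<Rightarrow> 'c"
  assumes a_closed: "h \<in> carrier H \<Longrightarrow> n \<in> carrier N \<Longrightarrow> a h n \<in> carrier N"
    and a_hom: "h \<in> carrier H \<Longrightarrow> n \<in> carrier N \<Longrightarrow> n' \<in> carrier N \<Longrightarrow>
      a h (n \<otimes>\<^bsub>N\<^esub> n') = a h n \<otimes>\<^bsub>N\<^esub> a h n'"
    and a_mult: "h \<in> carrier H \<Longrightarrow> h' \<in> carrier H \<Longrightarrow> n \<in> carrier N \<Longrightarrow>
      a (h \<otimes>\<^bsub>H\<^esub> h') n = a h (a h' n)"
    and a_one: "n \<in> carrier N \<Longrightarrow> a \<one>\<^bsub>H\<^esub> n = n"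
    and aX_closed: "h \<in> carrier H \<Longrightarrow> c \<in> XN \<Longrightarrow> aX h c \<in> XN"
    and aX_mult: "h \<in> carrier H \<Longrightarrow> h' \<in> carrier H \<Longrightarrow> c \<in> XN \<Longrightarrow>
      aX (h \<otimes>\<^bsub>H\<^esub> h') c = aX h (aX h' c)"
    and aX_one: "c \<in> XN \<Longrightarrow> aX \<one>\<^bsub>H\<^esub> c = c"
    and e_aX: "h \<in> carrier H \<Longrightarrow> c \<in> XN \<Longrightarrow> n \<in> carrier N \<Longrightarrow> eN (aX h c) n = eN c (a h n)"
begin

abbreviation \<Gamma> where "\<Gamma> \<equiv> semidirect N H a"

definition orbit :: "'c \<Rightarrow> 'c set" where
  "orbit c = (\<lambda>h. aX h c) ` carrier H"

lemma a_inv: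
  assumes "h \<in> carrier H" "n \<in> carrier N"
  shows "a h (a (inv\<^bsub>H\<^esub> h) n) = n" "a (inv\<^bsub>H\<^esub> h) (a h n) = n"
  using assms a_mult[of h "inv\<^bsub>H\<^esub> h" n] a_mult[of "inv\<^bsub>H\<^esub> h" h n] a_one by simp_all

lemma a_id: "h \<in> carrier H \<Longrightarrow> a h \<one>\<^bsub>N\<^esub> = \<one>\<^bsub>N\<^esub>"
  using a_hom[of h "\<one>\<^bsub>N\<^esub>" "\<one>\<^bsub>N\<^esub>"] a_closed by simp

lemma a_bij: "h \<in> carrier H \<Longrightarrow> bij_betw (a h) (carrier N) (carrier N)"
  by (rule bij_betw_byWitness[where f' = "a (inv\<^bsub>H\<^esub> h)"]) (auto simp: a_inv a_closed)

lemma aX_inv: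
  assumes "h \<in> carrier H" "c \<in> XN"
  shows "aX h (aX (inv\<^bsub>H\<^esub> h) c) = c" "aX (inv\<^bsub>H\<^esub> h) (aX h c) = c"
  using assms aX_mult[of h "inv\<^bsub>H\<^esub> h" c] aX_mult[of "inv\<^bsub>H\<^esub> h" h c] aX_one by simp_all

lemma orbit_subset: "c \<in> XN \<Longrightarrow> orbit c \<subseteq> XN"
  by (auto simp: orbit_def aX_closed)

lemma orbit_self: "c \<in> XN \<Longrightarrow> c \<in> orbit c"
  unfolding orbit_def using aX_one by (metis H.one_closed image_eqI)

lemma orbit_aX: "c \<in> XN \<Longrightarrow> x \<in> orbit c \<Longrightarrow> h \<in> carrier H \<Longrightarrow> aX h x \<in> orbit c"
  unfolding orbit_def using aX_mult[symmetric] by auto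

lemma finite_orbit: "finite (orbit c)"
  by (simp add: orbit_def H.finite_carrier)

lemma monoid_\<Gamma>: "monoid \<Gamma>"
  by (rule monoidI)
     (auto simp: a_closed a_hom a_mult a_one a_id N.m_assoc H.m_assoc)

end

context complex_ambient_space
begin

definition irreducible_action :: "('g, 'm) monoid_scheme \<Rightarrow> 'v set \<Rightarrow> ('g \<Rightarrow> 'v \<Rightarrow> 'v) \<Rightarrow> bool" where
  "irreducible_action G V U \<longleftrightarrow> V \<noteq> {0} \<and>
     (\<forall>W. subspace W \<and> W \<subseteq> V \<and> (\<forall>x\<in>carrier G. U x ` W \<subseteq> W) \<longrightarrow> W = {0} \<or> W = V)"

end

locale split_rep = complex_ambient_space scale + dual_action N XN eN H XH eH a aX
  for scale :: "complex \<Rightarrow> 'v::ab_group_add \<Rightarrow> 'v"  (infixr \<open>*s\<close> 75)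
    and N :: "('n, 'l) monoid_scheme" and XN :: "'c set" and eN
    and H :: "('h, 'k) monoid_scheme" and XH :: "'d set" and eH
    and a :: "'h \<Rightarrow> 'n \<Rightarrow> 'n" and aX :: "'h \<Rightarrow> 'c \<Rightarrow> 'c" +
  fixes V :: "'v set" and R :: "'n \<times> 'h \<Rightarrow> 'v \<Rightarrow> 'v"
  assumes rep: "is_rep (semidirect N H a) V R"
begin

definition T :: "'n \<Rightarrow> 'v \<Rightarrow> 'v" where "T n = R (n, \<one>\<^bsub>H\<^esub>)"

definition S :: "'h \<Rightarrow> 'v \<Rightarrow> 'v" where "S h = R (\<one>\<^bsub>N\<^esub>, h)"

lemma R_mult: "n \<in> carrier N \<Longrightarrow> h \<in> carrier H \<Longrightarrow> n' \<in> carrier N \<Longrightarrow> h' \<in> carrier H \<Longrightarrow> v \<in> V \<Longrightarrow>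
    R (n \<otimes>\<^bsub>N\<^esub> a h n', h \<otimes>\<^bsub>H\<^esub> h') v = R (n, h) (R (n', h') v)"
  using rep unfolding is_rep_def by (auto simp del: split_paired_All dest!: bspec)

sublocale t: abelian_rep scale N XN eN V T
proof
  have "T (n \<otimes>\<^bsub>N\<^esub> n') v = T n (T n' v)" if "n \<in> carrier N" "n' \<in> carrier N" "v \<in> V" for n n' v
    using that R_mult[of n "\<one>\<^bsub>H\<^esub>" n' "\<one>\<^bsub>H\<^esub>" v] by (simp add: T_def a_one)
  then show "is_rep N V T"
    using rep unfolding is_rep_def T_def by auto
qed

sublocale s: abelian_rep scale H XH eH V S
proof
  have "S (h \<otimes>\<^bsub>H\<^esub> h') v = S h (S h' v)" if "h \<in> carrier H" "h' \<in> carrier H" "v \<in> V" for h h' v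
    using that R_mult[of "\<one>\<^bsub>N\<^esub>" h "\<one>\<^bsub>N\<^esub>" h' v] by (simp add: S_def a_id)
  then show "is_rep H V S"
    using rep unfolding is_rep_def S_def by auto
qed

lemma R_eq: "n \<in> carrier N \<Longrightarrow> h \<in> carrier H \<Longrightarrow> v \<in> V \<Longrightarrow> R (n, h) v = T n (S h v)"
  using R_mult[of n "\<one>\<^bsub>H\<^esub>" "\<one>\<^bsub>N\<^esub>" h v] by (simp add: T_def S_def a_one)

lemma S_T: "n \<in> carrier N \<Longrightarrow> h \<in> carrier H \<Longrightarrow> v \<in> V \<Longrightarrow> S h (T n v) = T (a h n) (S h v)"
  using R_mult[of "\<one>\<^bsub>N\<^esub>" h n "\<one>\<^bsub>H\<^esub>" v] R_eq[of "a h n" h v] by (simp add: T_def S_def a_closed)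

text \<open>By \<open>S_T\<close>, conjugation by \<open>S h\<close> replaces \<open>n\<close> by
  \<open>a h n\<close> in the average, so \<open>S h\<close> maps the component of
  \<open>aX h c\<close> to the component of \<open>c\<close>. This direction, from
  \<open>aX h c\<close> to \<open>c\<close>, persists below.\<close>

lemma S_proj:
  assumes h: "h \<in> carrier H" and c: "c \<in> XN" and v: "v \<in> V"
  shows "S h (t.proj (aX h c) v) = t.proj c (S h v)"
proof -
  let ?f = "\<lambda>n. cnj (eN (aX h c) n) *s T n v"
  have mem: "?f n \<in> V" if "n \<in> carrier N" for n
    using that v by (simp add: t.U_closed subspace_scale s.subspace_V)
  have "S h (\<Sum>n\<in>carrier N. ?f n) = (\<Sum>n\<in>carrier N. S h (?f n))"
    by (rule linear_between_sum[OF s.U_linear[OF h] s.subspace_V]) (rule mem)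
  also have "\<dots> = (\<Sum>n\<in>carrier N. cnj (eN c (a h n)) *s T (a h n) (S h v))"
    using h c v by (intro sum.cong refl) (simp add: s.U_scale t.U_closed S_T e_aX)
  also have "\<dots> = (\<Sum>n\<in>carrier N. cnj (eN c n) *s T n (S h v))"
    by (rule sum.reindex_bij_betw[OF a_bij[OF h]])
  finally show ?thesis
    using h mem by (simp add: t.proj_def s.U_scale subspace_sum[OF s.subspace_V])
qed

lemma S_inject:
  assumes "h \<in> carrier H" "v \<in> V" "S h v = 0"
  shows "v = 0"
  using assms s.U_mult[of "inv\<^bsub>H\<^esub> h" h v] s.U_one[of v]
    linear_between_0[OF s.U_linear[of "inv\<^bsub>H\<^esub> h"] s.subspace_V] by simp

lemma invariant_iff:
  assumes "W \<subseteq> V"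
  shows "(\<forall>x\<in>carrier \<Gamma>. R x ` W \<subseteq> W) \<longleftrightarrow>
    (\<forall>n\<in>carrier N. T n ` W \<subseteq> W) \<and> (\<forall>h\<in>carrier H. S h ` W \<subseteq> W)" (is "?l \<longleftrightarrow> ?r")
proof
  assume ?l
  then show ?r by (simp add: T_def S_def)
next
  assume r: ?r
  have "R (n, h) w \<in> W" if "n \<in> carrier N" "h \<in> carrier H" "w \<in> W" for n h w
    using that r assms R_eq[of n h w] by (auto simp: image_subset_iff)
  then show ?l by auto
qed

text \<open>The invariant that classifies irreducible representations. A single vector has to
  witness both characters; \<open>occ_eq\<close> shows that for irreducible \<open>V\<close> this is
  the same as each of them occurring separately.\<close>

definition occ :: "('c \<times> 'd) set" where
  "occ = {(\<omega>, \<Psi>) \<in> XN \<times> XH. \<exists>w. s.eig \<Psi> w \<and> t.proj \<omega> w \<noteq> 0}"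

end

section \<open>The structure of one irreducible representation\<close>

locale irr_split_rep = split_rep +
  assumes irr: "irreducible_action \<Gamma> V R"
begin

lemma occ_nonempty: "occ \<noteq> {}"
proof -
  obtain v where v: "v \<in> V" "v \<noteq> 0"
    using irr subspace_0[OF s.subspace_V] unfolding irreducible_action_def by blast
  then obtain \<Psi> where P: "\<Psi> \<in> XH" "s.proj \<Psi> v \<noteq> 0" by (rule s.exists_eig)
  then have w: "s.eig \<Psi> (s.proj \<Psi> v)" "s.proj \<Psi> v \<in> V"
    using s.eig_proj v by (auto simp: s.proj_closed)
  then obtain \<omega> where "\<omega> \<in> XN" "t.proj \<omega> (s.proj \<Psi> v) \<noteq> 0" using P t.exists_eig by blast
  then show ?thesis using P w unfolding occ_def by blast
qed

context
  fixes \<omega> \<Psi> w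
  assumes om: "\<omega> \<in> XN" and psi: "\<Psi> \<in> XH" and w: "s.eig \<Psi> w" and pw: "t.proj \<omega> w \<noteq> 0"
begin

lemma wV: "w \<in> V"
  using w by (simp add: s.eig_def)

lemma S_proj_w: "h \<in> carrier H \<Longrightarrow> c \<in> XN \<Longrightarrow>
    S h (t.proj (aX h c) w) = eH \<Psi> h *s t.proj c w"
  using w wV t.proj_linear S_proj[of h c w] by (simp add: s.eig_def linear_between_def)

lemma proj_w_nonzero:
  assumes "\<chi> \<in> orbit \<omega>"
  shows "t.proj \<chi> w \<noteq> 0"
proof
  assume 0: "t.proj \<chi> w = 0"
  obtain h where h: "h \<in> carrier H" "\<chi> = aX h \<omega>" using assms by (auto simp: orbit_def)
  then have "eH \<Psi> h *s t.proj \<omega> w = 0"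
    using S_proj_w[of h \<omega>] 0 om linear_between_0[OF s.U_linear s.subspace_V] by simp
  then show False using pw H.e_nonzero[OF psi h(1)] by simp
qed

lemma V_eq_span: "V = span ((\<lambda>\<chi>. t.proj \<chi> w) ` orbit \<omega>)" (is "V = span ?B")
proof -
  have BV: "?B \<subseteq> V" using wV by (auto simp: t.proj_closed)
  then have WV: "span ?B \<subseteq> V" using span_minimal s.subspace_V by blast
  have preserved: "f ` span ?B \<subseteq> span ?B"
    if f: "linear_between V V f" and B: "\<And>\<chi>. \<chi> \<in> orbit \<omega> \<Longrightarrow> f (t.proj \<chi> w) \<in> span ?B" for f
  proof -
    \<comment> \<open>Linearity of \<open>f\<close> is known on \<open>V\<close> only, so membership
      in \<open>V\<close> is carried through the induction.\<close>
    have "v \<in> V \<and> f v \<in> span ?B" if "v \<in> span ?B" for v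
      using that
    proof (induction rule: span_induct_alt)
      case base
      then show ?case
        by (simp add: linear_between_0[OF f s.subspace_V] span_zero subspace_0[OF s.subspace_V])
    next
      case (step c x y)
      then have "x \<in> V" using BV by blast
      with step f B show ?case
        by (auto simp: linear_between_def span_add span_scale subspace_add[OF s.subspace_V]
            subspace_scale[OF s.subspace_V])
    qed
    then show ?thesis by blast
  qed
  have "T n ` span ?B \<subseteq> span ?B" if n: "n \<in> carrier N" for n
  proof (rule preserved[OF t.U_linear[OF n]])
    fix \<chi> assume x: "\<chi> \<in> orbit \<omega>"
    then have "T n (t.proj \<chi> w) = eN \<chi> n *s t.proj \<chi> w"
      using t.eig_proj wV orbit_subset[OF om] n by (auto simp: t.eig_def)
    then show "T n (t.proj \<chi> w) \<in> span ?B" using x by (simp add: span_scale span_base)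
  qed
  moreover have "S h ` span ?B \<subseteq> span ?B" if h: "h \<in> carrier H" for h
  proof (rule preserved[OF s.U_linear[OF h]])
    fix \<chi> assume x: "\<chi> \<in> orbit \<omega>"
    \<comment> \<open>\<open>S_proj_w\<close> starts from a component of the form
      \<open>aX h c\<close>, so the orbit point is first written in that form.\<close>
    let ?c = "aX (inv\<^bsub>H\<^esub> h) \<chi>"
    have "?c \<in> orbit \<omega>" "?c \<in> XN" "aX h ?c = \<chi>"
      using x om h orbit_aX subsetD[OF orbit_subset[OF om] x] aX_closed aX_inv by auto
    then have "S h (t.proj \<chi> w) = eH \<Psi> h *s t.proj ?c w"
      using S_proj_w[OF h, of ?c] by simp
    then show "S h (t.proj \<chi> w) \<in> span ?B"
      using \<open>?c \<in> orbit \<omega>\<close> by (simp add: span_scale span_base)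
  qed
  ultimately have "\<forall>x\<in>carrier \<Gamma>. R x ` span ?B \<subseteq> span ?B"
    using invariant_iff[OF WV] by blast
  then have "span ?B = {0} \<or> span ?B = V"
    using irr WV subspace_span unfolding irreducible_action_def by blast
  moreover have "t.proj \<omega> w \<in> span ?B" using orbit_self[OF om] by (auto intro: span_base)
  ultimately show ?thesis using pw by auto
qed

text \<open>\<open>V\<close> is spanned by the components of \<open>w\<close>, and
  \<open>proj c\<close> kills all of them except the one at \<open>c\<close>. This is multiplicity
  one for \<open>N\<close>.\<close>

lemma proj_V:
  assumes v: "v \<in> V" and c: "c \<in> XN"
  shows "t.proj c v \<in> (if c \<in> orbit \<omega> then span {t.proj c w} else {0})"
proof -
  have "v \<in> span ((\<lambda>\<chi>. t.proj \<chi> w) ` orbit \<omega>)" using v V_eq_span by simp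
  then have "v \<in> V \<and> t.proj c v \<in> (if c \<in> orbit \<omega> then span {t.proj c w} else {0})" (is "?P v")
  proof (induction rule: span_induct_alt)
    case base
    then show ?case
      by (simp add: linear_between_0[OF t.proj_linear s.subspace_V] span_zero subspace_0[OF s.subspace_V])
  next
    case (step k x y)
    then obtain \<chi> where x: "x = t.proj \<chi> w" "\<chi> \<in> orbit \<omega>" by auto
    then have X: "x \<in> V" "\<chi> \<in> XN" using wV orbit_subset[OF om] by (auto simp: t.proj_closed)
    then have "t.proj c x = (if c = \<chi> then x else 0)"
      using t.proj_of_eig[OF t.eig_proj[OF _ wV]] x c by simp
    moreover have "t.proj c (k *s x + y) = k *s t.proj c x + t.proj c y"
      using X step t.proj_linear
      by (simp add: linear_between_def subspace_scale[OF s.subspace_V])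
    moreover have "k *s x + y \<in> V"
      using X step by (simp add: subspace_scale[OF s.subspace_V] subspace_add[OF s.subspace_V])
    ultimately show ?case using step x
      by (auto simp: span_add span_scale span_base)
  qed
  then show ?thesis by simp
qed

lemma eig_N_iff:
  assumes c: "c \<in> XN"
  shows "(\<exists>v. t.eig c v \<and> v \<noteq> 0) \<longleftrightarrow> c \<in> orbit \<omega>"
proof
  assume "\<exists>v. t.eig c v \<and> v \<noteq> 0"
  then obtain v where v: "t.eig c v" "v \<noteq> 0" by blast
  then have "t.proj c v = v" "v \<in> V" using t.proj_of_eig[of c v c] c by (auto simp: t.eig_def)
  then show "c \<in> orbit \<omega>" using proj_V[of v c] c v by (auto split: if_splits)
next
  assume "c \<in> orbit \<omega>"
  then show "\<exists>v. t.eig c v \<and> v \<noteq> 0" using proj_w_nonzero t.eig_proj[OF c wV] by blast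
qed

lemma dim_V: "dim V = card (orbit \<omega>)"
proof -
  have "dim V = card {c \<in> XN. \<exists>v. t.eig c v \<and> v \<noteq> 0}"
  proof (rule t.dim_eq_card_eig)
    fix c v u assume c: "c \<in> XN" and v: "t.eig c v" and u: "t.eig c u" and nz: "v \<noteq> 0"
    have "c \<in> orbit \<omega>" using eig_N_iff[OF c] v nz by blast
    moreover have "t.proj c v = v" "t.proj c u = u" "v \<in> V" "u \<in> V"
      using v u c t.proj_of_eig[of c _ c] by (auto simp: t.eig_def)
    ultimately obtain k l where "v = k *s t.proj c w" "u = l *s t.proj c w"
      using proj_V[of v c] proj_V[of u c] c by (auto simp: span_singleton)
    with nz have "u = (l / k) *s v" by auto
    then show "u \<in> span {v}" by (auto simp: span_singleton)
  qed
  also have "{c \<in> XN. \<exists>v. t.eig c v \<and> v \<noteq> 0} = orbit \<omega>"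
    using eig_N_iff orbit_subset[OF om] by blast
  finally show ?thesis .
qed

text \<open>An \<open>H\<close>-eigenvector is determined by any one of its \<open>N\<close>-components, because \<open>H\<close> permutes these
  components transitively up to scalars.\<close>

lemma eig_H_zero:
  assumes v: "s.eig \<Phi> v" and 0: "t.proj \<chi> v = 0" and x: "\<chi> \<in> orbit \<omega>" and P: "\<Phi> \<in> XH"
  shows "v = 0"
proof -
  have vV: "v \<in> V" using v by (simp add: s.eig_def)
  have "t.proj c v = 0" if c: "c \<in> XN" for c
  proof (cases "c \<in> orbit \<omega>")
    case True
    obtain h where h: "h \<in> carrier H" "c = aX h \<omega>" using True by (auto simp: orbit_def)
    obtain k where k: "k \<in> carrier H" "\<chi> = aX k \<omega>" using x by (auto simp: orbit_def)
    \<comment> \<open>This element moves \<chi> to \<open>c\<close>, so its operator takes the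
      \<open>c\<close>-component of \<open>v\<close> to the \<chi>-component of a multiple of
      \<open>v\<close>, which is zero.\<close>
    let ?h = "h \<otimes>\<^bsub>H\<^esub> inv\<^bsub>H\<^esub> k"
    have xX: "\<chi> \<in> XN" using x orbit_subset om by blast
    have "aX ?h \<chi> = c"
      using h k om by (simp add: aX_mult aX_closed aX_inv)
    then have "S ?h (t.proj c v) = t.proj \<chi> (S ?h v)"
      using S_proj[of ?h \<chi> v] h k xX vV by simp
    also have "\<dots> = eH \<Phi> ?h *s t.proj \<chi> v"
      using v h k vV t.proj_linear by (simp add: s.eig_def linear_between_def)
    finally have "S ?h (t.proj c v) = 0" using 0 by simp
    then show ?thesis using S_inject[of ?h "t.proj c v"] h k vV by (simp add: t.proj_closed)
  next
    case False
    then show ?thesis using proj_V[OF vV c] by simp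
  qed
  then show ?thesis using t.proj_sum[OF vV] by simp
qed

text \<open>By \<open>eig_H_zero\<close> a nonzero \<open>H\<close>-eigenvector has a nonzero
  component at every orbit point, and by \<open>proj_V\<close> no vector has one elsewhere. Hence
  the occurring pairs form a full rectangle.\<close>

lemma occ_eq: "occ = orbit \<omega> \<times> {\<Phi> \<in> XH. \<exists>v. s.eig \<Phi> v \<and> v \<noteq> 0}"
proof -
  have "(\<exists>v. s.eig \<Phi> v \<and> t.proj c v \<noteq> 0) \<longleftrightarrow> c \<in> orbit \<omega> \<and> (\<exists>v. s.eig \<Phi> v \<and> v \<noteq> 0)"
    if "c \<in> XN" "\<Phi> \<in> XH" for c \<Phi>
  proof
    assume "\<exists>v. s.eig \<Phi> v \<and> t.proj c v \<noteq> 0"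
    then obtain v where v: "s.eig \<Phi> v" "t.proj c v \<noteq> 0" by blast
    then have "v \<in> V" by (simp add: s.eig_def)
    then show "c \<in> orbit \<omega> \<and> (\<exists>v. s.eig \<Phi> v \<and> v \<noteq> 0)"
      using v proj_V[of v c] that linear_between_0[OF t.proj_linear s.subspace_V]
      by (auto split: if_splits)
  next
    assume "c \<in> orbit \<omega> \<and> (\<exists>v. s.eig \<Phi> v \<and> v \<noteq> 0)"
    then show "\<exists>v. s.eig \<Phi> v \<and> t.proj c v \<noteq> 0" using eig_H_zero that by blast
  qed
  then show ?thesis using orbit_subset[OF om] unfolding occ_def by blast
qed

text \<open>Multiplicity one for \<open>H\<close>: by \<open>proj_V\<close> two eigenvectors of the
  same character have proportional \<omega>-components, so some combination of them has
  \<omega>-component zero and vanishes by \<open>eig_H_zero\<close>.\<close>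

lemma dim_V_H: "dim V = card {\<Phi> \<in> XH. \<exists>v. s.eig \<Phi> v \<and> v \<noteq> 0}"
proof (rule s.dim_eq_card_eig)
  fix c v u assume c: "c \<in> XH" and v: "s.eig c v" and u: "s.eig c u" and nz: "v \<noteq> 0"
  have V: "v \<in> V" "u \<in> V" using v u by (auto simp: s.eig_def)
  obtain k l where kl: "t.proj \<omega> v = k *s t.proj \<omega> w" "t.proj \<omega> u = l *s t.proj \<omega> w"
    using proj_V[OF V(1) om] proj_V[OF V(2) om] orbit_self[OF om] by (auto simp: span_singleton)
  have k: "k \<noteq> 0" using kl(1) nz eig_H_zero[OF v _ orbit_self[OF om] c] by auto
  let ?d = "u - (l / k) *s v"
  have "s.eig c ?d"
    using u v V by (auto simp: s.eig_def s.subspace_V subspace_diff subspace_scale s.U_scale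
        linear_between_diff[OF s.U_linear s.subspace_V] scale_right_diff_distrib mult.commute)
  moreover have "t.proj \<omega> ?d = t.proj \<omega> u - (l / k) *s t.proj \<omega> v"
    using t.proj_linear V linear_between_diff[OF t.proj_linear s.subspace_V V(2), of "(l / k) *s v" \<omega>]
    by (simp add: linear_between_def subspace_scale[OF s.subspace_V])
  then have "t.proj \<omega> ?d = 0" using kl k by simp
  ultimately have "?d = 0" using eig_H_zero orbit_self[OF om] c by blast
  then show "u \<in> span {v}" by (auto simp: span_singleton)
qed

end

lemma card_occ: "card occ = dim V * dim V"
proof -
  obtain \<omega> \<Psi> w where "\<omega> \<in> XN" "\<Psi> \<in> XH" "s.eig \<Psi> w" "t.proj \<omega> w \<noteq> 0"
    using occ_nonempty unfolding occ_def by blast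
  note * = this
  show ?thesis
    using occ_eq[OF *] dim_V[OF *] dim_V_H[OF *] by (simp add: card_cartesian_product)
qed

lemma dim_of_occ: "(\<omega>, \<Psi>) \<in> occ \<Longrightarrow> dim V = card (orbit \<omega>)"
  using dim_V unfolding occ_def by blast

end

section \<open>Equivalence of irreducible representations in terms of occurring pairs\<close>

context complex_ambient_space
begin

definition action_equiv :: "('g, 'm) monoid_scheme \<Rightarrow> 'v set \<Rightarrow> ('g \<Rightarrow> 'v \<Rightarrow> 'v) \<Rightarrow>
    'v set \<Rightarrow> ('g \<Rightarrow> 'v \<Rightarrow> 'v) \<Rightarrow> bool" where
  "action_equiv G V U V' U' \<longleftrightarrow> (\<exists>\<phi>. linear_between V V' \<phi> \<and> bij_betw \<phi> V V' \<and>
     (\<forall>x\<in>carrier G. \<forall>v\<in>V. \<phi> (U x v) = U' x (\<phi> v)))"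

text \<open>Intertwining may be tested on a spanning set. Here \<open>g\<close> is linear on the
  whole ambient space, as extensions from an independent set are, while \<open>f\<close> and
  \<open>f'\<close> are linear only on their subspaces.\<close>

lemma intertwine_span:
  assumes g: "Vector_Spaces.linear scale scale g" "g ` V \<subseteq> V'"
    and V: "V = span B" and V': "subspace V'"
    and f: "linear_between V V f" and f': "linear_between V' V' f'"
    and B: "\<And>b. b \<in> B \<Longrightarrow> g (f b) = f' (g b)" and v: "v \<in> V"
  shows "g (f v) = f' (g v)"
proof -
  interpret g: Vector_Spaces.linear scale scale g by (rule g)
  have V_sub: "subspace V" using V by simp
  have "v \<in> span B" using v V by simp
  then have "v \<in> V \<and> g (f v) = f' (g v)"
  proof (induction rule: span_induct_alt)
    case base
    then show ?case
      by (simp add: subspace_0[OF V_sub] linear_between_0[OF f V_sub] linear_between_0[OF f' V'] g.zero)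
  next
    case (step c x y)
    then have "x \<in> V" using V span_base by blast
    with step show ?case
      using f f' B[of x] g(2)
      by (auto simp: linear_between_def subspace_add[OF V_sub] subspace_scale[OF V_sub]
          subspace_scale[OF V'] image_subset_iff g.add g.scale)
  qed
  then show ?thesis by simp
qed

end

context irr_split_rep
begin

text \<open>Matching the component of \<open>w\<close> at each orbit point with that of
  \<open>w'\<close> gives the isomorphism. The two bases carry the same \<open>N\<close>-characters,
  and since \<open>w\<close> and \<open>w'\<close> have the same \<open>H\<close>-character,
  \<open>S_proj_w\<close> gives the same permutation with the same scalars on both.\<close>

lemma equiv_if_occ_meet:
  assumes "irr_split_rep scale N XN eN H XH eH a aX V' R'"
    and o: "x \<in> occ" and o': "x \<in> split_rep.occ scale N XN eN H XH eH V' R'"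
  shows "action_equiv \<Gamma> V R V' R'"
proof -
  interpret r': irr_split_rep scale N XN eN H XH eH a aX V' R' by (rule assms(1))
  interpret vp: vector_space_pair scale scale ..
  obtain \<omega> \<Psi> w where x: "x = (\<omega>, \<Psi>)" and om: "\<omega> \<in> XN" and psi: "\<Psi> \<in> XH"
    and w: "s.eig \<Psi> w" and pw: "t.proj \<omega> w \<noteq> 0"
    using o unfolding occ_def by auto
  obtain w' where w': "r'.s.eig \<Psi> w'" and pw': "r'.t.proj \<omega> w' \<noteq> 0"
    using o' x unfolding r'.occ_def by auto
  note A = om psi w pw and A' = om psi w' pw'
  let ?O = "orbit \<omega>"
  let ?e = "\<lambda>\<chi>. t.proj \<chi> w" and ?e' = "\<lambda>\<chi>. r'.t.proj \<chi> w'"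
  have e: "inj_on ?e ?O" "independent (?e ` ?O)"
    using t.eig_family_independent[of ?O ?e] proj_w_nonzero[OF A] wV[OF A] t.eig_proj
      orbit_subset[OF om] by auto
  have e': "inj_on ?e' ?O" "independent (?e' ` ?O)"
    using r'.t.eig_family_independent[of ?O ?e'] r'.proj_w_nonzero[OF A'] r'.wV[OF A']
      r'.t.eig_proj orbit_subset[OF om] by auto
  obtain g where g: "Vector_Spaces.linear scale scale g"
    and ge: "\<forall>b\<in>?e ` ?O. g b = (?e' \<circ> inv_into ?O ?e) b"
    using vp.linear_independent_extend[OF e(2)] by blast
  interpret g: Vector_Spaces.linear scale scale g by (rule g)
  have ge: "g (?e \<chi>) = ?e' \<chi>" if "\<chi> \<in> ?O" for \<chi>
    using ge that inv_into_f_f[OF e(1) that] by simp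
  have im: "g ` ?e ` ?O = ?e' ` ?O" using ge by force
  have gV: "g ` V = V'"
    using V_eq_span[OF A] r'.V_eq_span[OF A'] im g.span_image by metis
  have "inj_on g (?e ` ?O)"
    using ge e'(1) by (auto simp: inj_on_def)
  then have "inj_on g V"
    using g.inj_on_span_independent_image[of "?e ` ?O"] im e'(2) V_eq_span[OF A] by simp
  then have bij: "bij_betw g V V'" using gV by (simp add: bij_betw_def)
  have gT: "g (T n v) = r'.T n (g v)" if n: "n \<in> carrier N" and v: "v \<in> V" for n v
  proof (rule intertwine_span[OF g _ V_eq_span[OF A] r'.t.subspace_V t.U_linear[OF n] r'.t.U_linear[OF n] _ v])
    show "g ` V \<subseteq> V'" using gV by simp
    fix b assume "b \<in> ?e ` ?O"
    then obtain \<chi> where \<chi>: "b = ?e \<chi>" "\<chi> \<in> ?O" by auto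
    then have "\<chi> \<in> XN" using orbit_subset[OF om] by blast
    then have "T n b = eN \<chi> n *s b" "r'.T n (?e' \<chi>) = eN \<chi> n *s ?e' \<chi>"
      using t.eig_proj[OF _ wV[OF A]] r'.t.eig_proj[OF _ r'.wV[OF A']] n \<chi>
      by (auto simp: t.eig_def r'.t.eig_def)
    then show "g (T n b) = r'.T n (g b)"
      using \<chi> ge by (simp add: g.scale)
  qed
  have gS: "g (S h v) = r'.S h (g v)" if h: "h \<in> carrier H" and v: "v \<in> V" for h v
  proof (rule intertwine_span[OF g _ V_eq_span[OF A] r'.t.subspace_V s.U_linear[OF h] r'.s.U_linear[OF h] _ v])
    show "g ` V \<subseteq> V'" using gV by simp
    fix b assume "b \<in> ?e ` ?O"
    then obtain \<chi> where \<chi>: "b = ?e \<chi>" "\<chi> \<in> ?O" by auto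
    let ?c = "aX (inv\<^bsub>H\<^esub> h) \<chi>"
    have c: "?c \<in> ?O" "?c \<in> XN" "aX h ?c = \<chi>"
      using \<chi> om h orbit_aX subsetD[OF orbit_subset[OF om]] aX_closed aX_inv by auto
    have "S h b = eH \<Psi> h *s ?e ?c" "r'.S h (?e' \<chi>) = eH \<Psi> h *s ?e' ?c"
      using S_proj_w[OF A h c(2)] r'.S_proj_w[OF A' h c(2)] c \<chi> by auto
    then show "g (S h b) = r'.S h (g b)"
      using \<chi> ge c by (simp add: g.scale)
  qed
  have "linear_between V V' g"
    using gV by (auto simp: linear_between_def g.add g.scale)
  moreover have "g (R x v) = R' x (g v)" if "x \<in> carrier \<Gamma>" "v \<in> V" for x v
  proof -
    obtain n h where x: "x = (n, h)" "n \<in> carrier N" "h \<in> carrier H" using \<open>x \<in> carrier \<Gamma>\<close> by auto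
    have "g v \<in> V'" using gV that by blast
    then show ?thesis
      using that x by (simp add: R_eq r'.R_eq gT gS s.U_closed)
  qed
  ultimately show ?thesis using bij unfolding action_equiv_def by blast
qed

text \<open>An injective intertwiner commutes with all projectors, so it transports a witness of a
  pair to a witness of the same pair.\<close>

lemma occ_subset_if_equiv:
  assumes "split_rep scale N XN eN H XH eH a aX V' R'"
    and eq: "action_equiv \<Gamma> V R V' R'"
  shows "occ \<subseteq> split_rep.occ scale N XN eN H XH eH V' R'"
proof -
  interpret r': split_rep scale N XN eN H XH eH a aX V' R' by (rule assms(1))
  obtain \<phi> where phi: "linear_between V V' \<phi>" "bij_betw \<phi> V V'"
    and comm: "\<And>x v. x \<in> carrier \<Gamma> \<Longrightarrow> v \<in> V \<Longrightarrow> \<phi> (R x v) = R' x (\<phi> v)"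
    using eq unfolding action_equiv_def by blast
  have T: "\<phi> (T n v) = r'.T n (\<phi> v)" if "n \<in> carrier N" "v \<in> V" for n v
    using that comm by (simp add: T_def r'.T_def)
  have S: "\<phi> (S h v) = r'.S h (\<phi> v)" if "h \<in> carrier H" "v \<in> V" for h v
    using that comm by (simp add: S_def r'.S_def)
  have V': "\<phi> v \<in> V'" if "v \<in> V" for v using phi that by (auto simp: linear_between_def)
  have scale: "\<phi> (k *s v) = k *s \<phi> v" if "v \<in> V" for k v
    using phi that by (auto simp: linear_between_def)
  have zero: "\<phi> v = 0 \<longleftrightarrow> v = 0" if "v \<in> V" for v
    using phi(2) linear_between_0[OF phi(1) s.subspace_V] that subspace_0[OF s.subspace_V]
    by (metis bij_betw_def inj_on_eq_iff)
  have proj: "\<phi> (t.proj c v) = r'.t.proj c (\<phi> v)" if v: "v \<in> V" for c v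
  proof -
    have mem: "cnj (eN c n) *s T n v \<in> V" if "n \<in> carrier N" for n
      using that v by (simp add: t.U_closed subspace_scale[OF s.subspace_V])
    have "\<phi> (\<Sum>n\<in>carrier N. cnj (eN c n) *s T n v) = (\<Sum>n\<in>carrier N. \<phi> (cnj (eN c n) *s T n v))"
      by (rule linear_between_sum[OF phi(1) s.subspace_V]) (rule mem)
    also have "\<dots> = (\<Sum>n\<in>carrier N. cnj (eN c n) *s r'.T n (\<phi> v))"
      using v by (intro sum.cong refl) (simp add: scale T t.U_closed)
    finally show ?thesis
      using mem by (simp add: t.proj_def r'.t.proj_def scale subspace_sum[OF s.subspace_V])
  qed
  show ?thesis
  proof
    fix x assume "x \<in> occ"
    then obtain \<omega> \<Psi> w where x: "x = (\<omega>, \<Psi>)" "\<omega> \<in> XN" "\<Psi> \<in> XH"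
      and w: "s.eig \<Psi> w" and pw: "t.proj \<omega> w \<noteq> 0"
      unfolding occ_def by auto
    then have wV: "w \<in> V" by (simp add: s.eig_def)
    have "r'.s.eig \<Psi> (\<phi> w)"
      using w S[symmetric] V' scale by (simp add: s.eig_def r'.s.eig_def)
    moreover have "r'.t.proj \<omega> (\<phi> w) \<noteq> 0"
      using pw proj[OF wV, symmetric] zero[of "t.proj \<omega> w"] wV by (simp add: t.proj_closed)
    ultimately show "x \<in> r'.occ" using x unfolding r'.occ_def by auto
  qed
qed

text \<open>The inclusion of \<open>occ\<close> in \<open>occ'\<close> is an equality by counting: a
  common pair forces equal dimensions, both being the size of the orbit, and \<open>card_occ\<close>
  then gives equal cardinalities. The second claim makes the sets of pairs the blocks of a
  partition.\<close>

lemma equiv_iff_occ: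
  assumes "irr_split_rep scale N XN eN H XH eH a aX V' R'"
  defines "occ' \<equiv> split_rep.occ scale N XN eN H XH eH V' R'"
  shows "action_equiv \<Gamma> V R V' R' \<longleftrightarrow> occ = occ'" and "occ = occ' \<longleftrightarrow> occ \<inter> occ' \<noteq> {}"
proof -
  interpret r': irr_split_rep scale N XN eN H XH eH a aX V' R' by (rule assms(1))
  have 1: "occ = occ'" if e: "action_equiv \<Gamma> V R V' R'"
  proof -
    have sub: "occ \<subseteq> r'.occ" by (rule occ_subset_if_equiv[OF r'.split_rep_axioms e])
    obtain \<omega> \<Psi> where x: "(\<omega>, \<Psi>) \<in> occ" using occ_nonempty by auto
    have "dim V = dim V'" using dim_of_occ[OF x] r'.dim_of_occ[of \<omega> \<Psi>] x sub by auto
    then have "card occ = card r'.occ" using card_occ r'.card_occ by simp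
    moreover have "finite r'.occ"
      by (rule finite_subset[of _ "XN \<times> XH"]) (auto simp: r'.occ_def N.finite_X H.finite_X)
    ultimately show ?thesis unfolding occ'_def using sub card_subset_eq by blast
  qed
  have 2: "action_equiv \<Gamma> V R V' R'" if e: "occ \<inter> occ' \<noteq> {}"
    using e equiv_if_occ_meet[OF assms(1)] unfolding occ'_def by blast
  show "action_equiv \<Gamma> V R V' R' \<longleftrightarrow> occ = occ'" "occ = occ' \<longleftrightarrow> occ \<inter> occ' \<noteq> {}"
    using 1 2 occ_nonempty by blast+
qed

end

section \<open>Existence of an irreducible representation for every pair\<close>

lemma sum_fun_apply: "(\<Sum>x\<in>A. f x) i = (\<Sum>x\<in>A. f x i)"
  by (induction A rule: infinite_finite_induct) auto

text \<open>The model of the irreducible representation attached to an orbit and a character of \<open>H\<close>: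
  functions on the orbit, which is enumerated by \<open>{..<k}\<close>.\<close>

lemma (in dual_action) exists_irr_split_rep:
  assumes om: "\<omega> \<in> XN" and psi: "\<Psi> \<in> XH"
  shows "\<exists>V R. irr_split_rep seq_scale N XN eN H XH eH a aX V R \<and> cseq.findim_subspace V \<and>
    (\<omega>, \<Psi>) \<in> split_rep.occ seq_scale N XN eN H XH eH V R"
proof -
  define k where "k = card (orbit \<omega>)"
  obtain dec where dec: "bij_betw dec {..<k} (orbit \<omega>)"
    using ex_bij_betw_nat_finite[OF finite_orbit, of \<omega>] unfolding k_def atLeast0LessThan by blast
  define enc where "enc = inv_into {..<k} dec"
  have dX: "dec i \<in> XN" "dec i \<in> orbit \<omega>" if "i < k" for i
    using dec orbit_subset[OF om] that by (auto simp: bij_betw_def)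
  have enc: "enc \<chi> < k" "dec (enc \<chi>) = \<chi>" if "\<chi> \<in> orbit \<omega>" for \<chi>
    using dec that inv_into_into[of \<chi> dec "{..<k}"] bij_betw_inv_into_right
    unfolding enc_def bij_betw_def by (auto simp: f_inv_into_f)
  have ed: "enc (dec i) = i" if "i < k" for i
    unfolding enc_def using dec that by (simp add: bij_betw_inv_into_left)
  define V :: "(nat \<Rightarrow> complex) set" where "V = {f. \<forall>i\<ge>k. f i = 0}"
  \<comment> \<open>\<open>N\<close> multiplies the value at an orbit point by that character, and
    \<open>H\<close> translates the argument. The factor \<open>eH \<Psi> h\<close> twists the
    permutation action so that constants have character \<Psi>.\<close>
  define R :: "'n \<times> 'h \<Rightarrow> (nat \<Rightarrow> complex) \<Rightarrow> nat \<Rightarrow> complex" where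
    "R = (\<lambda>(n, h) f i. if i < k then eN (dec i) n * eH \<Psi> h * f (enc (aX h (dec i))) else 0)"
  have R_apply: "R (n, h) f i =
      (if i < k then eN (dec i) n * eH \<Psi> h * f (enc (aX h (dec i))) else 0)" for n h f i
    by (simp add: R_def)
  define \<delta> where "\<delta> j = (\<lambda>i. if i = j then 1 else 0 :: complex)" for j :: nat
  have sub: "cseq.subspace V"
    by (rule cseq.subspaceI) (auto simp: V_def seq_scale_def)
  have "cseq.is_rep \<Gamma> V R"
    unfolding cseq.is_rep_def
  proof (intro conjI ballI)
    show "cseq.subspace V" by (rule sub)
    fix x assume "x \<in> carrier \<Gamma>"
    show "cseq.linear_between V V (R x)"
      unfolding cseq.linear_between_def
      by (cases x) (auto simp: R_apply V_def seq_scale_def fun_eq_iff algebra_simps)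
  next
    fix x y f assume x: "x \<in> carrier \<Gamma>" and y: "y \<in> carrier \<Gamma>" and f: "f \<in> V"
    obtain n h where xh: "x = (n, h)" "n \<in> carrier N" "h \<in> carrier H" using x by auto
    obtain n' h' where yh: "y = (n', h')" "n' \<in> carrier N" "h' \<in> carrier H" using y by auto
    show "R (x \<otimes>\<^bsub>\<Gamma>\<^esub> y) f = R x (R y f)"
    proof
      fix i
      show "R (x \<otimes>\<^bsub>\<Gamma>\<^esub> y) f i = R x (R y f) i"
      proof (cases "i < k")
        case True
        have o: "aX h (dec i) \<in> orbit \<omega>" using dX[OF True] orbit_aX om xh by blast
        \<comment> \<open>Composing the operators evaluates \<open>f\<close> at
          \<open>aX h' (aX h _)\<close>, the opposite of the order in \<open>aX_mult\<close>;
          commutativity of \<open>H\<close> reconciles the two.\<close>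
        have "aX (h \<otimes>\<^bsub>H\<^esub> h') (dec i) = aX h' (aX h (dec i))"
          using dX[OF True] xh yh aX_mult[of h' h "dec i"] by (simp add: H.m_comm)
        then show ?thesis
          using xh yh dX[OF True] True enc[OF o] psi a_closed[of h n']
          by (simp add: R_apply N.e_mult H.e_mult e_aX)
      qed (auto simp: R_apply xh yh)
    qed
  next
    fix f assume f: "f \<in> V"
    show "R \<one>\<^bsub>\<Gamma>\<^esub> f = f"
    proof
      fix i show "R \<one>\<^bsub>\<Gamma>\<^esub> f i = f i"
        using f dX[of i] psi by (auto simp: R_apply V_def aX_one N.e_one H.e_one ed)
    qed
  qed
  then interpret r: split_rep seq_scale N XN eN H XH eH a aX V R
    by unfold_locales
  \<comment> \<open>In this model, projecting to \<open>c\<close> is restricting a function to the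
    one orbit point \<open>c\<close>.\<close>
  have proj: "r.t.proj c f i = (if i < k \<and> dec i = c then f i else 0)"
    if f: "f \<in> V" and c: "c \<in> XN" for c f i
  proof (cases "i < k")
    case True
    have "(\<Sum>n\<in>carrier N. seq_scale (cnj (eN c n)) (r.T n f)) i
        = (\<Sum>n\<in>carrier N. cnj (eN c n) * eN (dec i) n) * f i"
      using dX[OF True] True psi
      by (simp add: sum_fun_apply seq_scale_def r.T_def R_apply aX_one ed H.e_one sum_distrib_right mult.assoc)
    also have "\<dots> = (if dec i = c then of_nat (order N) else 0) * f i"
      using N.e_rows[OF dX(1)[OF True] c] by simp
    finally show ?thesis using True N.order_nonzero by (simp add: r.t.proj_def seq_scale_def)
  next
    case False
    have "r.t.proj c f \<in> V" using f by (rule r.t.proj_closed)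
    then show ?thesis using False by (simp add: V_def)
  qed
  have \<delta>V: "\<delta> j \<in> V" if "j < k" for j using that by (auto simp: \<delta>_def V_def)
  have V_span: "V = cseq.span (\<delta> ` {..<k})"
  proof
    show "cseq.span (\<delta> ` {..<k}) \<subseteq> V" using \<delta>V by (intro cseq.span_minimal sub) auto
    show "V \<subseteq> cseq.span (\<delta> ` {..<k})"
    proof
      fix f assume f: "f \<in> V"
      have "f = (\<Sum>j<k. seq_scale (f j) (\<delta> j))"
      proof
        fix i
        have "(\<Sum>j<k. seq_scale (f j) (\<delta> j)) i = (\<Sum>j<k. if i = j then f j else 0)"
          unfolding sum_fun_apply by (intro sum.cong) (auto simp: seq_scale_def \<delta>_def)
        then show "f i = (\<Sum>j<k. seq_scale (f j) (\<delta> j)) i" using f by (simp add: V_def)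
      qed
      also have "\<dots> \<in> cseq.span (\<delta> ` {..<k})"
        by (intro cseq.span_sum cseq.span_scale cseq.span_base) auto
      finally show "f \<in> cseq.span (\<delta> ` {..<k})" .
    qed
  qed
  have i0: "enc \<omega> < k" "dec (enc \<omega>) = \<omega>" using enc orbit_self[OF om] by auto
  have irr: "cseq.irreducible_action \<Gamma> V R"
    unfolding cseq.irreducible_action_def
  proof (intro conjI allI impI)
    have "\<delta> (enc \<omega>) \<noteq> 0" by (auto simp: \<delta>_def fun_eq_iff)
    then show "V \<noteq> {0}" using \<delta>V[OF i0(1)] by blast
    fix W assume W: "cseq.subspace W \<and> W \<subseteq> V \<and> (\<forall>x\<in>carrier \<Gamma>. R x ` W \<subseteq> W)"
    then have WT: "\<And>n. n \<in> carrier N \<Longrightarrow> r.T n ` W \<subseteq> W"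
      and WS: "\<And>h. h \<in> carrier H \<Longrightarrow> r.S h ` W \<subseteq> W"
      using r.invariant_iff[of W] by auto
    show "W = {0} \<or> W = V"
    proof (rule disjCI)
      assume ne: "W \<noteq> V"
      show "W = {0}"
      proof (rule ccontr)
        assume "W \<noteq> {0}"
        then obtain f where f: "f \<in> W" "f \<noteq> 0" using W cseq.subspace_0[of W] by blast
        then obtain i where fi: "f i \<noteq> 0" by (auto simp: fun_eq_iff)
        have fV: "f \<in> V" using f W by blast
        then have i: "i < k" using fi by (auto simp: V_def not_less[symmetric])
        \<comment> \<open>One nonzero value of \<open>f\<close> is enough: projecting to that point
          and rescaling puts a point mass into \<open>W\<close>, and \<open>H\<close> carries it to
          all other points.\<close>
        have "r.t.proj (dec i) f = seq_scale (f i) (\<delta> i)"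
        proof
          fix j
          have "dec j = dec i \<longleftrightarrow> j = i" if "j < k" using ed that i by metis
          then show "r.t.proj (dec i) f j = seq_scale (f i) (\<delta> i) j"
            using proj[OF fV dX(1)[OF i]] i by (auto simp: seq_scale_def \<delta>_def)
        qed
        moreover have "r.t.proj (dec i) f \<in> W"
          using W f WT by (intro r.t.proj_invariant) auto
        ultimately have "seq_scale (1 / f i) (seq_scale (f i) (\<delta> i)) \<in> W"
          using W cseq.subspace_scale by metis
        then have \<delta>i: "\<delta> i \<in> W" using fi by simp
        have "\<delta> j \<in> W" if j: "j < k" for j
        proof -
          \<comment> \<open>The point mass at \<open>i\<close> is carried to \<open>j\<close> by an
            element moving \<open>dec j\<close> to \<open>dec i\<close>, since translation of
            arguments reverses the direction.\<close>
          obtain h where h: "h \<in> carrier H" "dec i = aX h (dec j)"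
          proof -
            obtain h1 h2 where "h1 \<in> carrier H" "dec i = aX h1 \<omega>" "h2 \<in> carrier H" "dec j = aX h2 \<omega>"
              using dX(2)[OF i] dX(2)[OF j] by (auto simp: orbit_def)
            then show thesis
              using that[of "h1 \<otimes>\<^bsub>H\<^esub> inv\<^bsub>H\<^esub> h2"] om by (simp add: aX_mult aX_closed aX_inv)
          qed
          have "r.S h (\<delta> i) = seq_scale (eH \<Psi> h) (\<delta> j)"
          proof
            fix l
            show "r.S h (\<delta> i) l = seq_scale (eH \<Psi> h) (\<delta> j) l"
            proof (cases "l < k")
              case True
              have "enc (aX h (dec l)) = i \<longleftrightarrow> l = j"
              proof
                assume "enc (aX h (dec l)) = i"
                then have "aX h (dec l) = aX h (dec j)"
                  using enc(2)[OF orbit_aX[OF om dX(2)[OF True] h(1)]] h(2) by simp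
                then have "dec l = dec j" using aX_inv(2)[OF h(1)] dX True j by metis
                then show "l = j" using ed True j by metis
              qed (use ed[OF i] h(2) in simp)
              then show ?thesis
                using True dX[OF True]
                by (auto simp: r.S_def R_apply seq_scale_def \<delta>_def N.e_one)
            qed (use j in \<open>auto simp: r.S_def R_apply seq_scale_def \<delta>_def\<close>)
          qed
          moreover have "r.S h (\<delta> i) \<in> W" using WS[OF h(1)] \<delta>i by blast
          ultimately have "seq_scale (1 / eH \<Psi> h) (seq_scale (eH \<Psi> h) (\<delta> j)) \<in> W"
            using W cseq.subspace_scale by metis
          then show ?thesis using H.e_nonzero[OF psi h(1)] by simp
        qed
        then have "V \<subseteq> W" unfolding V_span using W by (intro cseq.span_minimal) auto
        then show False using ne W by blast
      qed
    qed
  qed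
  \<comment> \<open>The constant function on the orbit is an \<open>H\<close>-eigenvector of
    character \<Psi>, and all its \<open>N\<close>-components on the orbit are nonzero.\<close>
  define w :: "nat \<Rightarrow> complex" where "w = (\<lambda>i. if i < k then 1 else 0)"
  have wV: "w \<in> V" by (auto simp: w_def V_def)
  have "r.s.eig \<Psi> w"
    unfolding r.s.eig_def
  proof (intro conjI ballI ext)
    fix h i assume h: "h \<in> carrier H"
    show "r.S h w i = seq_scale (eH \<Psi> h) w i"
      using enc(1)[OF orbit_aX[OF om dX(2) h], of i] dX(1)[of i]
      by (auto simp: r.S_def R_apply w_def seq_scale_def N.e_one)
  qed (rule wV)
  moreover have "r.t.proj \<omega> w (enc \<omega>) = 1"
    using proj[OF wV om] i0 by (simp add: w_def)
  then have "r.t.proj \<omega> w \<noteq> 0" by auto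
  ultimately have "(\<omega>, \<Psi>) \<in> r.occ" using om psi unfolding r.occ_def by blast
  moreover have "irr_split_rep seq_scale N XN eN H XH eH a aX V R"
    by unfold_locales (rule irr)
  moreover have "cseq.findim_subspace V"
    unfolding cseq.findim_subspace_def V_span by blast
  ultimately show ?thesis by blast
qed

section \<open>Representations of skew left braces\<close>

lemma skew_left_braceD:
  assumes "skew_left_brace A"
  shows "group A" "group (circ_group A)"
    and "\<And>x y. x \<in> carrier A \<Longrightarrow> y \<in> carrier A \<Longrightarrow> x \<star>\<^bsub>A\<^esub> y \<in> carrier A"
    and "\<And>x y. x \<in> carrier A \<Longrightarrow> y \<in> carrier A \<Longrightarrow> lambda_op A x y \<in> carrier A"
    and "\<And>x y. x \<in> carrier A \<Longrightarrow> y \<in> carrier A \<Longrightarrow> lambda_op A x y \<otimes>\<^bsub>A\<^esub> x = x \<star>\<^bsub>A\<^esub> y"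
proof -
  show A: "group A" and C: "group (circ_group A)" using assms by (auto simp: skew_left_brace_def)
  interpret A: group A by (rule A)
  interpret C: group "circ_group A" by (rule C)
  show *: "x \<star>\<^bsub>A\<^esub> y \<in> carrier A" if "x \<in> carrier A" "y \<in> carrier A" for x y
    using C.m_closed[of x y] that by (simp add: circ_group_def)
  show "lambda_op A x y \<in> carrier A" "lambda_op A x y \<otimes>\<^bsub>A\<^esub> x = x \<star>\<^bsub>A\<^esub> y"
    if "x \<in> carrier A" "y \<in> carrier A" for x y
    using that * by (simp_all add: lambda_op_def A.m_assoc)
qed

lemma circ_group_simps [simp]:
  "carrier (circ_group A) = carrier A" "x \<otimes>\<^bsub>circ_group A\<^esub> y = x \<star>\<^bsub>A\<^esub> y"
  by (simp_all add: circ_group_def)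

section \<open>Linear groups, brace representations and their equivalence\<close>

context complex_ambient_space
begin

lemma linear_between_closed: "linear_between V W f \<Longrightarrow> x \<in> V \<Longrightarrow> f x \<in> W"
  by (auto simp: linear_between_def)

lemma GL_carrier: "f \<in> carrier (GL V) \<longleftrightarrow> f \<in> Bij V \<and> linear_between V V f"
  by (simp add: GL_def)

lemma GL_mult: "f \<in> carrier (GL V) \<Longrightarrow> g \<in> carrier (GL V) \<Longrightarrow> f \<otimes>\<^bsub>GL V\<^esub> g = compose V f g"
  by (simp add: GL_def BijGroup_def)

lemma GL_one: "\<one>\<^bsub>GL V\<^esub> = (\<lambda>x\<in>V. x)"
  by (simp add: GL_def BijGroup_def)

lemma group_GL:
  assumes V: "subspace V"
  shows "group (GL V)"
proof -
  have "subgroup {f \<in> Bij V. linear_between V V f} (BijGroup V)"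
  proof (rule group.subgroupI[OF group_BijGroup])
    show "{f \<in> Bij V. linear_between V V f} \<subseteq> carrier (BijGroup V)"
      by (auto simp: BijGroup_def)
    have "(\<lambda>x\<in>V. x) \<in> {f \<in> Bij V. linear_between V V f}"
      using V by (auto simp: id_Bij linear_between_def subspace_add subspace_scale)
    then show "{f \<in> Bij V. linear_between V V f} \<noteq> {}" by blast
  next
    fix f assume "f \<in> {f \<in> Bij V. linear_between V V f}"
    then have f: "f \<in> Bij V" "linear_between V V f" by auto
    then have bij: "bij_betw f V V" by (simp add: Bij_def)
    let ?g = "inv_into V f"
    have g: "?g x \<in> V" "f (?g x) = x" if "x \<in> V" for x
      using bij that by (auto simp: bij_betw_def inv_into_into f_inv_into_f)
    have gf: "?g y = x" if "x \<in> V" "f x = y" for x y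
      using bij that by (auto simp: bij_betw_def)
    have "?g (x + y) = ?g x + ?g y" if "x \<in> V" "y \<in> V" for x y
      using f(2) g that V by (intro gf) (auto simp: linear_between_def subspace_add)
    moreover have "?g (c *s x) = c *s ?g x" if "x \<in> V" for c x
      using f(2) g that V by (intro gf) (auto simp: linear_between_def subspace_scale)
    ultimately have "linear_between V V (\<lambda>x\<in>V. ?g x)"
      using V g by (auto simp: linear_between_def subspace_add subspace_scale)
    then show "inv\<^bsub>BijGroup V\<^esub> f \<in> {f \<in> Bij V. linear_between V V f}"
      using f by (simp add: inv_BijGroup restrict_inv_into_Bij)
  next
    fix f g assume "f \<in> {f \<in> Bij V. linear_between V V f}" "g \<in> {f \<in> Bij V. linear_between V V f}"
    then have f: "f \<in> Bij V" "linear_between V V f" and g: "g \<in> Bij V" "linear_between V V g" by auto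
    then have "linear_between V V (compose V f g)"
      using V by (auto simp: linear_between_def compose_def subspace_add subspace_scale Pi_iff)
    then show "f \<otimes>\<^bsub>BijGroup V\<^esub> g \<in> {f \<in> Bij V. linear_between V V f}"
      using f g by (simp add: BijGroup_def compose_Bij)
  qed
  then show ?thesis
    unfolding GL_def by (rule group.subgroup_imp_group[OF group_BijGroup])
qed

lemma is_rep_if_hom_GL:
  assumes V: "subspace V" and G: "group G" and U: "U \<in> hom G (GL V)"
  shows "is_rep G V U"
proof -
  interpret group_hom G "GL V" U
    using G U group_GL[OF V] by (simp add: group_hom_def group_hom_axioms_def)
  have "linear_between V V (U x)" if "x \<in> carrier G" for x
    using that hom_closed by (simp add: GL_carrier)
  moreover have "U (x \<otimes>\<^bsub>G\<^esub> y) v = U x (U y v)" if "x \<in> carrier G" "y \<in> carrier G" "v \<in> V" for x y v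
    using that hom_closed by (simp add: GL_mult compose_def)
  moreover have "U \<one>\<^bsub>G\<^esub> v = v" if "v \<in> V" for v
    using that by (simp add: GL_one)
  ultimately show ?thesis using V by (simp add: is_rep_def)
qed

lemma restrict_in_hom_GL:
  assumes G: "group G" and U: "is_rep G V U"
  shows "(\<lambda>x. restrict (U x) V) \<in> hom G (GL V)"
proof -
  interpret G: group G by (rule G)
  have lin: "linear_between V V (U x)" if "x \<in> carrier G" for x
    using U that by (simp add: is_rep_def)
  then have cl: "U x v \<in> V" if "x \<in> carrier G" "v \<in> V" for x v
    using that by (auto intro: linear_between_closed)
  have V: "subspace V" using U by (simp add: is_rep_def)
  have mult: "U (x \<otimes>\<^bsub>G\<^esub> y) v = U x (U y v)" if "x \<in> carrier G" "y \<in> carrier G" "v \<in> V" for x y v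
    using U that by (simp add: is_rep_def)
  have inv: "U (inv\<^bsub>G\<^esub> x) (U x v) = v" "U x (U (inv\<^bsub>G\<^esub> x) v) = v"
    if "x \<in> carrier G" "v \<in> V" for x v
    using that U mult[of "inv\<^bsub>G\<^esub> x" x v] mult[of x "inv\<^bsub>G\<^esub> x" v] by (simp_all add: is_rep_def)
  have mem: "restrict (U x) V \<in> carrier (GL V)" if x: "x \<in> carrier G" for x
  proof -
    have "bij_betw (U x) V V"
      by (rule bij_betw_byWitness[where f' = "U (inv\<^bsub>G\<^esub> x)"]) (auto simp: inv x cl)
    then have "bij_betw (restrict (U x) V) V V"
      by (subst bij_betw_cong[of V _ "U x"]) auto
    moreover have "linear_between V V (restrict (U x) V)"
      using lin[OF x] by (subst linear_between_cong[of V _ "U x"]) (auto simp: V)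
    ultimately show ?thesis by (simp add: GL_carrier Bij_def)
  qed
  show ?thesis
  proof (rule homI)
    fix x y assume xy: "x \<in> carrier G" "y \<in> carrier G"
    then show "restrict (U (x \<otimes>\<^bsub>G\<^esub> y)) V = restrict (U x) V \<otimes>\<^bsub>GL V\<^esub> restrict (U y) V"
      by (auto simp: GL_mult mem compose_def fun_eq_iff mult cl)
  qed (rule mem)
qed

text \<open>The conjugation relation is restated without an inverse, as an identity between vectors
  that no longer mentions \<open>GL V\<close>.\<close>

lemma brace_repsD:
  assumes A: "skew_left_brace A" and R: "(V, \<beta>, \<rho>) \<in> brace_reps A"
  shows "subspace V" "is_rep A V \<beta>" "is_rep (circ_group A) V \<rho>"
    and "\<And>x y v. x \<in> carrier A \<Longrightarrow> y \<in> carrier A \<Longrightarrow> v \<in> V \<Longrightarrow>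
      \<beta> (lambda_op A x y) (\<rho> x v) = \<rho> x (\<beta> y v)"
proof -
  note A' = skew_left_braceD[OF A]
  show V: "subspace V" using R by (auto simp: brace_reps_def findim_subspace_def)
  have hom: "\<beta> \<in> hom A (GL V)" "\<rho> \<in> hom (circ_group A) (GL V)"
    using R by (auto simp: brace_reps_def)
  show "is_rep A V \<beta>" "is_rep (circ_group A) V \<rho>"
    using hom A' V by (auto intro!: is_rep_if_hom_GL)
  interpret GL: group "GL V" by (rule group_GL[OF V])
  fix x y v assume x: "x \<in> carrier A" and y: "y \<in> carrier A" and v: "v \<in> V"
  have mem: "\<beta> (lambda_op A x y) \<in> carrier (GL V)" "\<rho> x \<in> carrier (GL V)" "\<beta> y \<in> carrier (GL V)"
    using hom_in_carrier[OF hom(1)] hom_in_carrier[OF hom(2)] x y A'(4) by auto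
  have "\<beta> (lambda_op A x y) = \<rho> x \<otimes>\<^bsub>GL V\<^esub> \<beta> y \<otimes>\<^bsub>GL V\<^esub> inv\<^bsub>GL V\<^esub> (\<rho> x)"
    using R x y by (auto simp: brace_reps_def)
  then have "\<beta> (lambda_op A x y) \<otimes>\<^bsub>GL V\<^esub> \<rho> x = \<rho> x \<otimes>\<^bsub>GL V\<^esub> \<beta> y"
    using mem by (simp add: GL.m_assoc)
  then have "compose V (\<beta> (lambda_op A x y)) (\<rho> x) = compose V (\<rho> x) (\<beta> y)"
    using mem by (simp add: GL_mult)
  then show "\<beta> (lambda_op A x y) (\<rho> x v) = \<rho> x (\<beta> y v)"
    using v by (auto simp: compose_def dest!: fun_cong[where x = v])
qed

text \<open>The converse passage; cutting the operators down to \<open>V\<close> supplies the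
  extensionality built into \<open>GL V\<close>.\<close>

lemma brace_repsI:
  assumes A: "skew_left_brace A" and V: "findim_subspace V"
    and b: "is_rep A V \<beta>" and r: "is_rep (circ_group A) V \<rho>"
    and comm: "\<And>x y v. x \<in> carrier A \<Longrightarrow> y \<in> carrier A \<Longrightarrow> v \<in> V \<Longrightarrow>
      \<beta> (lambda_op A x y) (\<rho> x v) = \<rho> x (\<beta> y v)"
  shows "(V, \<lambda>x. restrict (\<beta> x) V, \<lambda>x. restrict (\<rho> x) V) \<in> brace_reps A"
proof -
  note A' = skew_left_braceD[OF A]
  let ?b = "\<lambda>x. restrict (\<beta> x) V" and ?r = "\<lambda>x. restrict (\<rho> x) V"
  have hom: "?b \<in> hom A (GL V)" "?r \<in> hom (circ_group A) (GL V)"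
    using A' b r by (auto intro: restrict_in_hom_GL)
  interpret GL: group "GL V" using b by (intro group_GL) (simp add: is_rep_def)
  have "?b (lambda_op A x y) = ?r x \<otimes>\<^bsub>GL V\<^esub> ?b y \<otimes>\<^bsub>GL V\<^esub> inv\<^bsub>GL V\<^esub> (?r x)"
    if x: "x \<in> carrier A" and y: "y \<in> carrier A" for x y
  proof -
    have mem: "?b (lambda_op A x y) \<in> carrier (GL V)" "?r x \<in> carrier (GL V)" "?b y \<in> carrier (GL V)"
      using hom_in_carrier[OF hom(1)] hom_in_carrier[OF hom(2)] x y A'(4) by auto
    have "\<beta> y v \<in> V" "\<rho> x v \<in> V" if "v \<in> V" for v
      using b r x y that by (auto simp: is_rep_def linear_between_def)
    then have "?b (lambda_op A x y) \<otimes>\<^bsub>GL V\<^esub> ?r x = ?r x \<otimes>\<^bsub>GL V\<^esub> ?b y"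
      using comm[OF x y] by (auto simp: GL_mult[OF mem(1,2)] GL_mult[OF mem(2,3)] compose_def fun_eq_iff)
    then show ?thesis using GL.inv_solve_right[OF mem(1) GL.m_closed[OF mem(2,3)] mem(2)] by simp
  qed
  then show ?thesis using hom V by (auto simp: brace_reps_def)
qed

lemma equiv_rep_equiv: "equiv (brace_reps A) (rep_equiv A)"
proof (rule equivI)
  show "rep_equiv A \<subseteq> brace_reps A \<times> brace_reps A" by (auto simp: rep_equiv_def)
  show "refl_on (brace_reps A) (rep_equiv A)"
  proof (rule refl_onI)
    fix R assume "R \<in> brace_reps A"
    then obtain V \<beta> \<rho> where R: "R = (V, \<beta>, \<rho>)" "(V, \<beta>, \<rho>) \<in> brace_reps A" by (cases R) auto
    have "linear_between V V (\<lambda>x. x)" "bij_betw (\<lambda>x. x) V V"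
      by (auto simp: linear_between_def bij_betw_def)
    then show "(R, R) \<in> rep_equiv A" using R unfolding rep_equiv_def by blast
  qed
  show "sym (rep_equiv A)"
  proof (rule symI)
    fix R R' assume "(R, R') \<in> rep_equiv A"
    then obtain V \<beta> \<rho> V' \<beta>' \<rho>' \<phi> where R: "R = (V, \<beta>, \<rho>)" "R' = (V', \<beta>', \<rho>')"
      and rep: "(V, \<beta>, \<rho>) \<in> brace_reps A" "(V', \<beta>', \<rho>') \<in> brace_reps A"
      and phi: "linear_between V V' \<phi>" "bij_betw \<phi> V V'"
      and comm: "\<forall>a\<in>carrier A. \<forall>v\<in>V. \<phi> (\<beta> a v) = \<beta>' a (\<phi> v) \<and> \<phi> (\<rho> a v) = \<rho>' a (\<phi> v)"
      unfolding rep_equiv_def by auto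
    have V: "subspace V" using rep by (auto simp: brace_reps_def findim_subspace_def)
    let ?g = "inv_into V \<phi>"
    have g: "?g x \<in> V" "\<phi> (?g x) = x" if "x \<in> V'" for x
      using phi(2) that by (auto simp: bij_betw_def inv_into_into f_inv_into_f)
    have gf: "?g y = x" if "x \<in> V" "\<phi> x = y" for x y
      using phi(2) that by (auto simp: bij_betw_def)
    have cl: "\<beta> a v \<in> V" "\<rho> a v \<in> V" if "a \<in> carrier A" "v \<in> V" for a v
    proof -
      have "\<beta> a \<in> carrier (GL V)" "\<rho> a \<in> carrier (GL V)"
        using rep(1) that by (auto simp: brace_reps_def hom_def)
      then show "\<beta> a v \<in> V" "\<rho> a v \<in> V"
        using that by (auto simp: GL_carrier linear_between_def)
    qed
    have "bij_betw ?g V' V" using phi(2) by (rule bij_betw_inv_into)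
    moreover have "?g (x + y) = ?g x + ?g y" if "x \<in> V'" "y \<in> V'" for x y
      using phi(1) g that V by (intro gf) (auto simp: linear_between_def subspace_add)
    moreover have "?g (c *s x) = c *s ?g x" if "x \<in> V'" for c x
      using phi(1) g that V by (intro gf) (auto simp: linear_between_def subspace_scale)
    moreover have "?g (\<beta>' a v) = \<beta> a (?g v) \<and> ?g (\<rho>' a v) = \<rho> a (?g v)"
      if "a \<in> carrier A" "v \<in> V'" for a v
      using comm g that cl by (auto intro!: gf)
    ultimately show "(R', R) \<in> rep_equiv A"
      using R rep g(1) unfolding rep_equiv_def linear_between_def by blast
  qed
  show "trans (rep_equiv A)"
  proof (rule transI)
    fix R1 R2 R3 assume 12: "(R1, R2) \<in> rep_equiv A" and 23: "(R2, R3) \<in> rep_equiv A"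
    from 12 obtain V1 \<beta>1 \<rho>1 V2 \<beta>2 \<rho>2 \<phi> where R: "R1 = (V1, \<beta>1, \<rho>1)" "R2 = (V2, \<beta>2, \<rho>2)"
      and rep: "(V1, \<beta>1, \<rho>1) \<in> brace_reps A"
      and phi: "linear_between V1 V2 \<phi>" "bij_betw \<phi> V1 V2"
      and comm: "\<forall>a\<in>carrier A. \<forall>v\<in>V1. \<phi> (\<beta>1 a v) = \<beta>2 a (\<phi> v) \<and> \<phi> (\<rho>1 a v) = \<rho>2 a (\<phi> v)"
      unfolding rep_equiv_def by auto
    from 23 obtain V3 \<beta>3 \<rho>3 \<psi> where R3: "R3 = (V3, \<beta>3, \<rho>3)"
      and rep3: "(V3, \<beta>3, \<rho>3) \<in> brace_reps A"
      and psi: "linear_between V2 V3 \<psi>" "bij_betw \<psi> V2 V3"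
      and comm3: "\<forall>a\<in>carrier A. \<forall>v\<in>V2. \<psi> (\<beta>2 a v) = \<beta>3 a (\<psi> v) \<and> \<psi> (\<rho>2 a v) = \<rho>3 a (\<psi> v)"
      unfolding rep_equiv_def R by auto
    have "\<phi> v \<in> V2" if "v \<in> V1" for v using phi that by (auto simp: linear_between_def)
    then have "linear_between V1 V3 (\<psi> \<circ> \<phi>)"
      "\<forall>a\<in>carrier A. \<forall>v\<in>V1. (\<psi> \<circ> \<phi>) (\<beta>1 a v) = \<beta>3 a ((\<psi> \<circ> \<phi>) v) \<and> (\<psi> \<circ> \<phi>) (\<rho>1 a v) = \<rho>3 a ((\<psi> \<circ> \<phi>) v)"
      using phi psi comm comm3 by (auto simp: linear_between_def Pi_iff)
    moreover have "bij_betw (\<psi> \<circ> \<phi>) V1 V3" using phi(2) psi(2) by (rule bij_betw_trans)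
    ultimately show "(R1, R3) \<in> rep_equiv A" using R(1) R3 rep rep3 unfolding rep_equiv_def by blast
  qed
qed

lemma irreducible_if_dim_1:
  assumes R: "R \<in> brace_reps A" and dim: "rep_dim R = 1"
  shows "irreducible_rep A R"
proof -
  obtain V \<beta> \<rho> where RV: "R = (V, \<beta>, \<rho>)" by (cases R) auto
  have V: "subspace V" and d: "dim V = 1"
    using R dim by (auto simp: RV brace_reps_def findim_subspace_def rep_dim_def)
  obtain B where B: "B \<subseteq> V" "independent B" "V \<subseteq> span B" "card B = 1"
    using basis_exists[of V] d by metis
  then obtain b where b: "B = {b}" using card_1_singletonE by blast
  have Vb: "V = span {b}" using B b V span_minimal by blast
  have "b \<noteq> 0" using B(2) b by simp
  then have ne: "V \<noteq> {0}" using B b by auto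
  have "W = {0} \<or> W = V" if W: "subspace W" "W \<subseteq> V" for W
  proof (rule disjCI)
    assume "W \<noteq> V"
    show "W = {0}"
    proof (rule ccontr)
      assume "W \<noteq> {0}"
      then obtain w where w: "w \<in> W" "w \<noteq> 0" using W subspace_0 by blast
      then obtain k where k: "w = k *s b" using W Vb by (auto simp: span_singleton)
      then have "(1 / k) *s w = b" using w by auto
      then have "b \<in> W" using W w subspace_scale by metis
      then have "V \<subseteq> W" using Vb W span_minimal by (metis empty_subsetI insert_subset)
      then show False using W \<open>W \<noteq> V\<close> by blast
    qed
  qed
  then show ?thesis using ne by (auto simp: irreducible_rep_def RV)
qed

text \<open>A line has no proper nonzero subspace, so the one-dimensional counts of the theorem are
  counts of irreducibles.\<close>

lemma num_reps_1: "num_reps A 1 = num_irreps A 1"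
  unfolding num_reps_def num_irreps_def using irreducible_if_dim_1[of _ A]
  by (metis (no_types, lifting))

end

text \<open>The semidirect product of the additive group by the circle group, along \<open>\<lambda>\<^sup>o\<^sup>p\<close>, is identified with
  \<open>\<Gamma>\<close>.\<close>

locale brace_split = dual_action N XN eN H XH eH a aX
  for N :: "('n, 'l) monoid_scheme" and XN :: "'c set" and eN
    and H :: "('h, 'k) monoid_scheme" and XH :: "'d set" and eH
    and a :: "'h \<Rightarrow> 'n \<Rightarrow> 'n" and aX :: "'h \<Rightarrow> 'c \<Rightarrow> 'c" +
  fixes A :: "('a, 'm) skew_brace_scheme" and i j :: "'a \<Rightarrow> 'n \<times> 'h"
  assumes brace: "skew_left_brace A"
    and i_hom: "i \<in> hom A (semidirect N H a)"
    and j_hom: "j \<in> hom (circ_group A) (semidirect N H a)"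
    and ij_bij: "bij_betw (\<lambda>(x, y). i x \<otimes>\<^bsub>semidirect N H a\<^esub> j y) (carrier A \<times> carrier A)
      (carrier (semidirect N H a))"
    and j_i: "x \<in> carrier A \<Longrightarrow> y \<in> carrier A \<Longrightarrow>
      j x \<otimes>\<^bsub>semidirect N H a\<^esub> i y = i (lambda_op A x y) \<otimes>\<^bsub>semidirect N H a\<^esub> j x"
begin

sublocale A: group A using skew_left_braceD[OF brace] by simp
sublocale C: group "circ_group A" using skew_left_braceD[OF brace] by simp
sublocale \<Gamma>: monoid \<Gamma> by (rule monoid_\<Gamma>)

lemma lambda_closed: "x \<in> carrier A \<Longrightarrow> y \<in> carrier A \<Longrightarrow> lambda_op A x y \<in> carrier A"
  and circ_closed: "x \<in> carrier A \<Longrightarrow> y \<in> carrier A \<Longrightarrow> x \<star>\<^bsub>A\<^esub> y \<in> carrier A"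
  using skew_left_braceD[OF brace] by auto

lemma i_closed: "x \<in> carrier A \<Longrightarrow> i x \<in> carrier \<Gamma>"
  and j_closed: "x \<in> carrier A \<Longrightarrow> j x \<in> carrier \<Gamma>"
  using hom_in_carrier[OF i_hom] hom_in_carrier[OF j_hom] by auto

lemma i_mult: "x \<in> carrier A \<Longrightarrow> y \<in> carrier A \<Longrightarrow> i (x \<otimes>\<^bsub>A\<^esub> y) = i x \<otimes>\<^bsub>\<Gamma>\<^esub> i y"
  and j_mult: "x \<in> carrier A \<Longrightarrow> y \<in> carrier A \<Longrightarrow> j (x \<star>\<^bsub>A\<^esub> y) = j x \<otimes>\<^bsub>\<Gamma>\<^esub> j y"
  using hom_mult[OF i_hom] hom_mult[OF j_hom] by auto

text \<open>\<Gamma> is available as a monoid only, where a multiplicative map could send the unit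
  to another idempotent; this rules it out for \<open>i\<close> and \<open>j\<close>.\<close>

lemma idem_\<Gamma>:
  assumes "x \<in> carrier \<Gamma>" "x \<otimes>\<^bsub>\<Gamma>\<^esub> x = x"
  shows "x = \<one>\<^bsub>\<Gamma>\<^esub>"
proof -
  obtain n h where x: "x = (n, h)" "n \<in> carrier N" "h \<in> carrier H" using assms(1) by auto
  have "n \<otimes>\<^bsub>N\<^esub> a h n = n" "h \<otimes>\<^bsub>H\<^esub> h = h" using assms(2) x by auto
  then have "h = \<one>\<^bsub>H\<^esub>" using H.r_cancel_one x by simp
  then show ?thesis using \<open>n \<otimes>\<^bsub>N\<^esub> a h n = n\<close> x N.r_cancel_one by (simp add: a_one)
qed

lemma i_one: "i \<one>\<^bsub>A\<^esub> = \<one>\<^bsub>\<Gamma>\<^esub>"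
  using i_mult[of "\<one>\<^bsub>A\<^esub>" "\<one>\<^bsub>A\<^esub>"] by (intro idem_\<Gamma> i_closed) auto

lemma circ_one_closed: "\<one>\<^bsub>circ_group A\<^esub> \<in> carrier A"
  using C.one_closed by simp

lemma j_one: "j \<one>\<^bsub>circ_group A\<^esub> = \<one>\<^bsub>\<Gamma>\<^esub>"
  using j_mult[OF circ_one_closed circ_one_closed] C.l_one[of "\<one>\<^bsub>circ_group A\<^esub>"]
  by (intro idem_\<Gamma> j_closed circ_one_closed) (simp add: circ_one_closed)

text \<open>Coordinates of an element of \<Gamma> in its factorization as \<open>i x\<close> times
  \<open>j y\<close>, unique by \<open>ij_bij\<close>.\<close>

definition \<kappa> :: "'n \<times> 'h \<Rightarrow> 'a \<times> 'a" where
  "\<kappa> = inv_into (carrier A \<times> carrier A) (\<lambda>(x, y). i x \<otimes>\<^bsub>\<Gamma>\<^esub> j y)"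

definition gact :: "('a \<Rightarrow> 'v \<Rightarrow> 'v) \<Rightarrow> ('a \<Rightarrow> 'v \<Rightarrow> 'v) \<Rightarrow> 'n \<times> 'h \<Rightarrow> 'v \<Rightarrow> 'v" where
  "gact \<beta> \<rho> z v = \<beta> (fst (\<kappa> z)) (\<rho> (snd (\<kappa> z)) v)"

lemma gact_ij: "x \<in> carrier A \<Longrightarrow> y \<in> carrier A \<Longrightarrow> gact \<beta> \<rho> (i x \<otimes>\<^bsub>\<Gamma>\<^esub> j y) v = \<beta> x (\<rho> y v)"
  using bij_betw_inv_into_left[OF ij_bij, of "(x, y)"] by (simp add: gact_def \<kappa>_def)

lemma \<Gamma>_cases:
  assumes "z \<in> carrier \<Gamma>"
  obtains x y where "x \<in> carrier A" "y \<in> carrier A" "z = i x \<otimes>\<^bsub>\<Gamma>\<^esub> j y"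
proof -
  have "z \<in> (\<lambda>(x, y). i x \<otimes>\<^bsub>\<Gamma>\<^esub> j y) ` (carrier A \<times> carrier A)"
    using assms ij_bij by (simp only: bij_betw_def)
  then show thesis using that by (auto simp del: semidirect_simps)
qed

end

section \<open>Passage between brace representations and actions of \<Gamma>\<close>

locale ambient_brace_split = complex_ambient_space scale + brace_split N XN eN H XH eH a aX A i j
  for scale :: "complex \<Rightarrow> 'v::ab_group_add \<Rightarrow> 'v"  (infixr \<open>*s\<close> 75)
    and N :: "('n, 'l) monoid_scheme" and XN :: "'c set" and eN
    and H :: "('h, 'k) monoid_scheme" and XH :: "'d set" and eH
    and a :: "'h \<Rightarrow> 'n \<Rightarrow> 'n" and aX :: "'h \<Rightarrow> 'c \<Rightarrow> 'c"
    and A :: "('a, 'm) skew_brace_scheme" and i j :: "'a \<Rightarrow> 'n \<times> 'h"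
begin

lemma gact_i:
  assumes "(V, \<beta>, \<rho>) \<in> brace_reps A" "x \<in> carrier A" "v \<in> V"
  shows "gact \<beta> \<rho> (i x) v = \<beta> x v"
  using gact_ij[OF assms(2) circ_one_closed, of \<beta> \<rho> v] brace_repsD(3)[OF brace assms(1)]
    assms i_closed[of x] by (simp add: j_one is_rep_def del: semidirect_simps)

lemma gact_j:
  assumes "(V, \<beta>, \<rho>) \<in> brace_reps A" "y \<in> carrier A" "v \<in> V"
  shows "gact \<beta> \<rho> (j y) v = \<rho> y v"
proof -
  have "\<rho> y v \<in> V" using brace_repsD(3)[OF brace assms(1)] assms by (auto simp: is_rep_def linear_between_def)
  then show ?thesis
    using gact_ij[OF A.one_closed assms(2), of \<beta> \<rho> v] brace_repsD(2)[OF brace assms(1)] assms j_closed[of y]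
    by (simp add: i_one is_rep_def del: semidirect_simps)
qed

text \<open>A product of two factorized elements is brought to normal form by moving
  \<open>j y\<close> past \<open>i x'\<close> with \<open>j_i\<close>. The same move on the
  operators is the compatibility relation of a brace representation.\<close>

lemma gact_is_rep:
  assumes R: "(V, \<beta>, \<rho>) \<in> brace_reps A"
  shows "is_rep \<Gamma> V (gact \<beta> \<rho>)"
proof -
  note D = brace_repsD[OF brace R]
  have b: "linear_between V V (\<beta> x)" and r: "linear_between V V (\<rho> x)" if "x \<in> carrier A" for x
    using D that by (auto simp: is_rep_def)
  have cl: "\<beta> x v \<in> V" "\<rho> x v \<in> V" if "x \<in> carrier A" "v \<in> V" for x v
    using b r that by (auto intro: linear_between_closed)
  show ?thesis
    unfolding is_rep_def
  proof (intro conjI ballI)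
    show "subspace V" by (rule D)
    fix z assume "z \<in> carrier \<Gamma>"
    then obtain x y where z: "x \<in> carrier A" "y \<in> carrier A" "z = i x \<otimes>\<^bsub>\<Gamma>\<^esub> j y" by (rule \<Gamma>_cases)
    show "linear_between V V (gact \<beta> \<rho> z)"
      using b[OF z(1)] r[OF z(2)] z by (auto simp: linear_between_def gact_ij Pi_iff)
    fix z' v assume "z' \<in> carrier \<Gamma>" and v: "v \<in> V"
    then obtain x' y' where z': "x' \<in> carrier A" "y' \<in> carrier A" "z' = i x' \<otimes>\<^bsub>\<Gamma>\<^esub> j y'"
      using \<Gamma>_cases by metis
    note cls = z z' i_closed j_closed lambda_closed circ_closed
    have "z \<otimes>\<^bsub>\<Gamma>\<^esub> z' = i x \<otimes>\<^bsub>\<Gamma>\<^esub> (j y \<otimes>\<^bsub>\<Gamma>\<^esub> i x') \<otimes>\<^bsub>\<Gamma>\<^esub> j y'"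
      using cls by (simp add: \<Gamma>.m_assoc del: semidirect_simps)
    also have "\<dots> = (i x \<otimes>\<^bsub>\<Gamma>\<^esub> i (lambda_op A y x')) \<otimes>\<^bsub>\<Gamma>\<^esub> (j y \<otimes>\<^bsub>\<Gamma>\<^esub> j y')"
      using cls by (simp add: j_i \<Gamma>.m_assoc del: semidirect_simps)
    also have "\<dots> = i (x \<otimes>\<^bsub>A\<^esub> lambda_op A y x') \<otimes>\<^bsub>\<Gamma>\<^esub> j (y \<star>\<^bsub>A\<^esub> y')"
      using cls by (simp add: i_mult j_mult)
    finally have "gact \<beta> \<rho> (z \<otimes>\<^bsub>\<Gamma>\<^esub> z') v = \<beta> (x \<otimes>\<^bsub>A\<^esub> lambda_op A y x') (\<rho> (y \<star>\<^bsub>A\<^esub> y') v)"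
      using cls by (simp add: gact_ij)
    also have "\<dots> = \<beta> x (\<beta> (lambda_op A y x') (\<rho> y (\<rho> y' v)))"
      using D(2,3) cls v cl by (simp add: is_rep_def)
    also have "\<dots> = \<beta> x (\<rho> y (\<beta> x' (\<rho> y' v)))"
      using D(4) cls v cl by simp
    finally show "gact \<beta> \<rho> (z \<otimes>\<^bsub>\<Gamma>\<^esub> z') v = gact \<beta> \<rho> z (gact \<beta> \<rho> z' v)"
      using cls by (simp add: gact_ij)
  next
    fix v assume v: "v \<in> V"
    have "gact \<beta> \<rho> (i \<one>\<^bsub>A\<^esub>) v = v"
      using gact_i[OF R A.one_closed v] D(2) v by (simp add: is_rep_def)
    then show "gact \<beta> \<rho> \<one>\<^bsub>\<Gamma>\<^esub> v = v" by (simp add: i_one)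
  qed
qed

lemma irreducible_rep_iff:
  assumes R: "(V, \<beta>, \<rho>) \<in> brace_reps A"
  shows "irreducible_rep A (V, \<beta>, \<rho>) \<longleftrightarrow> irreducible_action \<Gamma> V (gact \<beta> \<rho>)"
proof -
  have inv: "(\<forall>x\<in>carrier A. \<beta> x ` W \<subseteq> W \<and> \<rho> x ` W \<subseteq> W) \<longleftrightarrow> (\<forall>z\<in>carrier \<Gamma>. gact \<beta> \<rho> z ` W \<subseteq> W)"
    (is "?l \<longleftrightarrow> ?r") if W: "W \<subseteq> V" for W
  proof
    assume l: ?l
    show ?r
    proof
      fix z assume "z \<in> carrier \<Gamma>"
      then obtain x y where "x \<in> carrier A" "y \<in> carrier A" "z = i x \<otimes>\<^bsub>\<Gamma>\<^esub> j y" by (rule \<Gamma>_cases)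
      then show "gact \<beta> \<rho> z ` W \<subseteq> W" using l by (auto simp: gact_ij image_subset_iff)
    qed
  next
    assume r: ?r
    have "\<beta> x w \<in> W" "\<rho> x w \<in> W" if x: "x \<in> carrier A" and w: "w \<in> W" for x w
    proof -
      have "gact \<beta> \<rho> (i x) w \<in> W" "gact \<beta> \<rho> (j x) w \<in> W" using r i_closed j_closed x w by blast+
      then show "\<beta> x w \<in> W" "\<rho> x w \<in> W" using gact_i[OF R x] gact_j[OF R x] W w by auto
    qed
    then show ?l by blast
  qed
  show ?thesis
    unfolding irreducible_rep_def irreducible_action_def prod.case by (simp only: inv cong: conj_cong)
qed

lemma rep_equiv_iff:
  assumes R: "(V, \<beta>, \<rho>) \<in> brace_reps A" and R': "(V', \<beta>', \<rho>') \<in> brace_reps A"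
  shows "((V, \<beta>, \<rho>), (V', \<beta>', \<rho>')) \<in> rep_equiv A \<longleftrightarrow>
    action_equiv \<Gamma> V (gact \<beta> \<rho>) V' (gact \<beta>' \<rho>')"
proof -
  have "(\<forall>x\<in>carrier A. \<forall>v\<in>V. \<phi> (\<beta> x v) = \<beta>' x (\<phi> v) \<and> \<phi> (\<rho> x v) = \<rho>' x (\<phi> v)) \<longleftrightarrow>
    (\<forall>z\<in>carrier \<Gamma>. \<forall>v\<in>V. \<phi> (gact \<beta> \<rho> z v) = gact \<beta>' \<rho>' z (\<phi> v))" (is "?l \<longleftrightarrow> ?r")
    if phi: "linear_between V V' \<phi>" for \<phi>
  proof
    assume l: ?l
    show ?r
    proof (intro ballI)
      fix z v assume "z \<in> carrier \<Gamma>" and v: "v \<in> V"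
      then obtain x y where z: "x \<in> carrier A" "y \<in> carrier A" "z = i x \<otimes>\<^bsub>\<Gamma>\<^esub> j y" by (metis \<Gamma>_cases)
      have "\<rho> y v \<in> V" using brace_repsD(3)[OF brace R] z v by (auto simp: is_rep_def linear_between_def)
      then show "\<phi> (gact \<beta> \<rho> z v) = gact \<beta>' \<rho>' z (\<phi> v)" using l z v by (simp add: gact_ij)
    qed
  next
    assume r: ?r
    have "\<phi> (\<beta> x v) = \<beta>' x (\<phi> v) \<and> \<phi> (\<rho> x v) = \<rho>' x (\<phi> v)" if x: "x \<in> carrier A" and v: "v \<in> V" for x v
    proof -
      have "\<phi> v \<in> V'" using phi v by (auto simp: linear_between_def)
      then show ?thesis
        using r i_closed[OF x] j_closed[OF x] v gact_i[OF R x v] gact_j[OF R x v]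
          gact_i[OF R' x] gact_j[OF R' x] by metis
    qed
    then show ?l by blast
  qed
  then show ?thesis using R R' unfolding rep_equiv_def action_equiv_def by blast
qed

lemma irr_split_rep_gact:
  assumes "(V, \<beta>, \<rho>) \<in> brace_reps A" "irreducible_rep A (V, \<beta>, \<rho>)"
  shows "irr_split_rep scale N XN eN H XH eH a aX V (gact \<beta> \<rho>)"
  using assms gact_is_rep irreducible_rep_iff by unfold_locales auto

text \<open>The operators are cut down to \<open>V\<close> to lie in \<open>GL V\<close>, so
  \<open>gact\<close> agrees with \<open>R\<close> on \<open>V\<close> only. The identity of
  \<open>V\<close> is then an equivalence, and \<open>occ\<close> is invariant under
  equivalence.\<close>

lemma brace_rep_of_action:
  assumes "irr_split_rep scale N XN eN H XH eH a aX V R" and V: "findim_subspace V"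
  shows "\<exists>\<beta> \<rho>. (V, \<beta>, \<rho>) \<in> brace_reps A \<and> irreducible_rep A (V, \<beta>, \<rho>) \<and>
    split_rep.occ scale N XN eN H XH eH V (gact \<beta> \<rho>) = split_rep.occ scale N XN eN H XH eH V R"
proof -
  interpret r: irr_split_rep scale N XN eN H XH eH a aX V R by (rule assms(1))
  have rep: "subspace V" "\<And>z. z \<in> carrier \<Gamma> \<Longrightarrow> linear_between V V (R z)"
    "\<And>z z' v. z \<in> carrier \<Gamma> \<Longrightarrow> z' \<in> carrier \<Gamma> \<Longrightarrow> v \<in> V \<Longrightarrow> R (z \<otimes>\<^bsub>\<Gamma>\<^esub> z') v = R z (R z' v)"
    "\<And>v. v \<in> V \<Longrightarrow> R \<one>\<^bsub>\<Gamma>\<^esub> v = v"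
    using r.rep unfolding is_rep_def by blast+
  let ?b = "\<lambda>x. restrict (R (i x)) V" and ?r = "\<lambda>x. restrict (R (j x)) V"
  have mem: "(V, ?b, ?r) \<in> brace_reps A"
  proof (rule brace_repsI[OF brace V])
    show "is_rep A V (\<lambda>x. R (i x))"
      unfolding is_rep_def using rep i_closed i_mult i_one by auto
    show "is_rep (circ_group A) V (\<lambda>x. R (j x))"
      unfolding is_rep_def using rep j_closed j_mult j_one by auto
    fix x y v assume "x \<in> carrier A" "y \<in> carrier A" "v \<in> V"
    then show "R (i (lambda_op A x y)) (R (j x) v) = R (j x) (R (i y) v)"
      using rep(3)[OF i_closed j_closed, of "lambda_op A x y" x v] rep(3)[OF j_closed i_closed, of x y v]
      by (simp add: lambda_closed j_i)
  qed
  have eq: "gact ?b ?r z v = R z v" if "z \<in> carrier \<Gamma>" and v: "v \<in> V" for z v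
  proof -
    obtain x y where z: "x \<in> carrier A" "y \<in> carrier A" "z = i x \<otimes>\<^bsub>\<Gamma>\<^esub> j y"
      using \<Gamma>_cases \<open>z \<in> carrier \<Gamma>\<close> by metis
    have "R (j y) v \<in> V" using rep(2)[OF j_closed[OF z(2)]] v by (auto simp: linear_between_def)
    then show ?thesis using z v by (simp add: gact_ij rep(3) i_closed j_closed del: semidirect_simps)
  qed
  have "R z ` W = gact ?b ?r z ` W" if "z \<in> carrier \<Gamma>" "W \<subseteq> V" for z W
    using eq[OF that(1)] that(2) by (intro image_cong) auto
  then have irr: "irreducible_rep A (V, ?b, ?r)"
    using r.irr unfolding irreducible_rep_iff[OF mem] irreducible_action_def by simp
  interpret r': irr_split_rep scale N XN eN H XH eH a aX V "gact ?b ?r"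
    using irr_split_rep_gact[OF mem irr] .
  have "linear_between V V (\<lambda>x. x)" "bij_betw (\<lambda>x. x) V V"
    by (auto simp: linear_between_def bij_betw_def)
  then have "action_equiv \<Gamma> V (gact ?b ?r) V R"
    unfolding action_equiv_def using eq by blast
  then have "r'.occ = r.occ" using r'.equiv_iff_occ(1)[OF assms(1)] by simp
  then show ?thesis using mem irr by blast
qed

end

theorem (in brace_split) num_irreps_eq:
  "cseq.num_irreps A d * d\<^sup>2 = card {\<omega> \<in> XN. card (orbit \<omega>) = d} * card XH"
proof -
  interpret ambient_brace_split seq_scale N XN eN H XH eH a aX A i j
    by unfold_locales
  define Q where "Q = {R \<in> cseq.brace_reps A. cseq.irreducible_rep A R \<and> cseq.rep_dim R = d}"
  define oc where "oc R = split_rep.occ seq_scale N XN eN H XH eH (fst R) (gact (fst (snd R)) (snd (snd R)))"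
    for R :: "('a, nat \<Rightarrow> complex) brace_rep"
  define I where "I = {\<omega> \<in> XN. card (orbit \<omega>) = d} \<times> XH"
  have finI: "finite I" unfolding I_def using N.finite_X H.finite_X by auto
  have Q: "irr_split_rep seq_scale N XN eN H XH eH a aX (fst R) (gact (fst (snd R)) (snd (snd R)))"
    if "R \<in> Q" for R
    using that irr_split_rep_gact by (cases R) (auto simp: Q_def)
  have ocI: "oc R \<subseteq> I" and oc_card: "card (oc R) = d\<^sup>2" and oc_ne: "oc R \<noteq> {}" if R: "R \<in> Q" for R
  proof -
    interpret r: irr_split_rep seq_scale N XN eN H XH eH a aX "fst R" "gact (fst (snd R)) (snd (snd R))"
      using Q[OF R] .
    have d: "cseq.dim (fst R) = d" using R by (simp add: Q_def cseq.rep_dim_def)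
    show "card (oc R) = d\<^sup>2" using r.card_occ d by (simp add: oc_def power2_eq_square)
    show "oc R \<subseteq> I"
    proof
      fix x assume x: "x \<in> oc R"
      then have "fst x \<in> XN" "snd x \<in> XH" by (auto simp: oc_def r.occ_def)
      moreover have "card (orbit (fst x)) = d"
        using r.dim_of_occ[of "fst x" "snd x"] x d by (simp add: oc_def)
      ultimately show "x \<in> I" by (auto simp: I_def mem_Times_iff)
    qed
    show "oc R \<noteq> {}" using r.occ_nonempty by (simp add: oc_def)
  qed
  have eqv: "(R, R') \<in> cseq.rep_equiv A \<longleftrightarrow> oc R = oc R'"
    and meet: "oc R = oc R' \<longleftrightarrow> oc R \<inter> oc R' \<noteq> {}" if R: "R \<in> Q" "R' \<in> Q" for R R'
  proof -
    interpret r: irr_split_rep seq_scale N XN eN H XH eH a aX "fst R" "gact (fst (snd R)) (snd (snd R))"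
      using Q[OF R(1)] .
    have "(R, R') \<in> cseq.rep_equiv A \<longleftrightarrow>
        cseq.action_equiv \<Gamma> (fst R) (gact (fst (snd R)) (snd (snd R))) (fst R') (gact (fst (snd R')) (snd (snd R')))"
      using rep_equiv_iff[of "fst R" "fst (snd R)" "snd (snd R)" "fst R'" "fst (snd R')" "snd (snd R')"] R
      by (simp add: Q_def)
    then show "(R, R') \<in> cseq.rep_equiv A \<longleftrightarrow> oc R = oc R'"
      using r.equiv_iff_occ(1)[OF Q[OF R(2)]] by (simp add: oc_def)
    show "oc R = oc R' \<longleftrightarrow> oc R \<inter> oc R' \<noteq> {}"
      using r.equiv_iff_occ(2)[OF Q[OF R(2)]] by (simp add: oc_def)
  qed
  have cover: "\<exists>R\<in>Q. x \<in> oc R" if x: "x \<in> I" for x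
  proof -
    obtain \<omega> \<Psi> where xo: "x = (\<omega>, \<Psi>)" "\<omega> \<in> XN" "\<Psi> \<in> XH" "card (orbit \<omega>) = d"
      using x by (auto simp: I_def)
    obtain V R where VR: "irr_split_rep seq_scale N XN eN H XH eH a aX V R" "cseq.findim_subspace V"
      "(\<omega>, \<Psi>) \<in> split_rep.occ seq_scale N XN eN H XH eH V R"
      using exists_irr_split_rep[OF xo(2,3)] by blast
    then obtain \<beta> \<rho> where b: "(V, \<beta>, \<rho>) \<in> cseq.brace_reps A" "cseq.irreducible_rep A (V, \<beta>, \<rho>)"
      and o: "(\<omega>, \<Psi>) \<in> oc (V, \<beta>, \<rho>)"
      using brace_rep_of_action[OF VR(1,2)] by (auto simp: oc_def)
    have "cseq.dim V = d"
      using irr_split_rep.dim_of_occ[OF VR(1,3)] xo by simp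
    then show ?thesis using b o xo by (auto simp: Q_def cseq.rep_dim_def)
  qed
  have equiv: "equiv (cseq.brace_reps A) (cseq.rep_equiv A)" by (rule cseq.equiv_rep_equiv)
  have "card (Q // cseq.rep_equiv A) = card (oc ` Q)"
  proof -
    \<comment> \<open>A value for each class, read off from an arbitrary representative in
      \<open>Q\<close>; \<open>eqv\<close> makes it independent of the choice and injective.\<close>
    define F where "F c = oc (SOME R. R \<in> Q \<and> cseq.rep_equiv A `` {R} = c)" for c
    have F: "F (cseq.rep_equiv A `` {R}) = oc R" if R: "R \<in> Q" for R
    proof -
      define R' where "R' = (SOME R'. R' \<in> Q \<and> cseq.rep_equiv A `` {R'} = cseq.rep_equiv A `` {R})"
      have "R' \<in> Q" "cseq.rep_equiv A `` {R'} = cseq.rep_equiv A `` {R}"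
        using someI[of "\<lambda>R'. R' \<in> Q \<and> cseq.rep_equiv A `` {R'} = cseq.rep_equiv A `` {R}" R] R
        unfolding R'_def by auto
      moreover then have "(R', R) \<in> cseq.rep_equiv A"
        using eq_equiv_class[OF _ equiv] R unfolding Q_def by blast
      ultimately show ?thesis using eqv R unfolding F_def R'_def by blast
    qed
    have "bij_betw F (Q // cseq.rep_equiv A) (oc ` Q)"
    proof (rule bij_betw_imageI)
      show "inj_on F (Q // cseq.rep_equiv A)"
      proof (rule inj_onI)
        fix c c' assume "c \<in> Q // cseq.rep_equiv A" "c' \<in> Q // cseq.rep_equiv A" and e: "F c = F c'"
        then obtain R R' where R: "R \<in> Q" "R' \<in> Q" "c = cseq.rep_equiv A `` {R}" "c' = cseq.rep_equiv A `` {R'}"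
          by (auto simp: quotient_def)
        then have "(R, R') \<in> cseq.rep_equiv A" using e F eqv by simp
        then show "c = c'" using R equiv_class_eq[OF equiv] by simp
      qed
      show "F ` (Q // cseq.rep_equiv A) = oc ` Q"
        unfolding quotient_def using F by (simp add: UNION_singleton_eq_range image_image)
    qed
    then show ?thesis by (rule bij_betw_same_card)
  qed
  moreover have "\<Union>(oc ` Q) = I" using ocI cover by blast
  \<comment> \<open>The distinct sets \<open>oc R\<close> partition the pairs with orbit size
    \<open>d\<close> into blocks of equal size; disjointness is \<open>meet\<close>.\<close>
  moreover have "d\<^sup>2 * card (oc ` Q) = card (\<Union>(oc ` Q))"
  proof (rule card_partition)
    show "finite (oc ` Q)" using finI ocI by (meson Pow_iff finite_Pow_iff finite_subset image_subsetI)
    show "finite (\<Union>(oc ` Q))" using \<open>\<Union>(oc ` Q) = I\<close> finI by simp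
    show "card c = d\<^sup>2" if "c \<in> oc ` Q" for c using oc_card that by auto
    show "c1 \<inter> c2 = {}" if "c1 \<in> oc ` Q" "c2 \<in> oc ` Q" "c1 \<noteq> c2" for c1 c2
      using that meet by blast
  qed
  ultimately show ?thesis
    unfolding cseq.num_irreps_def Q_def[symmetric] I_def by (simp add: card_cartesian_product mult.commute)
qed

section \<open>The skew left braces of order \<open>pq\<close>\<close>

definition torus :: "nat \<Rightarrow> (nat \<times> nat) monoid" where
  "torus n = \<lparr>carrier = {..<n} \<times> {..<n}, monoid.mult = dir_op n n, one = (0, 0)\<rparr>"

text \<open>The exponential of the standard pairing of \<open>c\<close> and \<open>x\<close>. Its
  symmetry makes the character group another copy of the torus.\<close>

definition chr :: "nat \<Rightarrow> nat \<times> nat \<Rightarrow> nat \<times> nat \<Rightarrow> complex" where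
  "chr n c x = cis (2 * pi * real (fst c * fst x + snd c * snd x) / real n)"

lemma torus_simps [simp]:
  "carrier (torus n) = {..<n} \<times> {..<n}"
  "x \<otimes>\<^bsub>torus n\<^esub> y = ((fst x + fst y) mod n, (snd x + snd y) mod n)"
  "\<one>\<^bsub>torus n\<^esub> = (0, 0)"
  by (simp_all add: torus_def dir_op_def split_beta)

lemma order_torus: "order (torus n) = n\<^sup>2"
  by (simp add: order_def card_cartesian_product power2_eq_square)

lemma cong_mult_mod: "[c * (x mod n) = c * x] (mod n)" for c x n :: nat
  by (simp add: cong_def mod_mult_right_eq)

lemma cis_root_cong:
  assumes "[k = l] (mod n)" "0 < n"
  shows "cis (2 * pi * real k / real n) = cis (2 * pi * real l / real n)"
proof -
  have "cis (2 * pi * real m / real n) = cis (2 * pi * real (m mod n) / real n)" for m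
  proof -
    have m: "real m = real n * real (m div n) + real (m mod n)"
      by (metis mult_div_mod_eq of_nat_add of_nat_mult)
    have "2 * pi * real m / real n = 2 * pi * real (m div n) + 2 * pi * real (m mod n) / real n"
      unfolding m using assms(2) by (simp add: field_simps)
    then have "cis (2 * pi * real m / real n)
        = cis (2 * pi * real (m div n)) * cis (2 * pi * real (m mod n) / real n)"
      by (simp only: cis_mult)
    also have "cis (2 * pi * real (m div n)) = 1"
      by (rule cis_multiple_2pi) simp
    finally show ?thesis by simp
  qed
  then show ?thesis using assms(1) unfolding cong_def by metis
qed

lemma chr_cong:
  assumes "0 < n" "[fst c * fst x + snd c * snd x = fst c' * fst x' + snd c' * snd x'] (mod n)"
  shows "chr n c x = chr n c' x'"
  unfolding chr_def using assms by (intro cis_root_cong)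

lemma cis_root_inj:
  assumes "k < n" "l < n" "cis (2 * pi * real k / real n) = cis (2 * pi * real l / real n)"
  shows "k = l"
  using bij_betw_roots_unity[of n] assms by (auto simp: bij_betw_def inj_on_def)

lemma sum_powers_root:
  fixes w :: complex
  assumes "w ^ n = 1"
  shows "(\<Sum>k<n. w ^ k) = (if w = 1 then of_nat n else 0)"
  using assms by (simp add: sum_gp_strict)

text \<open>The sum is a product of two geometric sums with n-th roots of unity as bases. Such a sum
  vanishes unless its base is 1, that is, unless the corresponding coordinates of \<open>c\<close>
  and \<open>c'\<close> agree.\<close>

lemma chr_rows:
  assumes n: "0 < n" and c: "c \<in> {..<n} \<times> {..<n}" and c': "c' \<in> {..<n} \<times> {..<n}"
  shows "(\<Sum>x\<in>{..<n} \<times> {..<n}. cnj (chr n c' x) * chr n c x) = (if c = c' then of_nat (n\<^sup>2) else 0)"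
proof -
  define r where "r k = cis (2 * pi * real k / real n)" for k
  have rn: "r k ^ n = 1" for k
  proof -
    have "r k ^ n = cis (2 * pi * real (k * n) / real n)" by (simp add: r_def DeMoivre mult_ac)
    also have "\<dots> = cis (2 * pi * real 0 / real n)" using n by (intro cis_root_cong) (simp_all add: cong_0_iff)
    finally show ?thesis by simp
  qed
  have chr: "chr n d x = r (fst d) ^ fst x * r (snd d) ^ snd x" for d x
    by (simp add: chr_def r_def DeMoivre cis_mult add_divide_distrib distrib_left mult_ac)
  define w where "w k l = cnj (r l) * r k" for k l
  have w1: "w k l = 1 \<longleftrightarrow> k = l" if "k < n" "l < n" for k l
  proof -
    have "cnj (r l) * r l = 1" by (simp add: r_def cis_cnj cis_mult)
    then have "w k l = 1 \<longleftrightarrow> r k = r l"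
      unfolding w_def by (metis mult.commute mult.left_commute mult.right_neutral)
    then show ?thesis using cis_root_inj that unfolding r_def by blast
  qed
  have wn: "w k l ^ n = 1" for k l
    using rn by (simp add: w_def power_mult_distrib flip: complex_cnj_power)
  have "(\<Sum>x\<in>{..<n} \<times> {..<n}. cnj (chr n c' x) * chr n c x)
      = (\<Sum>x\<in>{..<n} \<times> {..<n}. w (fst c) (fst c') ^ fst x * w (snd c) (snd c') ^ snd x)"
    by (intro sum.cong refl) (simp add: chr w_def power_mult_distrib mult_ac)
  also have "\<dots> = (\<Sum>k<n. w (fst c) (fst c') ^ k) * (\<Sum>k<n. w (snd c) (snd c') ^ k)"
    by (simp add: sum_product sum.cartesian_product split_beta)
  also have "\<dots> = (if c = c' then of_nat (n\<^sup>2) else 0)"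
    using c c' w1[of "fst c" "fst c'"] w1[of "snd c" "snd c'"]
    by (auto simp: sum_powers_root wn prod_eq_iff power2_eq_square)
  finally show ?thesis .
qed

lemma dual_pair_torus:
  assumes n: "0 < n"
  shows "dual_pair (torus n) ({..<n} \<times> {..<n}) (chr n)"
proof -
  have "comm_group (torus n)"
  proof (rule comm_groupI)
    fix x assume "x \<in> carrier (torus n)"
    then show "\<exists>y\<in>carrier (torus n). y \<otimes>\<^bsub>torus n\<^esub> x = \<one>\<^bsub>torus n\<^esub>"
      using n by (intro bexI[of _ "((n - fst x) mod n, (n - snd x) mod n)"]) (auto simp: mod_add_left_eq)
  qed (use n in \<open>auto simp: mod_add_left_eq mod_add_right_eq add_ac\<close>)
  then interpret comm_group "torus n" .
  show ?thesis
  proof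
    fix c x y
    have "[fst c * ((fst x + fst y) mod n) + snd c * ((snd x + snd y) mod n)
        = (fst c * fst x + snd c * snd x) + (fst c * fst y + snd c * snd y)] (mod n)"
      using cong_add[OF cong_mult_mod cong_mult_mod, of "fst c" "fst x + fst y" n "snd c" "snd x + snd y"]
      by (simp add: algebra_simps)
    then have "chr n c (x \<otimes>\<^bsub>torus n\<^esub> y) =
        cis (2 * pi * real ((fst c * fst x + snd c * snd x) + (fst c * fst y + snd c * snd y)) / real n)"
      unfolding chr_def using n by (intro cis_root_cong) simp_all
    also have "\<dots> = chr n c x * chr n c y"
      by (simp add: chr_def cis_mult add_divide_distrib distrib_left)
    finally show "chr n c (x \<otimes>\<^bsub>torus n\<^esub> y) = chr n c x * chr n c y" .
  next
    fix c x :: "nat \<times> nat"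
    show "cnj (chr n c x) * chr n c x = 1" by (simp add: chr_def cis_cnj cis_mult)
  next
    fix c c' :: "nat \<times> nat" assume "c \<in> {..<n} \<times> {..<n}" "c' \<in> {..<n} \<times> {..<n}"
    then show "(\<Sum>x\<in>carrier (torus n). cnj (chr n c' x) * chr n c x) =
        (if c = c' then of_nat (order (torus n)) else 0)"
      using chr_rows[OF n] by (simp add: order_torus)
  next
    fix x assume "x \<in> carrier (torus n)"
    \<comment> \<open>As \<open>chr\<close> is symmetric in its two arguments, the column relation
      is the row relation between \<open>x\<close> and the trivial character (0, 0).\<close>
    then have "(\<Sum>c\<in>{..<n} \<times> {..<n}. cnj (chr n x c) * chr n (0, 0) c) =
        (if (0, 0) = x then of_nat (n\<^sup>2) else 0)"
      using n by (intro chr_rows) auto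
    moreover have "chr n (0, 0) c = 1" "chr n x c = chr n c x" for c
      by (simp_all add: chr_def mult.commute)
    ultimately show "(\<Sum>c\<in>{..<n} \<times> {..<n}. cnj (chr n c x)) =
        (if x = \<one>\<^bsub>torus n\<^esub> then of_nat (order (torus n)) else 0)"
      by (auto simp: order_torus)
  qed auto
qed

text \<open>In coordinates of \<open>H\<close>, the two characters by which \<open>H\<close> acts on \<open>N\<close> have exponents \<open>(a, d)\<close> and \<open>(0, e)\<close>.
  The same formula gives the dual action on the characters of \<open>N\<close>.\<close>

definition torus_act :: "nat \<Rightarrow> nat \<Rightarrow> nat \<Rightarrow> nat \<Rightarrow> nat \<Rightarrow> nat \<times> nat \<Rightarrow> nat \<times> nat \<Rightarrow> nat \<times> nat" where
  "torus_act p g a d e h x =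
     ((g ^ (a * fst h + d * snd h) * fst x) mod p, (g ^ (e * snd h) * snd x) mod p)"

text \<open>The order of \<open>g\<close> may be a proper divisor of \<open>q\<close>; this admits
  the base 1, with which brace \<open>B\<close> is treated.\<close>

lemma power_cong_exponent:
  fixes g p q :: nat
  assumes "[g ^ q = 1] (mod p)" "[k = l] (mod q)"
  shows "[g ^ k = g ^ l] (mod p)"
proof -
  have "[g ^ m = g ^ (m mod q)] (mod p)" for m
  proof -
    have "g ^ m = (g ^ q) ^ (m div q) * g ^ (m mod q)"
      by (metis mult_div_mod_eq power_add power_mult)
    moreover have "[(g ^ q) ^ (m div q) * g ^ (m mod q) = 1 ^ (m div q) * g ^ (m mod q)] (mod p)"
      using assms(1) by (intro cong_mult cong_pow cong_refl)
    ultimately show ?thesis by simp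
  qed
  then show ?thesis using assms(2) unfolding cong_def by metis
qed

text \<open>A diagonal map is its own transpose for the pairing in \<open>chr\<close>, so one
  function serves as the action on \<open>N\<close> and as the dual action.\<close>

lemma dual_action_torus:
  assumes pq: "0 < p" "0 < q" and g: "[g ^ q = 1] (mod p)"
  shows "dual_action (torus p) ({..<p} \<times> {..<p}) (chr p) (torus q) ({..<q} \<times> {..<q}) (chr q)
    (torus_act p g a d e) (torus_act p g a d e)"
proof -
  interpret N: dual_pair "torus p" "{..<p} \<times> {..<p}" "chr p" by (rule dual_pair_torus[OF pq(1)])
  interpret H: dual_pair "torus q" "{..<q} \<times> {..<q}" "chr q" by (rule dual_pair_torus[OF pq(2)])
  have mult: "torus_act p g a d e (h \<otimes>\<^bsub>torus q\<^esub> h') x = torus_act p g a d e h (torus_act p g a d e h' x)" for h h' x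
  proof -
    have "[a * ((fst h + fst h') mod q) + d * ((snd h + snd h') mod q) =
        (a * fst h + d * snd h) + (a * fst h' + d * snd h')] (mod q)"
      "[e * ((snd h + snd h') mod q) = e * snd h + e * snd h'] (mod q)"
      using cong_add[OF cong_mult_mod cong_mult_mod, of a "fst h + fst h'" q d "snd h + snd h'"]
        cong_mult_mod[of e "snd h + snd h'" q]
      by (simp_all add: algebra_simps)
    from this[THEN power_cong_exponent[OF g]]
    have "[g ^ (a * ((fst h + fst h') mod q) + d * ((snd h + snd h') mod q)) * fst x =
        g ^ (a * fst h + d * snd h) * (g ^ (a * fst h' + d * snd h') * fst x)] (mod p)"
      "[g ^ (e * ((snd h + snd h') mod q)) * snd x =
        g ^ (e * snd h) * (g ^ (e * snd h') * snd x)] (mod p)"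
      by (auto simp: power_add mult.assoc[symmetric] intro!: cong_mult cong_refl)
    then show ?thesis by (simp add: torus_act_def cong_def mod_mult_right_eq)
  qed
  have one: "torus_act p g a d e \<one>\<^bsub>torus q\<^esub> x = x" if "x \<in> {..<p} \<times> {..<p}" for x
    using that by (auto simp: torus_act_def)
  have closed: "torus_act p g a d e h x \<in> {..<p} \<times> {..<p}" for h x
    using pq by (simp add: torus_act_def)
  show ?thesis
  proof
    fix h n n'
    show "torus_act p g a d e h (n \<otimes>\<^bsub>torus p\<^esub> n') =
        torus_act p g a d e h n \<otimes>\<^bsub>torus p\<^esub> torus_act p g a d e h n'"
      by (simp add: torus_act_def mod_simps distrib_left)
  next
    fix h c n
    have "[fst (torus_act p g a d e h c) * fst n + snd (torus_act p g a d e h c) * snd n =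
       fst c * fst (torus_act p g a d e h n) + snd c * snd (torus_act p g a d e h n)] (mod p)"
      using cong_add[OF cong_mult_mod cong_mult_mod, of "fst n" _ p "snd n"]
        cong_add[OF cong_mult_mod cong_mult_mod, of "fst c" _ p "snd c"]
      unfolding torus_act_def by (simp add: cong_def mult_ac)
    then show "chr p (torus_act p g a d e h c) n = chr p c (torus_act p g a d e h n)"
      by (rule chr_cong[OF pq(1)])
  qed (use mult one closed in \<open>simp_all del: torus_simps(2,3)\<close>)
qed

text \<open>The concrete embeddings are transported along the isomorphism. Injectivity of the
  product map suffices, since both sides have p^2 q^2 elements. In the last premise \<open>l\<close>
  stands for the value of \<open>lambda_op\<close>; characterizing it by
  \<open>ad l x = ci x y\<close> avoids additive inverses.\<close>

lemma brace_split_of_iso: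
  assumes A: "skew_left_brace A" and iso: "brace_iso A (pq_brace p q ad ci)"
    and act: "dual_action (torus p) ({..<p} \<times> {..<p}) (chr p) (torus q) ({..<q} \<times> {..<q}) (chr q) a a"
    and IJ: "\<And>x. x \<in> {..<p} \<times> {..<q} \<Longrightarrow> I x \<in> carrier (semidirect (torus p) (torus q) a)"
      "\<And>x. x \<in> {..<p} \<times> {..<q} \<Longrightarrow> J x \<in> carrier (semidirect (torus p) (torus q) a)"
    and I: "\<And>x y. x \<in> {..<p} \<times> {..<q} \<Longrightarrow> y \<in> {..<p} \<times> {..<q} \<Longrightarrow>
      I (ad x y) = I x \<otimes>\<^bsub>semidirect (torus p) (torus q) a\<^esub> I y"
    and J: "\<And>x y. x \<in> {..<p} \<times> {..<q} \<Longrightarrow> y \<in> {..<p} \<times> {..<q} \<Longrightarrow>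
      J (ci x y) = J x \<otimes>\<^bsub>semidirect (torus p) (torus q) a\<^esub> J y"
    and inj: "\<And>x y x' y'. x \<in> {..<p} \<times> {..<q} \<Longrightarrow> y \<in> {..<p} \<times> {..<q} \<Longrightarrow>
      x' \<in> {..<p} \<times> {..<q} \<Longrightarrow> y' \<in> {..<p} \<times> {..<q} \<Longrightarrow>
      I x \<otimes>\<^bsub>semidirect (torus p) (torus q) a\<^esub> J y = I x' \<otimes>\<^bsub>semidirect (torus p) (torus q) a\<^esub> J y' \<Longrightarrow>
      x = x' \<and> y = y'"
    and JI: "\<And>x y l. x \<in> {..<p} \<times> {..<q} \<Longrightarrow> y \<in> {..<p} \<times> {..<q} \<Longrightarrow> l \<in> {..<p} \<times> {..<q} \<Longrightarrow>
      ad l x = ci x y \<Longrightarrow>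
      J x \<otimes>\<^bsub>semidirect (torus p) (torus q) a\<^esub> I y = I l \<otimes>\<^bsub>semidirect (torus p) (torus q) a\<^esub> J x"
  shows "\<exists>i j. brace_split (torus p) ({..<p} \<times> {..<p}) (chr p) (torus q) ({..<q} \<times> {..<q}) (chr q) a a A i j"
proof -
  interpret dual_action "torus p" "{..<p} \<times> {..<p}" "chr p" "torus q" "{..<q} \<times> {..<q}" "chr q" a a
    by (rule act)
  interpret \<Gamma>: monoid \<Gamma> by (rule monoid_\<Gamma>)
  let ?X = "{..<p} \<times> {..<q}"
  obtain f where "f \<in> iso A (pq_brace p q ad ci)" "f \<in> iso (circ_group A) (circ_group (pq_brace p q ad ci))"
    using iso by (auto simp: brace_iso_def)
  then have bij: "bij_betw f (carrier A) ?X"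
    and f: "\<And>x y. x \<in> carrier A \<Longrightarrow> y \<in> carrier A \<Longrightarrow> f (x \<otimes>\<^bsub>A\<^esub> y) = ad (f x) (f y)"
      "\<And>x y. x \<in> carrier A \<Longrightarrow> y \<in> carrier A \<Longrightarrow> f (x \<star>\<^bsub>A\<^esub> y) = ci (f x) (f y)"
    by (auto simp: iso_def pq_brace_def dest: hom_mult)
  have fX: "f x \<in> ?X" if "x \<in> carrier A" for x using bij that by (auto simp: bij_betw_def)
  note D = skew_left_braceD[OF A]
  define F where "F = (\<lambda>(x, y). I (f x) \<otimes>\<^bsub>\<Gamma>\<^esub> J (f y))"
  have "inj_on F (carrier A \<times> carrier A)"
  proof (rule inj_onI)
    fix z z' assume z: "z \<in> carrier A \<times> carrier A" "z' \<in> carrier A \<times> carrier A" and e: "F z = F z'"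
    have "f (fst z) = f (fst z') \<and> f (snd z) = f (snd z')"
      using z e by (intro inj fX) (auto simp: F_def split_beta)
    then show "z = z'" using z bij by (auto simp: bij_betw_def inj_on_def prod_eq_iff)
  qed
  moreover have "F ` (carrier A \<times> carrier A) \<subseteq> carrier \<Gamma>"
    unfolding F_def split_beta by (intro image_subsetI \<Gamma>.m_closed IJ fX) auto
  moreover have "finite (carrier \<Gamma>)" by simp
  moreover have "card (carrier A \<times> carrier A) = card (carrier \<Gamma>)"
    using bij_betw_same_card[OF bij] by (simp add: card_cartesian_product)
  ultimately have "bij_betw F (carrier A \<times> carrier A) (carrier \<Gamma>)"
    by (simp add: bij_betw_def card_image card_subset_eq)
  then have "brace_split (torus p) ({..<p} \<times> {..<p}) (chr p) (torus q) ({..<q} \<times> {..<q}) (chr q) a a A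
      (\<lambda>x. I (f x)) (\<lambda>x. J (f x))"
  proof (unfold_locales, goal_cases)
    case 1 show ?case by (rule A)
  next
    case 2
    show ?case using IJ(1) fX f I by (intro homI) (auto simp del: semidirect_simps)
  next
    case 3
    show ?case using IJ(2) fX f J by (intro homI) (auto simp del: semidirect_simps)
  next
    case 4 then show ?case by (simp add: F_def)
  next
    case (5 x y)
    then have "ad (f (lambda_op A x y)) (f x) = ci (f x) (f y)"
      using D(4,5)[of x y] f by metis
    then show ?case using JI fX 5 D(4) by blast
  qed
  then show ?thesis by blast
qed

definition orb :: "nat \<Rightarrow> nat \<Rightarrow> nat \<Rightarrow> nat \<Rightarrow> nat \<Rightarrow> nat \<Rightarrow> nat \<times> nat \<Rightarrow> (nat \<times> nat) set" where
  "orb p q g a d e c = (\<lambda>h. torus_act p g a d e h c) ` ({..<q} \<times> {..<q})"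

lemma num_irreps_of_brace_split:
  assumes "0 < p" "0 < q" "[g ^ q = 1] (mod p)"
    and "\<exists>i j. brace_split (torus p) ({..<p} \<times> {..<p}) (chr p) (torus q) ({..<q} \<times> {..<q}) (chr q)
      (torus_act p g a d e) (torus_act p g a d e) A i j"
  shows "cseq.num_irreps A k * k\<^sup>2 = card {c \<in> {..<p} \<times> {..<p}. card (orb p q g a d e c) = k} * q\<^sup>2"
proof -
  obtain i j where "brace_split (torus p) ({..<p} \<times> {..<p}) (chr p) (torus q) ({..<q} \<times> {..<q}) (chr q)
      (torus_act p g a d e) (torus_act p g a d e) A i j" using assms(4) by blast
  then interpret brace_split "torus p" "{..<p} \<times> {..<p}" "chr p" "torus q" "{..<q} \<times> {..<q}" "chr q"
      "torus_act p g a d e" "torus_act p g a d e" A i j .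
  show ?thesis
    using num_irreps_eq[of k] unfolding orbit_def orb_def
    by (simp add: card_cartesian_product power2_eq_square)
qed

lemma coprime_power_one:
  fixes g p q k :: nat
  assumes "0 < q" "[g ^ q = 1] (mod p)"
  shows "coprime (g ^ k) p"
proof -
  have "coprime (g ^ q) p"
    using assms(2) by (metis cong_imp_coprime cong_sym coprime_1_left)
  then have "coprime g p" using assms(1) by simp
  then show ?thesis by simp
qed

text \<open>Here \<open>(n, m)\<close> is the circle product of \<open>(g\<^sup>-\<^sup>a\<^sup>m n, 0)\<close> and \<open>(0, m)\<close>, which gives the map \<open>J\<close>
  in the proof.\<close>

lemma num_irreps_linear_circ:
  assumes p: "0 < p" and q: "0 < q" and g: "[g ^ q = 1] (mod p)" and A: "skew_left_brace A"
    and iso: "brace_iso A (pq_brace p q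
      (\<lambda>(n, m) (s, t). ((n + g ^ (a * m) * s) mod p, (m + t) mod q))
      (\<lambda>(n, m) (s, t). ((g ^ (a * t) * n + g ^ (d * m) * s) mod p, (m + t) mod q)))"
    and e: "e = d + a * (q - 1)"
  shows "cseq.num_irreps A k * k\<^sup>2 = card {c \<in> {..<p} \<times> {..<p}. card (orb p q g a d e c) = k} * q\<^sup>2"
proof (rule num_irreps_of_brace_split[OF p q g])
  \<comment> \<open>\<open>r m\<close> is the inverse of \<open>g ^ (a * m)\<close> modulo
    \<open>p\<close>; the factor \<open>q - 1\<close> plays the part of -1 in exponents modulo
    \<open>q\<close>.\<close>
  define r where "r m = g ^ (a * (q - 1) * m)" for m
  have r_add: "[r ((m + t) mod q) = r m * r t] (mod p)" for m t
  proof -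
    have "[a * (q - 1) * ((m + t) mod q) = a * (q - 1) * m + a * (q - 1) * t] (mod q)"
      using cong_mult_mod[of "a * (q - 1)" "m + t" q] by (simp add: distrib_left)
    from power_cong_exponent[OF g this] show ?thesis by (simp add: r_def power_add)
  qed
  have r_inv: "[r t * g ^ (a * t) = 1] (mod p)" for t
  proof -
    have "a * (q - 1) * t + a * t = a * t * (q - 1 + 1)" by (simp add: algebra_simps)
    then have "[a * (q - 1) * t + a * t = 0] (mod q)" using q by (simp add: cong_0_iff)
    then have "[g ^ (a * (q - 1) * t + a * t) = g ^ 0] (mod p)" by (rule power_cong_exponent[OF g])
    then show ?thesis by (simp add: r_def power_add)
  qed
  have ge: "g ^ (e * m) = g ^ (d * m) * r m" for m
    by (simp add: e r_def power_add[symmetric] algebra_simps)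
  have cancel: "s = s'" if "(r t * s) mod p = (r t * s') mod p" "s < p" "s' < p" for t s s'
  proof -
    have "coprime (r t) p" unfolding r_def by (rule coprime_power_one[OF q g])
    moreover have "[r t * s = r t * s'] (mod p)" using that by (simp add: cong_def)
    ultimately have "[s = s'] (mod p)" by (simp only: cong_mult_lcancel_nat)
    then show ?thesis using that cong_less_modulus_unique_nat by blast
  qed
  show "\<exists>i j. brace_split (torus p) ({..<p} \<times> {..<p}) (chr p) (torus q) ({..<q} \<times> {..<q}) (chr q)
      (torus_act p g a d e) (torus_act p g a d e) A i j"
  proof (rule brace_split_of_iso[OF A iso dual_action_torus[OF p q g],
        where I = "\<lambda>(n, m). ((n, 0), (m, 0))" and J = "\<lambda>(n, m). ((0, (r m * n) mod p), (0, m))"], goal_cases)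
    case (3 x y)
    then show ?case using p by (auto simp: torus_act_def mod_simps)
  next
    case (4 x y)
    obtain n m s t where xy: "x = (n, m)" "y = (s, t)" by (metis surj_pair)
    have "[r ((m + t) mod q) * ((g ^ (a * t) * n + g ^ (d * m) * s) mod p)
        = (r m * r t) * (g ^ (a * t) * n + g ^ (d * m) * s)] (mod p)"
      using cong_mult[OF r_add] by (simp add: cong_def mod_mult_right_eq)
    \<comment> \<open>Here \<open>r t\<close> cancels \<open>g ^ (a * t)\<close>, while
      \<open>r m\<close> and \<open>g ^ (d * m)\<close> combine into \<open>g ^ (e * m)\<close>.
      This is the origin of the second weight, d - a modulo q.\<close>
    also have "(r m * r t) * (g ^ (a * t) * n + g ^ (d * m) * s)
        = r m * n * (r t * g ^ (a * t)) + g ^ (e * m) * (r t * s)"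
      by (simp add: ge algebra_simps)
    also have "[\<dots> = r m * n * 1 + g ^ (e * m) * (r t * s)] (mod p)"
      by (intro cong_add cong_mult cong_refl r_inv)
    finally show ?case
      using p by (simp add: xy torus_act_def cong_def mod_simps)
  next
    case (5 x y x' y')
    obtain n m s t n' m' s' t' where xy: "x = (n, m)" "y = (s, t)" "x' = (n', m')" "y' = (s', t')"
      by (metis surj_pair)
    have "n = n'" "m = m'" "t = t'" "(r t * s) mod p = (r t' * s') mod p"
      using 5 by (auto simp: xy torus_act_def)
    then show ?case using cancel[of t s s'] 5 by (simp add: xy)
  next
    case (6 x y l)
    obtain n m s t l1 l2 where xy: "x = (n, m)" "y = (s, t)" "l = (l1, l2)" by (metis surj_pair)
    have *: "(l1 + g ^ (a * l2) * n) mod p = (g ^ (a * t) * n + g ^ (d * m) * s) mod p"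
      "(l2 + m) mod q = (m + t) mod q" using 6(4) by (auto simp: xy)
    have "[l2 + m = t + m] (mod q)" using *(2) by (simp add: cong_def add.commute)
    then have "[l2 = t] (mod q)" by (simp only: cong_add_rcancel_nat)
    then have l2: "l2 = t" using 6 cong_less_modulus_unique_nat by (auto simp: xy)
    have "[l1 + g ^ (a * t) * n = g ^ (d * m) * s + g ^ (a * t) * n] (mod p)"
      using *(1) l2 by (simp add: cong_def add.commute)
    then have "[l1 = g ^ (d * m) * s] (mod p)" by (simp only: cong_add_rcancel_nat)
    then have "l1 = (g ^ (d * m) * s) mod p" using 6 by (simp add: cong_def xy)
    then show ?case using 6 p q by (auto simp: xy l2 torus_act_def mod_simps add.commute)
  qed (use p q in auto)
qed

text \<open>Here \<open>\<lambda>\<^sup>o\<^sup>p\<close> of \<open>(n, 0)\<close> is an additive conjugation, so \<open>\<beta>(n, 0)\<^sup>-\<^sup>1 \<rho>(n, 0)\<close> commutes with every \<open>\<beta>(b)\<close>. It is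
  taken as the second coordinate of \<open>N\<close>, which diagonalizes the action of \<open>H\<close>.\<close>

lemma num_irreps_semidirect_circ:
  assumes p: "0 < p" and q: "0 < q" and g: "[g ^ q = 1] (mod p)" and A: "skew_left_brace A"
    and iso: "brace_iso A (pq_brace p q
      (\<lambda>(n, m) (s, t). ((n + g ^ m * s) mod p, (m + t) mod q))
      (\<lambda>(n, m) (s, t). ((n + g ^ (d * m) * s) mod p, (m + t) mod q)))"
  shows "cseq.num_irreps A k * k\<^sup>2 = card {c \<in> {..<p} \<times> {..<p}. card (orb p q g 1 d d c) = k} * q\<^sup>2"
proof (rule num_irreps_of_brace_split[OF p q g])
  show "\<exists>i j. brace_split (torus p) ({..<p} \<times> {..<p}) (chr p) (torus q) ({..<q} \<times> {..<q}) (chr q)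
      (torus_act p g 1 d d) (torus_act p g 1 d d) A i j"
  proof (rule brace_split_of_iso[OF A iso dual_action_torus[OF p q g],
        where I = "\<lambda>(n, m). ((n, 0), (m, 0))" and J = "\<lambda>(n, m). ((n, n), (0, m))"], goal_cases)
    case (3 x y)
    then show ?case using p by (auto simp: torus_act_def mod_simps)
  next
    \<comment> \<open>The diagonal \<open>J\<close> is multiplicative because the circle factor of
      \<open>H\<close> acts on both coordinates of \<open>N\<close> with the same exponent
      \<open>d\<close>.\<close>
    case (4 x y)
    then show ?case using p by (auto simp: torus_act_def mod_simps)
  next
    case (5 x y x' y')
    obtain n m s t n' m' s' t' where xy: "x = (n, m)" "y = (s, t)" "x' = (n', m')" "y' = (s', t')"
      by (metis surj_pair)
    have *: "m = m'" "s = s'" "t = t'" "(n + g ^ m * s) mod p = (n' + g ^ m' * s') mod p"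
      using 5 by (auto simp: xy torus_act_def mod_simps)
    then have "[n + g ^ m * s = n' + g ^ m * s] (mod p)" by (simp add: cong_def)
    then have "[n = n'] (mod p)" by (simp only: cong_add_rcancel_nat)
    then have "n = n'" using 5 cong_less_modulus_unique_nat by (auto simp: xy)
    then show ?case using * by (simp add: xy)
  next
    case (6 x y l)
    obtain n m s t l1 l2 where xy: "x = (n, m)" "y = (s, t)" "l = (l1, l2)" by (metis surj_pair)
    have *: "(l1 + g ^ l2 * n) mod p = (n + g ^ (d * m) * s) mod p"
      "(l2 + m) mod q = (m + t) mod q" using 6(4) by (auto simp: xy)
    have "[l2 + m = t + m] (mod q)" using *(2) by (simp add: cong_def add.commute)
    then have "[l2 = t] (mod q)" by (simp only: cong_add_rcancel_nat)
    then have l2: "l2 = t" using 6 cong_less_modulus_unique_nat by (auto simp: xy)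
    \<comment> \<open>The equation \<open>*(1)\<close>, which determines \<open>l\<close>, is the
      equality of the first coordinates of the two products.\<close>
    then show ?case using 6 *(1) p q by (auto simp: xy torus_act_def mod_simps add.commute)
  qed (use p q in auto)
qed

section \<open>Orbit sizes on the characters of Z_p^2\<close>

context
  fixes p q g :: nat
  assumes p: "prime p" and q: "prime q" and g: "ord p g = q"
begin

lemma power_q_cong_1: "[g ^ q = 1] (mod p)" using ord[of g p] g by simp

lemma power_mult_eq_iff:
  assumes x: "0 < x" "x < p"
  shows "(g ^ k * x) mod p = (g ^ l * x) mod p \<longleftrightarrow> [k = l] (mod q)"
proof -
  have "coprime x p" using x p by (meson coprime_commute nat_dvd_not_less prime_imp_coprime)
  then have "(g ^ k * x) mod p = (g ^ l * x) mod p \<longleftrightarrow> [g ^ k = g ^ l] (mod p)"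
    using cong_mult_rcancel_nat by (simp add: cong_def)
  also have "coprime p g"
    using coprime_power_one[OF _ power_q_cong_1, of 1] q by (simp add: prime_gt_0_nat coprime_commute)
  then have "[g ^ k = g ^ l] (mod p) \<longleftrightarrow> [k = l] (mod q)"
    using order_divides_expdiff[of p g k l] g by simp
  finally show ?thesis .
qed

text \<open>Distinct powers of \<open>g\<close> take a nonzero residue to distinct residues, so any
  exponent function that is injective modulo \<open>q\<close> yields \<open>q\<close>
  values.\<close>

lemma card_power_orbit:
  assumes x: "x < p" and f: "\<And>k l. k < q \<Longrightarrow> l < q \<Longrightarrow> [f k = f l] (mod q) \<Longrightarrow> k = l"
  shows "card ((\<lambda>k. (g ^ f k * x) mod p) ` {..<q}) = (if x = 0 then 1 else q)"
proof (cases "x = 0")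
  case True
  then show ?thesis using prime_gt_0_nat[OF q] by (simp add: image_constant_conv lessThan_empty_iff)
next
  case False
  then have "inj_on (\<lambda>k. (g ^ f k * x) mod p) {..<q}"
    using f power_mult_eq_iff x by (auto simp: inj_on_def)
  then show ?thesis using False by (simp add: card_image)
qed

lemma mod_q_inject: "k < q \<Longrightarrow> l < q \<Longrightarrow> [k = l] (mod q) \<Longrightarrow> k = l"
  by (simp add: cong_less_modulus_unique_nat)

text \<open>For fixed \<open>t\<close> the exponent m + d t still takes every value modulo q. The
  two coordinates therefore move independently and the orbit is a product, whose second factor is a
  point when \<open>e\<close> vanishes modulo q.\<close>

lemma card_orb_first_weight:
  assumes c: "c \<in> {..<p} \<times> {..<p}"
  shows "card (orb p q g 1 d e c) =
    (if fst c = 0 then 1 else q) * (if q dvd e \<or> snd c = 0 then 1 else q)"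
proof -
  have q0: "0 < q" using q by (simp add: prime_gt_0_nat)
  obtain x y where xy: "c = (x, y)" "x < p" "y < p" using c by auto
  let ?X = "(\<lambda>k. (g ^ k * x) mod p) ` {..<q}" and ?Y = "(\<lambda>k. (g ^ (e * k) * y) mod p) ` {..<q}"
  have "orb p q g 1 d e c = ?X \<times> ?Y"
  proof
    show "orb p q g 1 d e c \<subseteq> ?X \<times> ?Y"
    proof
      fix z assume "z \<in> orb p q g 1 d e c"
      then obtain m t where mt: "m < q" "t < q"
        "z = ((g ^ (m + d * t) * x) mod p, (g ^ (e * t) * y) mod p)"
        by (auto simp: orb_def torus_act_def xy)
      have "[g ^ (m + d * t) * x = g ^ ((m + d * t) mod q) * x] (mod p)"
        by (intro cong_mult cong_refl power_cong_exponent[OF power_q_cong_1]) (simp add: cong_def)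
      then have "(g ^ (m + d * t) * x) mod p \<in> ?X"
        using q0 by (intro image_eqI[of _ _ "(m + d * t) mod q"]) (auto simp: cong_def)
      then show "z \<in> ?X \<times> ?Y" using mt by auto
    qed
    show "?X \<times> ?Y \<subseteq> orb p q g 1 d e c"
    proof clarify
      fix k t assume kt: "k < q" "t < q"
      \<comment> \<open>The solution of m + d t = k modulo q, with \<open>q - 1\<close> in place of
        -1.\<close>
      let ?m = "(k + (q - 1) * (d * t)) mod q"
      have "k + (q - 1) * (d * t) + d * t = k + q * (d * t)"
        using q0 by (cases q) (auto simp: algebra_simps)
      moreover have "[?m + d * t = k + (q - 1) * (d * t) + d * t] (mod q)"
        by (intro cong_add cong_refl) (simp add: cong_def)
      ultimately have "[?m + d * t = k + q * (d * t)] (mod q)" by (simp only:)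
      then have "[?m + d * t = k] (mod q)" by (simp add: cong_def)
      then have "[g ^ (?m + d * t) * x = g ^ k * x] (mod p)"
        by (intro cong_mult cong_refl power_cong_exponent[OF power_q_cong_1])
      then have "((g ^ k * x) mod p, (g ^ (e * t) * y) mod p) = torus_act p g 1 d e (?m, t) c"
        by (simp add: torus_act_def xy cong_def)
      moreover have "(?m, t) \<in> {..<q} \<times> {..<q}" using q0 kt by simp
      ultimately show "((g ^ k * x) mod p, (g ^ (e * t) * y) mod p) \<in> orb p q g 1 d e c"
        unfolding orb_def by (rule image_eqI)
    qed
  qed
  moreover have "card ?X = (if x = 0 then 1 else q)"
    using card_power_orbit[of x "\<lambda>k. k"] mod_q_inject xy by simp
  moreover have "card ?Y = (if q dvd e \<or> y = 0 then 1 else q)"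
  proof (cases "q dvd e")
    case True
    have "[g ^ (e * k) * y = g ^ 0 * y] (mod p)" for k
      using True by (intro cong_mult cong_refl power_cong_exponent[OF power_q_cong_1]) (simp add: cong_0_iff)
    then have "?Y = (\<lambda>k. y) ` {..<q}"
      using xy by (intro image_cong refl) (simp add: cong_def)
    then show ?thesis using True q0 by (simp add: image_constant_conv lessThan_empty_iff)
  next
    case False
    then have "coprime e q" using prime_imp_coprime[OF q] coprime_commute by blast
    then have "k = l" if "k < q" "l < q" "[e * k = e * l] (mod q)" for k l
      using that mod_q_inject cong_mult_lcancel_nat by blast
    then show ?thesis using card_power_orbit[of y "\<lambda>k. e * k"] xy False by simp
  qed
  ultimately show ?thesis by (simp add: card_cartesian_product xy)
qed

text \<open>\<open>H\<close> acts through its second coordinate by scalars, and a nontrivial scalar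
  fixes only the origin.\<close>

lemma card_orb_equal_weights:
  assumes c: "c \<in> {..<p} \<times> {..<p}"
  shows "card (orb p q g 0 1 1 c) = (if c = (0, 0) then 1 else q)"
proof -
  have q0: "0 < q" using q by (simp add: prime_gt_0_nat)
  let ?f = "\<lambda>k. ((g ^ k * fst c) mod p, (g ^ k * snd c) mod p)"
  have "orb p q g 0 1 1 c = ?f ` {..<q}"
    unfolding orb_def torus_act_def using q0 by force
  moreover have "inj_on ?f {..<q}" if "c \<noteq> (0, 0)"
  proof (rule inj_onI)
    fix k l assume kl: "k \<in> {..<q}" "l \<in> {..<q}" "?f k = ?f l"
    have "0 < fst c \<or> 0 < snd c" using that by (auto simp: prod_eq_iff)
    then show "k = l"
    proof
      assume "0 < fst c"
      then show ?thesis using kl c power_mult_eq_iff[of "fst c" k l] mod_q_inject by auto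
    next
      assume "0 < snd c"
      then show ?thesis using kl c power_mult_eq_iff[of "snd c" k l] mod_q_inject by auto
    qed
  qed
  ultimately show ?thesis
    using q0 by (auto simp: card_image image_constant_conv lessThan_empty_iff)
qed

text \<open>The first coordinate alone decides: the orbit is a point if it is zero and has size q
  otherwise.\<close>

lemma card_orb_eq_dependent_weights:
  assumes "q dvd e"
  shows "card {c \<in> {..<p} \<times> {..<p}. card (orb p q g 1 d e c) = 1} = p"
    and "card {c \<in> {..<p} \<times> {..<p}. card (orb p q g 1 d e c) = q} = p\<^sup>2 - p"
proof -
  have p0: "0 < p" and q1: "1 < q" using prime_gt_0_nat[OF p] prime_gt_1_nat[OF q] .
  have "{c \<in> {..<p} \<times> {..<p}. card (orb p q g 1 d e c) = 1} = {0} \<times> {..<p}"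
    using p0 q1 assms by (auto simp: card_orb_first_weight[unfolded One_nat_def] split: if_splits)
  then show "card {c \<in> {..<p} \<times> {..<p}. card (orb p q g 1 d e c) = 1} = p"
    by (simp add: card_cartesian_product)
  have "{c \<in> {..<p} \<times> {..<p}. card (orb p q g 1 d e c) = q} = {1..<p} \<times> {..<p}"
    using p0 q1 assms by (auto simp: card_orb_first_weight[unfolded One_nat_def] split: if_splits)
  then show "card {c \<in> {..<p} \<times> {..<p}. card (orb p q g 1 d e c) = q} = p\<^sup>2 - p"
    by (simp add: card_cartesian_product power2_eq_square diff_mult_distrib)
qed

text \<open>The orbit size is q raised to the number of nonzero coordinates of
  \<open>c\<close>.\<close>

lemma card_orb_eq_independent_weights:
  assumes "\<not> q dvd e"
  shows "card {c \<in> {..<p} \<times> {..<p}. card (orb p q g 1 d e c) = 1} = 1"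
    and "card {c \<in> {..<p} \<times> {..<p}. card (orb p q g 1 d e c) = q} = 2 * (p - 1)"
    and "card {c \<in> {..<p} \<times> {..<p}. card (orb p q g 1 d e c) = q\<^sup>2} = (p - 1)\<^sup>2"
proof -
  have p0: "0 < p" and q1: "1 < q" using prime_gt_0_nat[OF p] prime_gt_1_nat[OF q] .
  have "{c \<in> {..<p} \<times> {..<p}. card (orb p q g 1 d e c) = 1} = {(0, 0)}"
    using p0 q1 assms by (auto simp: card_orb_first_weight[unfolded One_nat_def] split: if_splits)
  then show "card {c \<in> {..<p} \<times> {..<p}. card (orb p q g 1 d e c) = 1} = 1" by simp
  have "{c \<in> {..<p} \<times> {..<p}. card (orb p q g 1 d e c) = q} = {1..<p} \<times> {0} \<union> {0} \<times> {1..<p}"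
    using p0 q1 assms by (auto simp: card_orb_first_weight[unfolded One_nat_def] split: if_splits)
  moreover have "card ({1..<p} \<times> {0} \<union> {0} \<times> {1..<p}) = (p - 1) + (p - 1)"
    by (subst card_Un_disjoint) (auto simp: card_cartesian_product)
  ultimately show "card {c \<in> {..<p} \<times> {..<p}. card (orb p q g 1 d e c) = q} = 2 * (p - 1)" by simp
  have "{c \<in> {..<p} \<times> {..<p}. card (orb p q g 1 d e c) = q\<^sup>2} = {1..<p} \<times> {1..<p}"
  proof -
    \<comment> \<open>A product of two factors from {1, q} is q^2 only when both are q, because q >
      1.\<close>
    have "q \<noteq> q\<^sup>2" "1 \<noteq> q\<^sup>2" using q1 by (auto simp: power2_eq_square)
    then have "card (orb p q g 1 d e c) = q\<^sup>2 \<longleftrightarrow> fst c \<noteq> 0 \<and> snd c \<noteq> 0"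
      if "c \<in> {..<p} \<times> {..<p}" for c
      unfolding card_orb_first_weight[OF that] using assms by (cases "fst c = 0"; cases "snd c = 0") (auto simp: power2_eq_square)
    then have "{c \<in> {..<p} \<times> {..<p}. card (orb p q g 1 d e c) = q\<^sup>2} =
        {c \<in> {..<p} \<times> {..<p}. fst c \<noteq> 0 \<and> snd c \<noteq> 0}" by blast
    also have "\<dots> = {1..<p} \<times> {1..<p}" by auto
    finally show ?thesis .
  qed
  then show "card {c \<in> {..<p} \<times> {..<p}. card (orb p q g 1 d e c) = q\<^sup>2} = (p - 1)\<^sup>2"
    by (simp add: card_cartesian_product power2_eq_square)
qed

lemma card_orb_eq_equal_weights:
  shows "card {c \<in> {..<p} \<times> {..<p}. card (orb p q g 0 1 1 c) = 1} = 1"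
    and "card {c \<in> {..<p} \<times> {..<p}. card (orb p q g 0 1 1 c) = q} = p\<^sup>2 - 1"
proof -
  have p0: "0 < p" and q1: "1 < q" using prime_gt_0_nat[OF p] prime_gt_1_nat[OF q] .
  have "{c \<in> {..<p} \<times> {..<p}. card (orb p q g 0 1 1 c) = 1} = {(0, 0)}"
    using p0 q1 by (auto simp: card_orb_equal_weights[unfolded One_nat_def] split: if_splits)
  then show "card {c \<in> {..<p} \<times> {..<p}. card (orb p q g 0 1 1 c) = 1} = 1" by simp
  have "{c \<in> {..<p} \<times> {..<p}. card (orb p q g 0 1 1 c) = q} = {..<p} \<times> {..<p} - {(0, 0)}"
    using p0 q1 by (auto simp: card_orb_equal_weights[unfolded One_nat_def] split: if_splits)
  then show "card {c \<in> {..<p} \<times> {..<p}. card (orb p q g 0 1 1 c) = q} = p\<^sup>2 - 1"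
    using p0 by (simp add: card_Diff_subset card_cartesian_product power2_eq_square)
qed

end

section \<open>Groups of order \<open>pq\<close> with \<open>q\<close> not dividing \<open>p - 1\<close>\<close>

context group
begin

lemma pow_eq_iff:
  fixes k l :: nat
  assumes x: "x \<in> carrier G"
  shows "x [^] k = x [^] l \<longleftrightarrow> [k = l] (mod ord x)"
proof -
  have le: "x [^] k = x [^] l \<longleftrightarrow> [k = l] (mod ord x)" if "k \<le> l" for k l :: nat
  proof -
    have "x [^] l = x [^] k \<otimes> x [^] (l - k)" using that x by (simp add: nat_pow_mult)
    then have "x [^] k = x [^] l \<longleftrightarrow> x [^] (l - k) = \<one>" using x by (metis l_cancel_one' nat_pow_closed)
    also have "\<dots> \<longleftrightarrow> ord x dvd l - k" using x by (rule pow_eq_id)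
    also have "\<dots> \<longleftrightarrow> [l = k] (mod ord x)" using that by (simp add: cong_altdef_nat)
    finally show ?thesis by (simp add: cong_sym_eq)
  qed
  show ?thesis
    using le[of k l] le[of l k] by (cases "k \<le> l") (auto simp: cong_sym_eq)
qed

lemma ord_eq_prime:
  assumes "x \<in> carrier G" "x [^] r = \<one>" "x \<noteq> \<one>" "prime r"
  shows "ord x = r"
  using assms pow_eq_id[of x r] ord_eq_1[of x] by (auto simp: prime_nat_iff)

text \<open>Cauchy's theorem, from \<open>sylow_thm\<close> with exponent 1: every nontrivial
  element of a subgroup of order \<open>r\<close> has order \<open>r\<close>.\<close>

lemma exists_prime_ord:
  assumes "prime r" "r dvd order G" "finite (carrier G)"
  obtains x where "x \<in> carrier G" "ord x = r"
proof -
  obtain m where "order G = r ^ 1 * m" using assms(2) by (auto simp: dvd_def)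
  then obtain S where S: "subgroup S G" "card S = r ^ 1"
    using sylow_thm[OF assms(1) is_group _ assms(3)] by blast
  have "card S > 1" using S(2) prime_gt_1_nat[OF assms(1)] by simp
  then have "\<not> S \<subseteq> {\<one>}" using card_mono[of "{\<one>}" S] by auto
  then obtain x where x: "x \<in> S" "x \<noteq> \<one>" by blast
  then have xG: "x \<in> carrier G" using subgroup.mem_carrier[OF S(1)] by simp
  interpret SG: group "G\<lparr>carrier := S\<rparr>" by (rule subgroup_imp_group[OF S(1)])
  have "x [^]\<^bsub>G\<lparr>carrier := S\<rparr>\<^esub> r = \<one>\<^bsub>G\<lparr>carrier := S\<rparr>\<^esub>"
    using SG.pow_order_eq_1[of x] x S by (simp add: order_def)
  then have "x [^] r = \<one>" by (simp add: nat_pow_consistent[symmetric])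
  then show thesis using ord_eq_prime[OF xG _ x(2) assms(1)] that xG by blast
qed

text \<open>The exponent \<open>k\<close> is invertible modulo \<open>r\<close>, so \<open>z\<close>
  is a power of \<open>z [^] k\<close>.\<close>

lemma power_eq_generator:
  fixes k m :: nat
  assumes z: "z \<in> carrier G" "z [^] r = \<one>" and r: "prime r" and x: "x \<in> carrier G"
    and k: "\<not> r dvd k" "z [^] k = x [^] m"
  shows "\<exists>n. z = x [^] (n :: nat)"
proof -
  have "coprime k r" using prime_imp_coprime[OF r k(1)] by (simp add: coprime_commute)
  then obtain l where l: "[k * l = 1] (mod r)" using cong_solve_coprime_nat by auto
  have "ord z dvd r" using z pow_eq_id by blast
  then have "[k * l = 1] (mod ord z)" using l cong_dvd_modulus_nat by blast
  then have "z = z [^] (k * l)" using pow_eq_iff[OF z(1), of "k * l" 1] z by simp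
  also have "\<dots> = x [^] (m * l)" using z x k by (simp add: nat_pow_pow[symmetric])
  finally show ?thesis by blast
qed

text \<open>Otherwise the \<open>r\<^sup>2\<close> products \<open>x\<^sup>a z\<^sup>b\<close> would be distinct.\<close>

lemma unique_prime_subgroup:
  assumes r: "prime r" and fin: "finite (carrier G)" and ord: "order G < r * r"
    and x: "x \<in> carrier G" "ord x = r" and z: "z \<in> carrier G" "z [^] r = \<one>"
  shows "\<exists>n. z = x [^] (n :: nat)"
proof -
  let ?f = "\<lambda>(a, b). x [^] (a :: nat) \<otimes> z [^] (b :: nat)"
  have "\<not> inj_on ?f ({..<r} \<times> {..<r})"
  proof
    assume "inj_on ?f ({..<r} \<times> {..<r})"
    then have "card ({..<r} \<times> {..<r}) \<le> card (carrier G)"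
      using x z fin by (intro card_inj_on_le) auto
    then show False using ord by (simp add: order_def card_cartesian_product)
  qed
  then obtain a b c d where abcd: "a < r" "b < r" "c < r" "d < r" "(a, b) \<noteq> (c, d)"
    and eq: "x [^] a \<otimes> z [^] b = x [^] c \<otimes> z [^] d"
    by (auto simp: inj_on_def)
  have main: "\<exists>n. z = x [^] (n :: nat)"
    if "b < d" "d < r" "c < r" "x [^] a \<otimes> z [^] b = x [^] c \<otimes> z [^] d" for a b c d :: nat
  proof -
    have "z [^] d = z [^] (d - b) \<otimes> z [^] b" using that z by (simp add: nat_pow_mult)
    then have "x [^] a \<otimes> z [^] b = (x [^] c \<otimes> z [^] (d - b)) \<otimes> z [^] b"
      using that x z by (simp add: m_assoc)
    then have "x [^] a = x [^] c \<otimes> z [^] (d - b)" using x z by simp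
    \<comment> \<open>The exponent \<open>r - c\<close> stands for -c, which keeps all exponents
      natural.\<close>
    then have "x [^] (r - c) \<otimes> x [^] a = x [^] (r - c) \<otimes> x [^] c \<otimes> z [^] (d - b)"
      using x z by (simp add: m_assoc)
    moreover have "x [^] (r - c) \<otimes> x [^] c = \<one>"
      using that x pow_ord_eq_1[of x] by (simp add: nat_pow_mult)
    ultimately have "z [^] (d - b) = x [^] (r - c + a)"
      using x z by (simp add: nat_pow_mult)
    moreover have "\<not> r dvd d - b" using that by (auto dest: dvd_imp_le)
    ultimately show ?thesis using power_eq_generator[OF z r x(1)] by blast
  qed
  have "b \<noteq> d"
  proof
    assume bd: "b = d"
    then have "x [^] a = x [^] c" using eq x z by simp
    then have "a = c" using pow_eq_iff[OF x(1)] x(2) abcd cong_less_modulus_unique_nat by metis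
    then show False using bd abcd by simp
  qed
  then show ?thesis using main[of b d c a] main[of d b a c] eq abcd by (metis linorder_neqE_nat)
qed

text \<open>On the group generated by \<open>x\<close>, \<phi> is the \<open>k\<close>-th power map.
  So k^n = 1 modulo r, and the order of k divides both n and r - 1, which forces k = 1 modulo
  r.\<close>

lemma fixed_of_coprime_order:
  assumes r: "prime r" and x: "x \<in> carrier G" "ord x = r"
    and phi: "\<phi> \<in> hom G G" "\<phi> x = x [^] (k :: nat)" "(\<phi> ^^ n) x = x"
    and n: "0 < n" "coprime n (r - 1)"
  shows "\<phi> x = x"
proof -
  have "(\<phi> ^^ m) x = x [^] (k ^ m)" for m
  proof (induction m)
    case (Suc m)
    have "(\<phi> ^^ Suc m) x = \<phi> (x [^] (k ^ m))" by (simp add: Suc)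
    also have "\<dots> = \<phi> x [^] (k ^ m)" by (rule hom_nat_pow[OF phi(1) x(1) is_group is_group])
    finally show ?case using x phi by (simp add: nat_pow_pow)
  qed (use x in simp)
  then have "x [^] (k ^ n) = x [^] (1 :: nat)" using phi x by simp
  then have kn: "[k ^ n = 1] (mod r)" unfolding pow_eq_iff[OF x(1)] x(2) .
  have "coprime r k" using kn n(1) coprime_power_one[of n k r 1] by (simp add: coprime_commute)
  then have "Pocklington.ord r k dvd totient r" by (rule order_divides_totient)
  then have "Pocklington.ord r k dvd r - 1" using r by (simp add: totient_prime)
  moreover have "Pocklington.ord r k dvd n" using kn ord_divides by blast
  ultimately have "Pocklington.ord r k = 1" using n(2) by (metis coprime_common_divisor_nat)
  then have "[k = 1] (mod r)" using Pocklington.ord[of k r] by simp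
  then show ?thesis using pow_eq_iff[OF x(1), of k 1] x phi(2) by simp
qed

end

text \<open>As p q < p^2, the subgroup generated by \<open>x\<close> is the only one of order p, so
  conjugation by \<open>y\<close> preserves it. The q-th iterate of the conjugation fixes
  \<open>x\<close>, and q is coprime to p - 1, so \<open>x\<close> and \<open>y\<close>
  commute.\<close>

lemma (in group) pq_structure:
  assumes p: "prime p" and q: "prime q" and qp: "q < p" and np: "\<not> [p = 1] (mod q)"
    and ord_G: "order G = p * q"
  obtains x y where "x \<in> carrier G" "y \<in> carrier G" "ord x = p" "ord y = q" "x \<otimes> y = y \<otimes> x"
    "bij_betw (\<lambda>(n, m). x [^] n \<otimes> y [^] m) ({..<p} \<times> {..<q :: nat}) (carrier G)"
proof -
  have p0: "0 < p" and q0: "0 < q" using prime_gt_0_nat[OF p] prime_gt_0_nat[OF q] .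
  have fin: "finite (carrier G)" using ord_G p0 q0 order_gt_0_iff_finite by simp
  obtain x where x: "x \<in> carrier G" "ord x = p" using exists_prime_ord[OF p _ fin] ord_G by auto
  obtain y where y: "y \<in> carrier G" "ord y = q" using exists_prime_ord[OF q _ fin] ord_G by auto
  define \<phi> where "\<phi> g = y \<otimes> g \<otimes> inv y" for g
  have hom: "\<phi> \<in> hom G G"
    using y by (auto intro!: homI simp: \<phi>_def m_assoc inv_solve_left)
  have iter: "(\<phi> ^^ n) x = y [^] n \<otimes> x \<otimes> inv (y [^] n)" for n :: nat
  proof (induction n)
    case (Suc n)
    have "y [^] Suc n = y \<otimes> y [^] n" using y nat_pow_Suc2 by blast
    moreover have "(\<phi> ^^ Suc n) x = y \<otimes> (y [^] n \<otimes> x \<otimes> inv (y [^] n)) \<otimes> inv y"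
      by (simp only: funpow.simps o_apply Suc \<phi>_def)
    ultimately show ?case
      using x y by (simp only: inv_mult_group nat_pow_closed) (simp add: m_assoc)
  qed (use x in simp)
  have "\<phi> x [^] p = \<phi> (x [^] p)" using hom_nat_pow[OF hom x(1) is_group is_group] by simp
  also have "\<dots> = \<one>" using x pow_ord_eq_1[of x] y by (simp add: \<phi>_def)
  finally obtain k :: nat where k: "\<phi> x = x [^] k"
    using unique_prime_subgroup[OF p fin _ x, of "\<phi> x"] ord_G qp p0 x y by (auto simp: \<phi>_def)
  have "\<not> q dvd p - 1"
    using np p0 by (simp add: cong_altdef_nat)
  then have "coprime q (p - 1)" using prime_imp_coprime[OF q] by blast
  moreover have "(\<phi> ^^ q) x = x" using iter[of q] x y pow_ord_eq_1[of y] by simp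
  ultimately have "\<phi> x = x" using fixed_of_coprime_order[OF p x hom k] q0 by blast
  then have "y \<otimes> x \<otimes> inv y \<otimes> y = x \<otimes> y" by (simp add: \<phi>_def)
  then have comm: "x \<otimes> y = y \<otimes> x" using x y by (simp add: m_assoc)
  let ?h = "\<lambda>(n, m). x [^] (n :: nat) \<otimes> y [^] (m :: nat)"
  \<comment> \<open>The q-th power removes the \<open>y\<close>-part and recovers \<open>n\<close>,
    as q is invertible modulo p.\<close>
  have pow_q: "(x [^] n \<otimes> y [^] m) [^] q = x [^] (n * q)" for n m :: nat
  proof -
    have c: "x [^] n \<otimes> y [^] m = y [^] m \<otimes> x [^] n"
      using comm x y by (metis group_commutes_pow nat_pow_closed)
    have "(x [^] n \<otimes> y [^] m) [^] q = x [^] (n * q) \<otimes> y [^] (m * q)"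
      using pow_mult_distrib[OF c] x y by (simp add: nat_pow_pow)
    moreover have "y [^] (m * q) = \<one>" using y by (simp add: pow_eq_id)
    ultimately show ?thesis using x by simp
  qed
  have "inj_on ?h ({..<p} \<times> {..<q})"
  proof (rule inj_onI, clarify)
    fix n m n' m' assume nm: "n < p" "n' < p" "m < q" "m' < q"
      and eq: "x [^] n \<otimes> y [^] m = x [^] n' \<otimes> y [^] m'"
    then have "x [^] (n * q) = x [^] (n' * q)" using pow_q by metis
    then have "[n * q = n' * q] (mod p)" using pow_eq_iff[OF x(1)] x(2) by simp
    moreover have "coprime q p" using qp p q by (metis nat_neq_iff primes_coprime)
    ultimately have "[n = n'] (mod p)" by (simp only: cong_mult_rcancel_nat)
    then have n: "n = n'" using nm cong_less_modulus_unique_nat by blast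
    then have "y [^] m = y [^] m'" using eq x y by simp
    then have "[m = m'] (mod q)" using pow_eq_iff[OF y(1)] y(2) by simp
    then show "n = n' \<and> m = m'" using n nm cong_less_modulus_unique_nat by blast
  qed
  moreover have "?h ` ({..<p} \<times> {..<q}) \<subseteq> carrier G" using x y by auto
  ultimately have "bij_betw ?h ({..<p} \<times> {..<q}) (carrier G)"
    using fin ord_G by (simp add: bij_betw_def card_image card_subset_eq card_cartesian_product order_def)
  then show thesis using that x y comm by blast
qed

text \<open>The formula for iterates turns the order of an element of the circle group into a bound
  on the order of its \<open>lambda_op\<close>, which forces triviality below.\<close>

lemma lambda_op_properties:
  assumes A: "skew_left_brace A"
  shows "\<And>x. x \<in> carrier A \<Longrightarrow> lambda_op A x \<in> hom A A"
    and "\<And>x y n. x \<in> carrier A \<Longrightarrow> y \<in> carrier A \<Longrightarrow>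
      (lambda_op A x ^^ n) y = lambda_op A (x [^]\<^bsub>circ_group A\<^esub> (n :: nat)) y"
    and "\<And>y. y \<in> carrier A \<Longrightarrow> lambda_op A \<one>\<^bsub>circ_group A\<^esub> y = y"
proof -
  note D = skew_left_braceD[OF A]
  interpret A: group A by (rule D)
  interpret C: group "circ_group A" by (rule D)
  note cl = D(3)
  have dist: "x \<star>\<^bsub>A\<^esub> (y \<otimes>\<^bsub>A\<^esub> z) = (x \<star>\<^bsub>A\<^esub> y) \<otimes>\<^bsub>A\<^esub> inv\<^bsub>A\<^esub> x \<otimes>\<^bsub>A\<^esub> (x \<star>\<^bsub>A\<^esub> z)"
    if "x \<in> carrier A" "y \<in> carrier A" "z \<in> carrier A" for x y z
    using A that by (simp add: skew_left_brace_def)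
  \<comment> \<open>Distributivity with both summands the additive unit reads e = e x^-1 e for e = x
    \<star> 1, hence e = x. Consequently the two units coincide.\<close>
  have x1: "x \<star>\<^bsub>A\<^esub> \<one>\<^bsub>A\<^esub> = x" if x: "x \<in> carrier A" for x
  proof -
    let ?e = "x \<star>\<^bsub>A\<^esub> \<one>\<^bsub>A\<^esub>"
    have e: "?e \<in> carrier A" using cl x by simp
    have "?e \<otimes>\<^bsub>A\<^esub> \<one>\<^bsub>A\<^esub> = ?e \<otimes>\<^bsub>A\<^esub> (inv\<^bsub>A\<^esub> x \<otimes>\<^bsub>A\<^esub> ?e)"
      using dist[OF x A.one_closed A.one_closed] e x by (simp add: A.m_assoc)
    then have "\<one>\<^bsub>A\<^esub> = inv\<^bsub>A\<^esub> x \<otimes>\<^bsub>A\<^esub> ?e" using e x by (simp del: A.r_one)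
    then have "x \<otimes>\<^bsub>A\<^esub> \<one>\<^bsub>A\<^esub> = x \<otimes>\<^bsub>A\<^esub> (inv\<^bsub>A\<^esub> x \<otimes>\<^bsub>A\<^esub> ?e)" by simp
    then show ?thesis using e x by (simp add: A.m_assoc[symmetric])
  qed
  have one: "\<one>\<^bsub>circ_group A\<^esub> = \<one>\<^bsub>A\<^esub>"
    using x1[of "\<one>\<^bsub>circ_group A\<^esub>"] C.l_one[of "\<one>\<^bsub>A\<^esub>"] C.one_closed by simp
  show hom: "lambda_op A x \<in> hom A A" if x: "x \<in> carrier A" for x
  proof (rule homI)
    fix y z assume yz: "y \<in> carrier A" "z \<in> carrier A"
    show "lambda_op A x (y \<otimes>\<^bsub>A\<^esub> z) = lambda_op A x y \<otimes>\<^bsub>A\<^esub> lambda_op A x z"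
      using dist[OF x yz] cl x yz by (simp add: lambda_op_def A.m_assoc)
  qed (use D(4) x in simp)
  show id: "lambda_op A \<one>\<^bsub>circ_group A\<^esub> y = y" if y: "y \<in> carrier A" for y
    using C.l_one[of y] y by (simp add: lambda_op_def one)
  have comp: "lambda_op A x (lambda_op A y z) = lambda_op A (x \<star>\<^bsub>A\<^esub> y) z"
    if xyz: "x \<in> carrier A" "y \<in> carrier A" "z \<in> carrier A" for x y z
  proof -
    let ?xy = "x \<star>\<^bsub>A\<^esub> y" and ?l = "lambda_op A x"
    have lcl: "?l w \<in> carrier A" if "w \<in> carrier A" for w using D(4) xyz that by simp
    have z: "lambda_op A y z \<in> carrier A" "y \<star>\<^bsub>A\<^esub> z \<in> carrier A" "?xy \<in> carrier A"
      using D(3,4) xyz by auto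
    \<comment> \<open>Both sides are compared after right multiplication by \<open>?xy\<close>,
      which equals \<open>?l y\<close> times \<open>x\<close>; then associativity of the circle
      product applies.\<close>
    have "?l (lambda_op A y z) \<otimes>\<^bsub>A\<^esub> ?xy = ?l (lambda_op A y z) \<otimes>\<^bsub>A\<^esub> (?l y \<otimes>\<^bsub>A\<^esub> x)"
      using D(5) xyz by simp
    also have "\<dots> = ?l (lambda_op A y z \<otimes>\<^bsub>A\<^esub> y) \<otimes>\<^bsub>A\<^esub> x"
      using hom_mult[OF hom[OF xyz(1)] z(1) xyz(2)] lcl xyz z by (simp add: A.m_assoc)
    also have "\<dots> = x \<star>\<^bsub>A\<^esub> (y \<star>\<^bsub>A\<^esub> z)"
      using D(5) xyz z by simp
    also have "\<dots> = ?xy \<star>\<^bsub>A\<^esub> z" using C.m_assoc[of x y z] xyz by simp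
    also have "\<dots> = lambda_op A ?xy z \<otimes>\<^bsub>A\<^esub> ?xy" using D(5) xyz z by simp
    finally show ?thesis using A.right_cancel lcl z D(4) xyz by simp
  qed
  show "(lambda_op A x ^^ n) y = lambda_op A (x [^]\<^bsub>circ_group A\<^esub> n) y"
    if xy: "x \<in> carrier A" "y \<in> carrier A" for x y and n :: nat
  proof (induction n)
    case (Suc n)
    have "x [^]\<^bsub>circ_group A\<^esub> n \<in> carrier A" using C.nat_pow_closed xy by simp
    moreover have "x [^]\<^bsub>circ_group A\<^esub> Suc n = x \<star>\<^bsub>A\<^esub> (x [^]\<^bsub>circ_group A\<^esub> n)"
      using C.nat_pow_Suc2[of x n] xy by simp
    ultimately show ?case using Suc comp xy by simp
  qed (use id xy in simp)
qed

text \<open>The additive group is Z_p times Z_q. Each \<open>lambda_op\<close> preserves both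
  factors, and its p q-th iterate is the identity, while p q is coprime to p - 1 and to q - 1. So it
  is trivial, and the circle product is addition.\<close>

lemma brace_iso_B_if_not_cong:
  assumes p: "prime p" and q: "prime q" and qp: "q < p" and np: "\<not> [p = 1] (mod q)"
    and A: "skew_left_brace A" and ord_A: "order A = p * q"
  shows "brace_iso A (brace_B p q)"
proof -
  note D = skew_left_braceD[OF A]
  interpret A: group A by (rule D)
  interpret C: group "circ_group A" by (rule D)
  have p0: "0 < p" and q0: "0 < q" using prime_gt_0_nat[OF p] prime_gt_0_nat[OF q] .
  have fin: "finite (carrier A)" using ord_A p0 q0 A.order_gt_0_iff_finite by simp
  let ?X = "{..<p} \<times> {..<q}"
  obtain x y where x: "x \<in> carrier A" "A.ord x = p" and y: "y \<in> carrier A" "A.ord y = q"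
    and comm: "x \<otimes>\<^bsub>A\<^esub> y = y \<otimes>\<^bsub>A\<^esub> x"
    and bij: "bij_betw (\<lambda>(n, m). x [^]\<^bsub>A\<^esub> n \<otimes>\<^bsub>A\<^esub> y [^]\<^bsub>A\<^esub> m) ?X (carrier A)"
    using A.pq_structure[OF p q qp np ord_A] by blast
  define h where "h = (\<lambda>(n, m). x [^]\<^bsub>A\<^esub> (n :: nat) \<otimes>\<^bsub>A\<^esub> y [^]\<^bsub>A\<^esub> (m :: nat))"
  have bij: "bij_betw h ?X (carrier A)" using bij by (simp add: h_def)
  have yx: "y [^]\<^bsub>A\<^esub> m \<otimes>\<^bsub>A\<^esub> x [^]\<^bsub>A\<^esub> n = x [^]\<^bsub>A\<^esub> n \<otimes>\<^bsub>A\<^esub> y [^]\<^bsub>A\<^esub> m" for n m :: nat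
    using comm x y by (metis A.group_commutes_pow A.nat_pow_closed)
  have h_mult: "h u \<otimes>\<^bsub>A\<^esub> h v = h (dir_op p q u v)" for u v
  proof -
    obtain n m s t where uv: "u = (n, m)" "v = (s, t)" by (metis surj_pair)
    have "h u \<otimes>\<^bsub>A\<^esub> h v = x [^]\<^bsub>A\<^esub> n \<otimes>\<^bsub>A\<^esub> (y [^]\<^bsub>A\<^esub> m \<otimes>\<^bsub>A\<^esub> x [^]\<^bsub>A\<^esub> s) \<otimes>\<^bsub>A\<^esub> y [^]\<^bsub>A\<^esub> t"
      using x y by (simp add: h_def uv A.m_assoc)
    also have "\<dots> = (x [^]\<^bsub>A\<^esub> n \<otimes>\<^bsub>A\<^esub> x [^]\<^bsub>A\<^esub> s) \<otimes>\<^bsub>A\<^esub> (y [^]\<^bsub>A\<^esub> m \<otimes>\<^bsub>A\<^esub> y [^]\<^bsub>A\<^esub> t)"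
      using x y by (simp add: yx A.m_assoc)
    also have "\<dots> = x [^]\<^bsub>A\<^esub> (n + s) \<otimes>\<^bsub>A\<^esub> y [^]\<^bsub>A\<^esub> (m + t)"
      using x y by (simp add: A.nat_pow_mult)
    also have "x [^]\<^bsub>A\<^esub> (n + s) = x [^]\<^bsub>A\<^esub> ((n + s) mod p)"
      using A.pow_eq_iff[OF x(1)] x(2) by (simp add: cong_def)
    also have "y [^]\<^bsub>A\<^esub> (m + t) = y [^]\<^bsub>A\<^esub> ((m + t) mod q)"
      using A.pow_eq_iff[OF y(1)] y(2) by (simp add: cong_def)
    finally show ?thesis by (simp add: h_def uv dir_op_def)
  qed
  have surj: "\<exists>u\<in>?X. z = h u" if "z \<in> carrier A" for z
    using bij that unfolding bij_betw_def by blast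
  have abelian: "w \<otimes>\<^bsub>A\<^esub> z = z \<otimes>\<^bsub>A\<^esub> w" if wz: "w \<in> carrier A" "z \<in> carrier A" for w z
  proof -
    obtain u v where "w = h u" "z = h v" using surj[OF wz(1)] surj[OF wz(2)] by blast
    then show ?thesis by (simp add: h_mult dir_op_def split_beta add.commute)
  qed
  have lambda_id: "lambda_op A z w = w" if z: "z \<in> carrier A" and w: "w \<in> carrier A" for z w
  proof -
    let ?l = "lambda_op A z"
    note L = lambda_op_properties[OF A]
    have hom: "?l \<in> hom A A" using L(1) z by simp
    have cl: "?l w \<in> carrier A" if "w \<in> carrier A" for w using hom_in_carrier[OF hom that] .
    have pow: "?l (w [^]\<^bsub>A\<^esub> n) = ?l w [^]\<^bsub>A\<^esub> n" if "w \<in> carrier A" for w and n :: nat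
      using hom_nat_pow[OF hom that D(1) D(1)] .
    have l1: "?l \<one>\<^bsub>A\<^esub> = \<one>\<^bsub>A\<^esub>" using hom_one[OF hom D(1) D(1)] .
    have iter: "(?l ^^ (p * q)) w = w" if "w \<in> carrier A" for w
    proof -
      have "z [^]\<^bsub>circ_group A\<^esub> (p * q) = \<one>\<^bsub>circ_group A\<^esub>"
        using C.pow_order_eq_1[of z] z ord_A by (simp add: order_def)
      then show ?thesis using L(2)[OF z that, of "p * q"] L(3)[OF that] by simp
    qed
    have cop: "coprime p (r - 1)" if "prime r" "r \<le> p" for r
      using that prime_gt_1_nat[OF that(1)] by (intro prime_imp_coprime[OF p]) (auto dest: dvd_imp_le)
    have cop_q: "coprime q (p - 1)"
      using np p0 by (intro prime_imp_coprime[OF q]) (simp add: cong_altdef_nat)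
    have cop_q': "coprime q (q - 1)"
      using prime_gt_1_nat[OF q] by (intro prime_imp_coprime[OF q]) (auto dest: dvd_imp_le)
    have "?l x [^]\<^bsub>A\<^esub> p = \<one>\<^bsub>A\<^esub>"
      using pow[OF x(1), of p] x l1 A.pow_ord_eq_1[of x] by simp
    then obtain k :: nat where "?l x = x [^]\<^bsub>A\<^esub> k"
      using A.unique_prime_subgroup[OF p fin _ x cl[OF x(1)]] ord_A qp p0 by auto
    then have lx: "?l x = x"
      using A.fixed_of_coprime_order[OF p x hom _ iter[OF x(1)]] p0 q0 cop[OF p] cop_q by simp
    \<comment> \<open>\<open>unique_prime_subgroup\<close> covers \<open>x\<close> but not
      \<open>y\<close>, since p q > q^2. Instead, the q-th power of the image of \<open>y\<close> is
      the unit, which makes its \<open>x\<close>-part trivial.\<close>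
    obtain n m where nm: "n < p" "m < q" "?l y = x [^]\<^bsub>A\<^esub> n \<otimes>\<^bsub>A\<^esub> y [^]\<^bsub>A\<^esub> m"
      using surj[OF cl[OF y(1)]] by (auto simp: h_def)
    have "\<one>\<^bsub>A\<^esub> = ?l y [^]\<^bsub>A\<^esub> q"
      using pow[OF y(1), of q] y l1 A.pow_ord_eq_1[of y] by simp
    also have "\<dots> = x [^]\<^bsub>A\<^esub> (n * q) \<otimes>\<^bsub>A\<^esub> y [^]\<^bsub>A\<^esub> (m * q)"
      using A.pow_mult_distrib[OF yx[symmetric]] x y by (simp add: nm(3) A.nat_pow_pow)
    also have "y [^]\<^bsub>A\<^esub> (m * q) = \<one>\<^bsub>A\<^esub>" using y A.pow_eq_id by simp
    finally have "x [^]\<^bsub>A\<^esub> (n * q) = \<one>\<^bsub>A\<^esub>" using x by simp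
    then have "p dvd n * q" using A.pow_eq_id[OF x(1)] x(2) by simp
    moreover have "\<not> p dvd q" using qp q0 by (auto dest: dvd_imp_le)
    ultimately have "p dvd n" using p by (simp add: prime_dvd_mult_iff)
    then have "n = 0" using nm(1) by (auto dest: dvd_imp_le)
    then have "?l y = y [^]\<^bsub>A\<^esub> m" using nm(3) y by simp
    then have ly: "?l y = y"
      using A.fixed_of_coprime_order[OF q y hom _ iter[OF y(1)]] p0 q0 cop[OF q] cop_q' qp by simp
    obtain n m where "w = x [^]\<^bsub>A\<^esub> (n :: nat) \<otimes>\<^bsub>A\<^esub> y [^]\<^bsub>A\<^esub> (m :: nat)"
      using surj[OF w] by (auto simp: h_def)
    then show ?thesis using hom_mult[OF hom] x y pow lx ly by simp
  qed
  have circ: "z \<star>\<^bsub>A\<^esub> w = z \<otimes>\<^bsub>A\<^esub> w" if "z \<in> carrier A" "w \<in> carrier A" for z w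
    using D(5)[OF that] lambda_id[OF that] abelian[OF that] by simp
  define f where "f = inv_into ?X h"
  have fbij: "bij_betw f (carrier A) ?X" unfolding f_def using bij by (rule bij_betw_inv_into)
  have hf: "h (f z) = z" if "z \<in> carrier A" for z
    unfolding f_def using bij that by (rule bij_betw_inv_into_right)
  have fh: "f (h u) = u" if "u \<in> ?X" for u
    unfolding f_def using bij that by (rule bij_betw_inv_into_left)
  have f_mult: "f (z \<otimes>\<^bsub>A\<^esub> w) = dir_op p q (f z) (f w)" if "z \<in> carrier A" "w \<in> carrier A" for z w
  proof -
    have "z \<otimes>\<^bsub>A\<^esub> w = h (dir_op p q (f z) (f w))" using h_mult[of "f z" "f w"] hf that by simp
    moreover have "dir_op p q (f z) (f w) \<in> ?X" using p0 q0 by (simp add: dir_op_def split_beta)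
    ultimately show ?thesis using fh by simp
  qed
  have fX: "f z \<in> ?X" if "z \<in> carrier A" for z using fbij that by (auto simp: bij_betw_def)
  have "f \<in> iso A (brace_B p q)" "f \<in> iso (circ_group A) (circ_group (brace_B p q))"
    using f_mult fbij fX by (auto simp: iso_def hom_def brace_B_def pq_brace_def circ)
  then show ?thesis by (auto simp: brace_iso_def)
qed

section \<open>The counts\<close>

text \<open>Each brace is put into one of the two shapes treated above, with exponents such as
  \<open>0 * m\<close> left standing to display the parameters. \<open>D\<close> and
  \<open>E\<close> are the value 1 of the parameters of \<open>F\<close> and \<open>G\<close>. For
  \<open>B\<close> the base is 1, a choice that makes sense for all p and q.\<close>

lemma brace_eqs:
  "brace_B p q = pq_brace p q
     (\<lambda>(n, m) (s, t). ((n + 1 ^ (0 * m) * s) mod p, (m + t) mod q))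
     (\<lambda>(n, m) (s, t). ((1 ^ (0 * t) * n + 1 ^ (0 * m) * s) mod p, (m + t) mod q))"
  "brace_C p q g = pq_brace p q
     (\<lambda>(n, m) (s, t). ((n + g ^ (0 * m) * s) mod p, (m + t) mod q))
     (\<lambda>(n, m) (s, t). ((g ^ (0 * t) * n + g ^ (1 * m) * s) mod p, (m + t) mod q))"
  "brace_D p q g = brace_F p q g 1"
  "brace_E p q g = brace_G p q g 1"
  "brace_F p q g \<gamma> = pq_brace p q
     (\<lambda>(n, m) (s, t). ((n + g ^ m * s) mod p, (m + t) mod q))
     (\<lambda>(n, m) (s, t). ((n + g ^ (\<gamma> * m) * s) mod p, (m + t) mod q))"
  "brace_G p q g \<gamma> = pq_brace p q
     (\<lambda>(n, m) (s, t). ((n + g ^ (1 * m) * s) mod p, (m + t) mod q))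
     (\<lambda>(n, m) (s, t). ((g ^ (1 * t) * n + g ^ (\<gamma> * m) * s) mod p, (m + t) mod q))"
  by (simp_all add: brace_B_def brace_C_def brace_D_def brace_E_def brace_F_def brace_G_def
      dir_op_def semidir_op_def power_mult)

text \<open>With base 1 the action is trivial and every character of \<open>N\<close> is an orbit by
  itself. This holds for every residue of p modulo q, so it serves both halves of the
  theorem.\<close>

lemma num_reps_B:
  assumes "0 < p" "0 < q" "skew_left_brace A" "brace_iso A (brace_B p q)"
  shows "cseq.num_reps A 1 = p\<^sup>2 * q\<^sup>2"
proof -
  have "orb p q 1 0 0 0 c = {c}" if "c \<in> {..<p} \<times> {..<p}" for c
    using assms(1,2) that by (auto simp: orb_def torus_act_def)
  then have "{c \<in> {..<p} \<times> {..<p}. card (orb p q 1 0 0 0 c) = 1} = {..<p} \<times> {..<p}" by auto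
  moreover have "cseq.num_irreps A 1 * 1\<^sup>2 =
      card {c \<in> {..<p} \<times> {..<p}. card (orb p q 1 0 0 0 c) = 1} * q\<^sup>2"
    using assms by (intro num_irreps_linear_circ) (simp_all add: brace_eqs(1))
  ultimately show ?thesis
    unfolding cseq.num_reps_1 by (simp add: card_cartesian_product power2_eq_square)
qed

context
  fixes p q g :: nat and A :: "'a skew_brace"
  assumes p: "prime p" and q: "prime q" and g: "ord p g = q" and A: "skew_left_brace A"
begin

lemma num_irreps_C:
  "brace_iso A (brace_C p q g) \<Longrightarrow>
    cseq.num_irreps A k * k\<^sup>2 = card {c \<in> {..<p} \<times> {..<p}. card (orb p q g 0 1 1 c) = k} * q\<^sup>2"
  using num_irreps_linear_circ[OF prime_gt_0_nat[OF p] prime_gt_0_nat[OF q] power_q_cong_1[OF p q g] A, of 0 1 1 k]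
  by (simp add: brace_eqs(2))

lemma num_irreps_F:
  "brace_iso A (brace_F p q g \<gamma>) \<Longrightarrow>
    cseq.num_irreps A k * k\<^sup>2 = card {c \<in> {..<p} \<times> {..<p}. card (orb p q g 1 \<gamma> \<gamma> c) = k} * q\<^sup>2"
  using num_irreps_semidirect_circ[OF prime_gt_0_nat[OF p] prime_gt_0_nat[OF q] power_q_cong_1[OF p q g] A, of \<gamma> k]
  by (simp add: brace_eqs(5))

text \<open>The second weight is \<mu> - 1 modulo q, with \<open>q - 1\<close> in place of
  -1.\<close>

lemma num_irreps_G:
  "brace_iso A (brace_G p q g \<mu>) \<Longrightarrow>
    cseq.num_irreps A k * k\<^sup>2 =
      card {c \<in> {..<p} \<times> {..<p}. card (orb p q g 1 \<mu> (\<mu> + (q - 1)) c) = k} * q\<^sup>2"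
  using num_irreps_linear_circ[OF prime_gt_0_nat[OF p] prime_gt_0_nat[OF q] power_q_cong_1[OF p q g] A, of 1 \<mu> _ k]
  by (simp add: brace_eqs(6))

lemma counts_C:
  assumes "brace_iso A (brace_C p q g)"
  shows "cseq.num_reps A 1 = q\<^sup>2" "cseq.num_irreps A q = p\<^sup>2 - 1"
  using num_irreps_C[OF assms, of 1] num_irreps_C[OF assms, of q] prime_gt_0_nat[OF q]
  unfolding card_orb_eq_equal_weights[OF p q g] cseq.num_reps_1 by auto

text \<open>For k = q the two squares cancel; for k = q^2 a factor q^2 remains on the left. The
  quotient is stated over the reals, where division does not truncate.\<close>

lemma counts_of_independent_weights:
  assumes "\<And>k. cseq.num_irreps A k * k\<^sup>2 =
      card {c \<in> {..<p} \<times> {..<p}. card (orb p q g 1 d e c) = k} * q\<^sup>2"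
    and "\<not> q dvd e"
  shows "cseq.num_reps A 1 = q\<^sup>2" "cseq.num_irreps A q = 2 * (p - 1)"
    "real (cseq.num_irreps A (q\<^sup>2)) = (real p - 1)\<^sup>2 / (real q)\<^sup>2"
proof -
  have q0: "0 < q" and p1: "1 \<le> p" using prime_gt_0_nat[OF q] prime_gt_0_nat[OF p] by auto
  show "cseq.num_reps A 1 = q\<^sup>2" "cseq.num_irreps A q = 2 * (p - 1)"
    using assms(1)[of 1] assms(1)[of q] q0
    unfolding card_orb_eq_independent_weights[OF p q g assms(2)] cseq.num_reps_1 by auto
  have "cseq.num_irreps A (q\<^sup>2) * q\<^sup>2 * q\<^sup>2 = (p - 1)\<^sup>2 * q\<^sup>2"
    using assms(1)[of "q\<^sup>2"] unfolding card_orb_eq_independent_weights[OF p q g assms(2)]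
    by (simp only: power2_eq_square[of "q\<^sup>2"] mult.assoc)
  then have "cseq.num_irreps A (q\<^sup>2) * q\<^sup>2 = (p - 1)\<^sup>2" using q0 by simp
  then have "real (cseq.num_irreps A (q\<^sup>2)) * (real q)\<^sup>2 = (real (p - 1))\<^sup>2"
    by (metis of_nat_mult of_nat_power)
  then show "real (cseq.num_irreps A (q\<^sup>2)) = (real p - 1)\<^sup>2 / (real q)\<^sup>2"
    using q0 p1 by (simp add: field_simps of_nat_diff)
qed

lemma counts_of_dependent_weights:
  assumes "\<And>k. cseq.num_irreps A k * k\<^sup>2 =
      card {c \<in> {..<p} \<times> {..<p}. card (orb p q g 1 d e c) = k} * q\<^sup>2"
    and "q dvd e"
  shows "cseq.num_reps A 1 = p * q\<^sup>2" "cseq.num_irreps A q = p\<^sup>2 - p"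
  using assms(1)[of 1] assms(1)[of q] prime_gt_0_nat[OF q]
  unfolding card_orb_eq_dependent_weights[OF p q g assms(2)] cseq.num_reps_1 by auto

text \<open>The second weights are \<gamma> for F_\<gamma>, 1 for D = F_1, and \<mu> - 1 for
  G_\<mu>. In the given ranges they lie between 1 and q - 1, so none vanishes modulo q.\<close>

lemma counts_D_F_G:
  assumes "brace_iso A (brace_D p q g) \<or>
    (\<exists>\<gamma>. 1 < \<gamma> \<and> \<gamma> < q \<and> brace_iso A (brace_F p q g \<gamma>)) \<or>
    (\<exists>\<mu>. 1 < \<mu> \<and> \<mu> \<le> q \<and> brace_iso A (brace_G p q g \<mu>))"
  shows "cseq.num_reps A 1 = q\<^sup>2" "cseq.num_irreps A q = 2 * (p - 1)"
    "real (cseq.num_irreps A (q\<^sup>2)) = (real p - 1)\<^sup>2 / (real q)\<^sup>2"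
proof -
  have q1: "1 < q" by (rule prime_gt_1_nat[OF q])
  consider \<gamma> where "0 < \<gamma>" "\<gamma> < q" "brace_iso A (brace_F p q g \<gamma>)"
    | \<mu> where "1 < \<mu>" "\<mu> \<le> q" "brace_iso A (brace_G p q g \<mu>)"
    using assms q1 unfolding brace_eqs(3) by (meson less_trans zero_less_one)
  then have "\<exists>d e. \<not> q dvd e \<and> (\<forall>k. cseq.num_irreps A k * k\<^sup>2 =
      card {c \<in> {..<p} \<times> {..<p}. card (orb p q g 1 d e c) = k} * q\<^sup>2)"
  proof cases
    case 1
    then show ?thesis using num_irreps_F nat_dvd_not_less by blast
  next
    case 2
    have "\<not> q dvd \<mu> - 1" using 2 by (auto dest: dvd_imp_le)
    moreover have "\<mu> + (q - 1) = (\<mu> - 1) + q" using 2 q1 by simp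
    ultimately have "\<not> q dvd \<mu> + (q - 1)" by (simp only: dvd_add_triv_right_iff not_False_eq_True)
    then show ?thesis using num_irreps_G[OF 2(3)] by blast
  qed
  then obtain d e where de: "\<not> q dvd e" "\<And>k. cseq.num_irreps A k * k\<^sup>2 =
      card {c \<in> {..<p} \<times> {..<p}. card (orb p q g 1 d e c) = k} * q\<^sup>2" by blast
  note * = counts_of_independent_weights[OF de(2,1)]
  show "cseq.num_reps A 1 = q\<^sup>2" "cseq.num_irreps A q = 2 * (p - 1)"
    "real (cseq.num_irreps A (q\<^sup>2)) = (real p - 1)\<^sup>2 / (real q)\<^sup>2" by (rule *)+
qed

text \<open>Here the second weight is a multiple of q: it is q itself for F_q, and 1 + (q - 1) for E
  = G_1.\<close>

lemma counts_E_F: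
  assumes "brace_iso A (brace_E p q g) \<or> brace_iso A (brace_F p q g q)"
  shows "cseq.num_reps A 1 = p * q\<^sup>2" "cseq.num_irreps A q = p\<^sup>2 - p"
proof -
  have "\<exists>d e. q dvd e \<and> (\<forall>k. cseq.num_irreps A k * k\<^sup>2 =
      card {c \<in> {..<p} \<times> {..<p}. card (orb p q g 1 d e c) = k} * q\<^sup>2)"
    using assms
  proof
    assume "brace_iso A (brace_E p q g)"
    then have G: "brace_iso A (brace_G p q g 1)" by (simp only: brace_eqs(4))
    have "q dvd 1 + (q - 1)" using prime_gt_0_nat[OF q] by simp
    then show ?thesis using num_irreps_G[OF G] by blast
  next
    assume "brace_iso A (brace_F p q g q)"
    then show ?thesis using num_irreps_F dvd_refl by blast
  qed
  then obtain d e where de: "q dvd e" "\<And>k. cseq.num_irreps A k * k\<^sup>2 =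
      card {c \<in> {..<p} \<times> {..<p}. card (orb p q g 1 d e c) = k} * q\<^sup>2" by blast
  note * = counts_of_dependent_weights[OF de(2,1)]
  show "cseq.num_reps A 1 = p * q\<^sup>2" "cseq.num_irreps A q = p\<^sup>2 - p" by (rule *)+
qed

end

theorem theorem1p1:
  fixes A :: "'a skew_brace" and p q :: nat
  assumes "prime p" and "prime q" and "q < p"
    and "skew_left_brace A" and "order A = p * q"
  shows "(\<not> [p = 1] (mod q) \<longrightarrow> cseq.num_reps A 1 = p\<^sup>2 * q\<^sup>2) \<and>
    ([p = 1] (mod q) \<longrightarrow> (\<forall>g<p. ord p g = q \<longrightarrow>
       (brace_iso A (brace_B p q) \<longrightarrow>
          cseq.num_reps A 1 = p\<^sup>2 * q\<^sup>2) \<and>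
       (brace_iso A (brace_C p q g) \<longrightarrow>
          cseq.num_reps A 1 = q\<^sup>2 \<and>
          cseq.num_irreps A q = p\<^sup>2 - 1) \<and>
       (brace_iso A (brace_D p q g) \<or>
        (\<exists>\<gamma>. 1 < \<gamma> \<and> \<gamma> < q \<and> brace_iso A (brace_F p q g \<gamma>)) \<or>
        (\<exists>\<mu>. 1 < \<mu> \<and> \<mu> \<le> q \<and> brace_iso A (brace_G p q g \<mu>)) \<longrightarrow>
          cseq.num_reps A 1 = q\<^sup>2 \<and>
          cseq.num_irreps A q = 2 * (p - 1) \<and>
          real (cseq.num_irreps A (q\<^sup>2)) = (real p - 1)\<^sup>2 / (real q)\<^sup>2) \<and>
       (brace_iso A (brace_E p q g) \<or> brace_iso A (brace_F p q g q) \<longrightarrow>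
          cseq.num_reps A 1 = p * q\<^sup>2 \<and>
          cseq.num_irreps A q = p\<^sup>2 - p)))"
proof (intro conjI impI allI)
  \<comment> \<open>Used twice: under the hypothesis of case (1), and in the first half once the
    brace is known to be \<open>B\<close>.\<close>
  have B: "cseq.num_reps A 1 = p\<^sup>2 * q\<^sup>2" if "brace_iso A (brace_B p q)"
    using num_reps_B[OF prime_gt_0_nat[OF assms(1)] prime_gt_0_nat[OF assms(2)] assms(4) that] .
  then show "cseq.num_reps A 1 = p\<^sup>2 * q\<^sup>2" if "\<not> [p = 1] (mod q)"
    using brace_iso_B_if_not_cong[OF assms(1-3) that assms(4,5)] by blast
  show "cseq.num_reps A 1 = p\<^sup>2 * q\<^sup>2" if "brace_iso A (brace_B p q)"
    using B that .
qed (use counts_C[OF assms(1,2) _ assms(4)] counts_D_F_G[OF assms(1,2) _ assms(4)]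
    counts_E_F[OF assms(1,2) _ assms(4)] in blast)+

end
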